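(* Let $H$ be a semisimple Hopf algebra over an algebraically closed field $k$ of characteristic $0$ and let $N$ be a left coideal subalgebra of $H$. Then the form $(\,|\,)_N$ on $N^*$ defined by $(p|p')_N=\langle p',F_N^{-1}(p)\rangle$ is a non-degenerate symmetric bilinear form on $N^*$, and the irreducible characters of $N$ are orthogonal with respect to it.
   Context: A left coideal subalgebra of $H$ is a unital subalgebra $N$ with $\Delta(N)\subset H\otimes N$; it is a semisimple algebra and has a unique idempotent two-sided integral $\Lambda_N$ ($n\Lambda_N=\Lambda_Nn=\langle\varepsilon,n\rangle\Lambda_N$ for $n\in N$, $\langle\varepsilon,\Lambda_N\rangle=1$). For $a\in H$, $p\in H^*$, $a\rightharpoonup p\in H^*$ is given by $\langle a\rightharpoonup p,a'\rangle=\langle p,a'a\rangle$. Similarly $N$ acts on $N^*$ by $\langle n\rightharpoonup p,n'\rangle=\langle p,n'n\rangle$. Let $\lambda=\chi_H=\sum_i d_i\chi_i\in H^*$, where $\chi_i$ runs over the irreducible characters of $H$ and $d_i=\langle\chi_i,1\rangle$ (the character of the regular representation). Put $\lambda_B=\Lambda_N\rightharpoonup\lambda\in H^*$; it is a nonzero integral of $B=(H^* )^N=\{p\in H^*: n\rightharpoonup p=\langle\varepsilon,n\rangle p\ \forall n\in N\}$, and $\langle\lambda_B,1\rangle\neq0$. The map $F_N:N\to N^*$ is $F_N(n)=\frac{1}{\langle\lambda_B,1\rangle}\,n\rightharpoonup(\lambda_{|N})$; it is bijective. *)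

theory Defs
  imports Complex_Main "HOL-Computational_Algebra.Polynomial"
begin

section \<open>Tensors as formal sums\<close>

text \<open>
  A list \<open>[(a\<^sub>1, b\<^sub>1), \<dots>, (a\<^sub>m, b\<^sub>m)]\<close> stands for the element \<open>\<Sum>\<^sub>i a\<^sub>i \<otimes> b\<^sub>i\<close> of \<open>H \<otimes> H\<close>, and a
  list of triples for an element of \<open>H \<otimes> H \<otimes> H\<close>. Two lists represent the same tensor iff they are
  identified by the usual presentation of the tensor product over \<open>k\<close>: the congruence on
  commutative formal sums generated by the elementary relations below.
\<close>

inductive formal_sum_eq :: "('t list \<Rightarrow> 't list \<Rightarrow> bool) \<Rightarrow> 't list \<Rightarrow> 't list \<Rightarrow> bool"
  for R :: "'t list \<Rightarrow> 't list \<Rightarrow> bool" where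
  base: "R xs ys \<Longrightarrow> formal_sum_eq R xs ys"
| refl: "formal_sum_eq R xs xs"
| sym: "formal_sum_eq R xs ys \<Longrightarrow> formal_sum_eq R ys xs"
| trans: "formal_sum_eq R xs ys \<Longrightarrow> formal_sum_eq R ys zs \<Longrightarrow> formal_sum_eq R xs zs"
| append: "formal_sum_eq R xs xs' \<Longrightarrow> formal_sum_eq R ys ys'
    \<Longrightarrow> formal_sum_eq R (xs @ ys) (xs' @ ys')"
| comm: "formal_sum_eq R (xs @ ys) (ys @ xs)"

inductive tensor2_rel ::
  "('k::field \<Rightarrow> 'h::ab_group_add \<Rightarrow> 'h) \<Rightarrow> ('h \<times> 'h) list \<Rightarrow> ('h \<times> 'h) list \<Rightarrow> bool"
  for scale :: "'k \<Rightarrow> 'h \<Rightarrow> 'h" where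
  zero: "tensor2_rel scale [(0, b)] []"
| add_left: "tensor2_rel scale [(a + a', b)] [(a, b), (a', b)]"
| add_right: "tensor2_rel scale [(a, b + b')] [(a, b), (a, b')]"
| balanced: "tensor2_rel scale [(scale c a, b)] [(a, scale c b)]"

inductive tensor3_rel ::
  "('k::field \<Rightarrow> 'h::ab_group_add \<Rightarrow> 'h) \<Rightarrow> ('h \<times> 'h \<times> 'h) list \<Rightarrow> ('h \<times> 'h \<times> 'h) list \<Rightarrow> bool"
  for scale :: "'k \<Rightarrow> 'h \<Rightarrow> 'h" where
  zero: "tensor3_rel scale [(0, b, c)] []"
| add_1: "tensor3_rel scale [(a + a', b, c)] [(a, b, c), (a', b, c)]"
| add_2: "tensor3_rel scale [(a, b + b', c)] [(a, b, c), (a, b', c)]"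
| add_3: "tensor3_rel scale [(a, b, c + c')] [(a, b, c), (a, b, c')]"
| balanced_12: "tensor3_rel scale [(scale r a, b, c)] [(a, scale r b, c)]"
| balanced_23: "tensor3_rel scale [(a, scale r b, c)] [(a, b, scale r c)]"

abbreviation tensor2_eq ::
  "('k::field \<Rightarrow> 'h::ab_group_add \<Rightarrow> 'h) \<Rightarrow> ('h \<times> 'h) list \<Rightarrow> ('h \<times> 'h) list \<Rightarrow> bool"
  where "tensor2_eq scale \<equiv> formal_sum_eq (tensor2_rel scale)"

abbreviation tensor3_eq ::
  "('k::field \<Rightarrow> 'h::ab_group_add \<Rightarrow> 'h) \<Rightarrow> ('h \<times> 'h \<times> 'h) list \<Rightarrow> ('h \<times> 'h \<times> 'h) list \<Rightarrow> bool"
  where "tensor3_eq scale \<equiv> formal_sum_eq (tensor3_rel scale)"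


section \<open>Hopf algebras\<close>

locale k_algebra = vector_space scale
  for scale :: "'k::field \<Rightarrow> 'h::ring_1 \<Rightarrow> 'h" +
  assumes scale_mult_left: "scale c (x * y) = scale c x * y"
    and scale_mult_right: "scale c (x * y) = x * scale c y"

text \<open>
  \<open>\<Delta> x\<close> is some formal sum representing the comultiplication of \<open>x\<close>, so every axiom about \<open>\<Delta>\<close> is
  stated up to equality of tensors. Sums over \<open>(a, b) \<leftarrow> \<Delta> x\<close> are Sweedler sums.
\<close>

locale hopf_algebra = k_algebra scale
  for scale :: "'k::field \<Rightarrow> 'h::ring_1 \<Rightarrow> 'h" +
  fixes \<Delta> :: "'h \<Rightarrow> ('h \<times> 'h) list"
    and \<epsilon> :: "'h \<Rightarrow> 'k"
    and S :: "'h \<Rightarrow> 'h"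
  assumes comult_add: "tensor2_eq scale (\<Delta> (x + y)) (\<Delta> x @ \<Delta> y)"
    and comult_scale: "tensor2_eq scale (\<Delta> (scale c x)) [(scale c a, b). (a, b) \<leftarrow> \<Delta> x]"
    and comult_one: "tensor2_eq scale (\<Delta> 1) [(1, 1)]"
    and comult_mult:
      "tensor2_eq scale (\<Delta> (x * y)) [(a * a', b * b'). (a, b) \<leftarrow> \<Delta> x, (a', b') \<leftarrow> \<Delta> y]"
    and coassoc:
      "tensor3_eq scale [(a\<^sub>1, a\<^sub>2, b). (a, b) \<leftarrow> \<Delta> x, (a\<^sub>1, a\<^sub>2) \<leftarrow> \<Delta> a]
                        [(a, b\<^sub>1, b\<^sub>2). (a, b) \<leftarrow> \<Delta> x, (b\<^sub>1, b\<^sub>2) \<leftarrow> \<Delta> b]"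
    and counit_linear: "Vector_Spaces.linear scale (*) \<epsilon>"
    and counit_one: "\<epsilon> 1 = 1"
    and counit_mult: "\<epsilon> (x * y) = \<epsilon> x * \<epsilon> y"
    and counit_left: "(\<Sum>(a, b) \<leftarrow> \<Delta> x. scale (\<epsilon> a) b) = x"
    and counit_right: "(\<Sum>(a, b) \<leftarrow> \<Delta> x. scale (\<epsilon> b) a) = x"
    and antipode_linear: "Vector_Spaces.linear scale scale S"
    and antipode_left: "(\<Sum>(a, b) \<leftarrow> \<Delta> x. S a * b) = scale (\<epsilon> x) 1"
    and antipode_right: "(\<Sum>(a, b) \<leftarrow> \<Delta> x. a * S b) = scale (\<epsilon> x) 1"

definition is_left_ideal :: "('k::field \<Rightarrow> 'h::ring_1 \<Rightarrow> 'h) \<Rightarrow> 'h set \<Rightarrow> bool" where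
  "is_left_ideal scale L \<longleftrightarrow> module.subspace scale L \<and> (\<forall>x. \<forall>y\<in>L. x * y \<in> L)"

text \<open>Semisimplicity of the regular module: every left ideal is a direct summand.\<close>

definition semisimple_algebra :: "('k::field \<Rightarrow> 'h::ring_1 \<Rightarrow> 'h) \<Rightarrow> bool" where
  "semisimple_algebra scale \<longleftrightarrow>
     k_algebra scale \<and>
     (\<forall>L. is_left_ideal scale L \<longrightarrow>
        (\<exists>L'. is_left_ideal scale L' \<and> L \<inter> L' = {0} \<and> (\<forall>x. \<exists>y\<in>L. \<exists>z\<in>L'. x = y + z)))"

definition unital_subalgebra :: "('k::field \<Rightarrow> 'h::ring_1 \<Rightarrow> 'h) \<Rightarrow> 'h set \<Rightarrow> bool" where
  "unital_subalgebra scale N \<longleftrightarrow>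
     module.subspace scale N \<and> 1 \<in> N \<and> (\<forall>x\<in>N. \<forall>y\<in>N. x * y \<in> N)"

definition left_coideal_subalgebra ::
  "('k::field \<Rightarrow> 'h::ring_1 \<Rightarrow> 'h) \<Rightarrow> ('h \<Rightarrow> ('h \<times> 'h) list) \<Rightarrow> 'h set \<Rightarrow> bool" where
  "left_coideal_subalgebra scale \<Delta> N \<longleftrightarrow>
     unital_subalgebra scale N \<and>
     (\<forall>n\<in>N. \<exists>xs. tensor2_eq scale (\<Delta> n) xs \<and> (\<forall>(a, b)\<in>set xs. b \<in> N))"


section \<open>Representations and characters\<close>

text \<open>
  On an infinite-dimensional space this yields a junk value. It is only used for spaces that are
  automatically finite-dimensional: a semisimple Hopf algebra and irreducible modules over its
  left coideal subalgebras.
\<close>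

definition lin_trace :: "('k::field \<Rightarrow> 'v::ab_group_add \<Rightarrow> 'v) \<Rightarrow> ('v \<Rightarrow> 'v) \<Rightarrow> 'k" where
  "lin_trace scale f =
     (let B = vector_space.extend_basis scale {} in \<Sum>b\<in>B. module.representation scale B (f b) b)"

text \<open>The values of \<open>\<rho>\<close> outside \<open>N\<close> are irrelevant.\<close>

definition is_representation ::
  "('k::field \<Rightarrow> 'h::ring_1 \<Rightarrow> 'h) \<Rightarrow> 'h set \<Rightarrow> ('k \<Rightarrow> 'v::ab_group_add \<Rightarrow> 'v) \<Rightarrow> ('h \<Rightarrow> 'v \<Rightarrow> 'v) \<Rightarrow> bool"
  where
  "is_representation scale N scaleV \<rho> \<longleftrightarrow>
     vector_space scaleV \<and>
     (\<forall>n\<in>N. Vector_Spaces.linear scaleV scaleV (\<rho> n)) \<and>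
     (\<forall>m\<in>N. \<forall>n\<in>N. \<forall>v. \<rho> (m + n) v = \<rho> m v + \<rho> n v) \<and>
     (\<forall>c. \<forall>n\<in>N. \<forall>v. \<rho> (scale c n) v = scaleV c (\<rho> n v)) \<and>
     (\<forall>v. \<rho> 1 v = v) \<and>
     (\<forall>m\<in>N. \<forall>n\<in>N. \<forall>v. \<rho> (m * n) v = \<rho> m (\<rho> n v))"

definition irreducible_representation ::
  "('k::field \<Rightarrow> 'h::ring_1 \<Rightarrow> 'h) \<Rightarrow> 'h set \<Rightarrow> ('k \<Rightarrow> 'v::ab_group_add \<Rightarrow> 'v) \<Rightarrow> ('h \<Rightarrow> 'v \<Rightarrow> 'v) \<Rightarrow> bool"
  where
  "irreducible_representation scale N scaleV \<rho> \<longleftrightarrow>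
     is_representation scale N scaleV \<rho> \<and>
     (\<exists>v::'v. v \<noteq> 0) \<and>
     (\<forall>W. module.subspace scaleV W \<and> (\<forall>n\<in>N. \<forall>w\<in>W. \<rho> n w \<in> W) \<longrightarrow> W = {0} \<or> W = UNIV)"


section \<open>The form on the dual of a left coideal subalgebra\<close>

text \<open>
  An element of \<open>N\<^sup>*\<close> is encoded as a function on all of \<open>H\<close> that is linear on \<open>N\<close> and vanishes
  outside \<open>N\<close>, so that distinct functions are distinct functionals and the vector space
  operations of \<open>N\<^sup>*\<close> are the pointwise ones.
\<close>

definition dual_space :: "('k::field \<Rightarrow> 'h::ab_group_add \<Rightarrow> 'h) \<Rightarrow> 'h set \<Rightarrow> ('h \<Rightarrow> 'k) set" where
  "dual_space scale N =
     {p. (\<forall>x\<in>N. \<forall>y\<in>N. p (x + y) = p x + p y) \<and> (\<forall>c. \<forall>x\<in>N. p (scale c x) = c * p x) \<and>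
         (\<forall>x. x \<notin> N \<longrightarrow> p x = 0)}"

definition restrict_to :: "'h set \<Rightarrow> ('h \<Rightarrow> 'k::zero) \<Rightarrow> 'h \<Rightarrow> 'k" where
  "restrict_to N p = (\<lambda>x. if x \<in> N then p x else 0)"

text \<open>\<open>hit N n p\<close> is \<open>n \<rightharpoonup> p\<close>, the functional \<open>x \<mapsto> p (x n)\<close> on \<open>N\<close>; the action on \<open>H\<^sup>*\<close> is \<open>hit UNIV\<close>.\<close>

definition hit :: "'h set \<Rightarrow> 'h::times \<Rightarrow> ('h \<Rightarrow> 'k::zero) \<Rightarrow> 'h \<Rightarrow> 'k" where
  "hit N n p = restrict_to N (\<lambda>x. p (x * n))"

definition rep_character ::
  "'h set \<Rightarrow> ('k::field \<Rightarrow> 'v::ab_group_add \<Rightarrow> 'v) \<Rightarrow> ('h \<Rightarrow> 'v \<Rightarrow> 'v) \<Rightarrow> 'h \<Rightarrow> 'k" where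
  "rep_character N scaleV \<rho> = restrict_to N (\<lambda>n. lin_trace scaleV (\<rho> n))"

definition regular_character :: "('k::field \<Rightarrow> 'h::ring_1 \<Rightarrow> 'h) \<Rightarrow> 'h \<Rightarrow> 'k" where
  "regular_character scale = rep_character UNIV scale (*)"

definition is_idempotent_integral :: "('h::ring_1 \<Rightarrow> 'k::field) \<Rightarrow> ('k \<Rightarrow> 'h \<Rightarrow> 'h) \<Rightarrow> 'h set \<Rightarrow> 'h \<Rightarrow> bool"
  where
  "is_idempotent_integral \<epsilon> scale N L \<longleftrightarrow>
     L \<in> N \<and> L * L = L \<and> \<epsilon> L = 1 \<and>
     (\<forall>n\<in>N. n * L = scale (\<epsilon> n) L \<and> L * n = scale (\<epsilon> n) L)"

definition integral_of :: "('k::field \<Rightarrow> 'h::ring_1 \<Rightarrow> 'h) \<Rightarrow> ('h \<Rightarrow> 'k) \<Rightarrow> 'h set \<Rightarrow> 'h" where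
  "integral_of scale \<epsilon> N = (THE L. is_idempotent_integral \<epsilon> scale N L)"

definition lambda_B :: "('k::field \<Rightarrow> 'h::ring_1 \<Rightarrow> 'h) \<Rightarrow> ('h \<Rightarrow> 'k) \<Rightarrow> 'h set \<Rightarrow> 'h \<Rightarrow> 'k" where
  "lambda_B scale \<epsilon> N = hit UNIV (integral_of scale \<epsilon> N) (regular_character scale)"

definition F_map :: "('k::field \<Rightarrow> 'h::ring_1 \<Rightarrow> 'h) \<Rightarrow> ('h \<Rightarrow> 'k) \<Rightarrow> 'h set \<Rightarrow> 'h \<Rightarrow> 'h \<Rightarrow> 'k" where
  "F_map scale \<epsilon> N n =
     (\<lambda>x. 1 / lambda_B scale \<epsilon> N 1 * hit N n (restrict_to N (regular_character scale)) x)"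

definition form_N ::
  "('k::field \<Rightarrow> 'h::ring_1 \<Rightarrow> 'h) \<Rightarrow> ('h \<Rightarrow> 'k) \<Rightarrow> 'h set \<Rightarrow> ('h \<Rightarrow> 'k) \<Rightarrow> ('h \<Rightarrow> 'k) \<Rightarrow> 'k" where
  "form_N scale \<epsilon> N p p' = p' (the_inv_into N (F_map scale \<epsilon> N) p)"

text \<open>Properties of a form on a space \<open>D\<close> of functions with pointwise operations.\<close>

definition bilinear_form_on :: "('h \<Rightarrow> 'k::field) set \<Rightarrow> (('h \<Rightarrow> 'k) \<Rightarrow> ('h \<Rightarrow> 'k) \<Rightarrow> 'k) \<Rightarrow> bool" where
  "bilinear_form_on D \<beta> \<longleftrightarrow>
     (\<forall>p\<in>D. \<forall>q\<in>D. \<forall>r\<in>D. \<beta> (\<lambda>x. p x + q x) r = \<beta> p r + \<beta> q r) \<and>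
     (\<forall>p\<in>D. \<forall>q\<in>D. \<forall>r\<in>D. \<beta> p (\<lambda>x. q x + r x) = \<beta> p q + \<beta> p r) \<and>
     (\<forall>c. \<forall>p\<in>D. \<forall>q\<in>D. \<beta> (\<lambda>x. c * p x) q = c * \<beta> p q) \<and>
     (\<forall>c. \<forall>p\<in>D. \<forall>q\<in>D. \<beta> p (\<lambda>x. c * q x) = c * \<beta> p q)"

definition symmetric_form_on :: "('h \<Rightarrow> 'k::field) set \<Rightarrow> (('h \<Rightarrow> 'k) \<Rightarrow> ('h \<Rightarrow> 'k) \<Rightarrow> 'k) \<Rightarrow> bool" where
  "symmetric_form_on D \<beta> \<longleftrightarrow> (\<forall>p\<in>D. \<forall>q\<in>D. \<beta> p q = \<beta> q p)"

definition nondegenerate_form_on :: "('h \<Rightarrow> 'k::field) set \<Rightarrow> (('h \<Rightarrow> 'k) \<Rightarrow> ('h \<Rightarrow> 'k) \<Rightarrow> 'k) \<Rightarrow> bool" where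
  "nondegenerate_form_on D \<beta> \<longleftrightarrow>
     (\<forall>p\<in>D. (\<forall>q\<in>D. \<beta> p q = 0) \<longrightarrow> p = (\<lambda>_. 0)) \<and>
     (\<forall>q\<in>D. (\<forall>p\<in>D. \<beta> p q = 0) \<longrightarrow> q = (\<lambda>_. 0))"

end

theory Submission
  imports Defs
begin

text \<open>
  Let \<open>\<chi>\<close> be the regular character of \<open>H\<close>. The theorem rests on one fact: the trace form
  \<open>(x, y) \<mapsto> \<chi> (x y)\<close> stays nondegenerate when it is restricted to \<open>N\<close> (\<open>chi_nondegenerate_on\<close>).
  Every functional on \<open>N\<close> is then \<open>\<chi> (- z)\<close> for a unique \<open>z \<in> N\<close>. Representing \<open>\<epsilon>\<close> in this way
  produces the integral of \<open>N\<close> and shows that the normalising scalar \<open>\<kappa> = \<langle>\<lambda>\<^sub>B, 1\<rangle>\<close> is nonzero, so \<open>F\<^sub>N\<close>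
  is bijective. On the images of \<open>m\<close> and \<open>n\<close> the form takes the value \<open>\<chi> (m n) / \<kappa>\<close>, which is
  symmetric because \<open>\<chi>\<close> is a trace. If \<open>V\<close> is irreducible with character \<open>\<chi>\<^sub>V\<close> and
  \<open>u = F\<^sub>N\<inverse> (\<chi>\<^sub>V)\<close>, then \<open>u\<close> is central in \<open>N\<close> and is killed by the annihilator of \<open>V\<close>. Should \<open>u\<close> act
  nontrivially on an irreducible module \<open>W\<close>, the annihilator of \<open>V\<close> would kill \<open>W\<close>, which forces
  \<open>V \<cong> W\<close>; so for different characters \<open>u\<close> acts as \<open>0\<close> on \<open>W\<close> and \<open>(\<chi>\<^sub>V | \<chi>\<^sub>W) = \<chi>\<^sub>W (u) = 0\<close>.
  
  For the nondegeneracy, an element \<open>x\<close> of the radical of the restricted form is nilpotent: in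
  characteristic \<open>0\<close> an element that is not nilpotent yields, through Fitting's lemma, an idempotent of
  nonzero trace. So \<open>\<epsilon>\<close> vanishes on the radical, hence \<open>\<epsilon> = \<chi> (- z)\<close> on \<open>N\<close> for some \<open>z \<in> N\<close>. If \<open>\<chi>\<close>
  is an integral of the dual Hopf algebra, then \<open>\<Sum> S(x\<^sub>1) \<chi> (x\<^sub>2 z) = \<Sum> z\<^sub>1 \<chi> (x z\<^sub>2)\<close>. The right-hand side
  vanishes because \<open>z\<^sub>2\<close> runs through \<open>N\<close>, and the left-hand side then gives
  \<open>x = \<Sum> x\<^sub>1 \<epsilon> (x\<^sub>2) = 0\<close>.
  
  That \<open>\<chi>\<close> is such an integral amounts to the theorem of Larson and Radford that the square of the
  antipode of a semisimple Hopf algebra in characteristic \<open>0\<close> is the identity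
  (\<open>antipode_involutive\<close>). It is proved in three steps. The functional \<open>\<mu> (x) = Tr (h \<mapsto> S\<^sup>2(h) x)\<close> is a
  right integral normalised on the integral of \<open>H\<close>, and comparing it with \<open>\<mu> \<circ> S\<close> shows that \<open>S\<^sup>4\<close> is
  conjugation by a grouplike element \<open>g\<close>, which has finite order. Next, if \<open>\<mu>\<close> vanished on all powers
  of \<open>g\<close>, the decomposition of \<open>Tr (L\<^sub>a R\<^sub>b)\<close> along central idempotents and a rational linear functional
  on the field would turn these equations into a vanishing sum of rational squares, one of which is
  nonzero; hence \<open>g = 1\<close> and \<open>Tr (S\<^sup>2) = \<mu> (1) \<noteq> 0\<close>. Finally convolution by \<open>\<chi>\<close> is \<open>n = dim H\<close> times a
  projection that commutes with \<open>S\<^sup>2\<close>, so \<open>Tr (S\<^sup>2)\<close> is \<open>n\<close> times an integer. It is also a nonzero sum of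
  \<open>n\<close> signs, at least one of them \<open>+1\<close>, so all the signs are \<open>+1\<close>.
\<close>


section \<open>Traces and functionals\<close>

lemma vector_space_field: "vector_space ((*) :: 'k::field \<Rightarrow> 'k \<Rightarrow> 'k)"
  by unfold_locales (simp_all add: algebra_simps)

lemma linear_comp:
  assumes "Vector_Spaces.linear s1 s2 f" "Vector_Spaces.linear s2 s3 p"
  shows "Vector_Spaces.linear s1 s3 (\<lambda>x. p (f x))"
  using assms by (simp add: Vector_Spaces.linear_iff)

context finite_dimensional_vector_space
begin

lemma independent_extend_basis_empty: "independent (extend_basis {})"
  by (rule independent_extend_basis[OF independent_empty])

lemma span_extend_basis_empty: "span (extend_basis {}) = UNIV"
  by (rule span_extend_basis[OF independent_empty])

lemma finite_extend_basis: "finite (extend_basis {})"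
  by (rule finiteI_independent[OF independent_extend_basis_empty])

lemmas extend_basis_facts [simp] =
  independent_extend_basis_empty span_extend_basis_empty finite_extend_basis

text \<open>
  The trace of a sum of rank-one operators. Any expansion may be used, so the properties of the
  trace below follow without reference to the basis in its definition.
\<close>

lemma lin_trace_rank_expansion:
  assumes I: "finite I" and p: "\<And>i. i \<in> I \<Longrightarrow> Vector_Spaces.linear scale (*) (p i)"
    and f: "\<And>x. f x = (\<Sum>i\<in>I. scale (p i x) (v i))"
  shows "lin_trace scale f = (\<Sum>i\<in>I. p i (v i))"
proof -
  define B where "B = extend_basis {}"
  have B: "independent B" "finite B" "span B = UNIV"
    by (auto simp: B_def)
  have "lin_trace scale f = (\<Sum>b\<in>B. representation B (f b) b)"
    unfolding lin_trace_def Let_def B_def by simp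
  also have "\<dots> = (\<Sum>b\<in>B. \<Sum>i\<in>I. p i b * representation B (v i) b)"
    using B by (simp add: f representation_sum representation_scale)
  also have "\<dots> = (\<Sum>i\<in>I. \<Sum>b\<in>B. p i b * representation B (v i) b)"
    by (rule sum.swap)
  also have "\<dots> = (\<Sum>i\<in>I. p i (v i))"
  proof (rule sum.cong[OF HOL.refl])
    fix i assume "i \<in> I"
    then interpret p: Vector_Spaces.linear scale "(*)" "p i" by (rule p)
    have "p i (v i) = p i (\<Sum>b\<in>B. scale (representation B (v i) b) b)"
      using B by (simp add: sum_representation_eq)
    then show "(\<Sum>b\<in>B. p i b * representation B (v i) b) = p i (v i)"
      by (simp add: p.sum p.scale mult.commute)
  qed
  finally show ?thesis .
qed

lemma linear_coordinate:
  assumes "independent B" "span B = UNIV"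
  shows "Vector_Spaces.linear scale (*) (\<lambda>x. representation B x b)"
  using assms by (auto simp: Vector_Spaces.linear_iff representation_add representation_scale vector_space_axioms
      vector_space_field)

lemma coordinates_expand:
  "(\<Sum>b\<in>extend_basis {}. scale (representation (extend_basis {}) x b) b) = x"
  by (simp add: sum_representation_eq)

lemma linear_coord: "Vector_Spaces.linear scale (*) (\<lambda>x. representation (extend_basis {}) x b)"
  by (rule linear_coordinate) simp_all

lemma lin_trace_eq_sum_coords:
  shows "lin_trace scale f = (\<Sum>b\<in>extend_basis {}. representation (extend_basis {}) (f b) b)"
  unfolding lin_trace_def Let_def by simp

lemma lin_trace_commute:
  assumes f: "Vector_Spaces.linear scale scale f" and g: "Vector_Spaces.linear scale scale g"
  shows "lin_trace scale (\<lambda>x. f (g x)) = lin_trace scale (\<lambda>x. g (f x))"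
proof -
  interpret f: Vector_Spaces.linear scale scale f by (rule f)
  interpret g: Vector_Spaces.linear scale scale g by (rule g)
  let ?B = "extend_basis {}"
  let ?r = "representation ?B"
  have "lin_trace scale (\<lambda>x. f (g x)) = (\<Sum>b\<in>?B. ?r (f (g b)) b)"
    by (rule lin_trace_eq_sum_coords)
  moreover have "lin_trace scale (\<lambda>x. g (f x)) = (\<Sum>b\<in>?B. ?r (f (g b)) b)"
  proof (rule lin_trace_rank_expansion[where p = "\<lambda>b x. ?r (f x) b" and v = g])
    show "Vector_Spaces.linear scale (*) (\<lambda>x. ?r (f x) b)" for b
      by (rule linear_comp[OF f linear_coord])
    show "g (f x) = (\<Sum>b\<in>?B. scale (?r (f x) b) (g b))" for x
      using arg_cong[OF coordinates_expand[of "f x"], of g] by (simp add: g.sum g.scale)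
  qed (simp add: finite_extend_basis)
  ultimately show ?thesis by simp
qed

lemma lin_trace_add:
  assumes "Vector_Spaces.linear scale scale f" "Vector_Spaces.linear scale scale g"
  shows "lin_trace scale (\<lambda>x. f x + g x) = lin_trace scale f + lin_trace scale g"
  unfolding lin_trace_def Let_def
  by (simp add: representation_add sum.distrib)

lemma lin_trace_scale:
  "lin_trace scale (\<lambda>x. scale c (f x)) = c * lin_trace scale f"
  unfolding lin_trace_def Let_def
  by (simp add: representation_scale sum_distrib_left)

lemma lin_trace_zero: "lin_trace scale (\<lambda>x. 0) = 0"
  unfolding lin_trace_def Let_def by (simp add: representation_zero)

text \<open>
  The trace of a projection is its rank, by expanding it along a basis of its image. Over a field of
  characteristic \<open>0\<close> this detects whether the projection vanishes; all positivity and integrality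
  arguments below come from this fact.
\<close>

lemma lin_trace_idempotent:
  assumes f: "Vector_Spaces.linear scale scale f" and idem: "\<And>x. f (f x) = f x"
  obtains r where "lin_trace scale f = of_nat r" "r = 0 \<longleftrightarrow> (\<forall>x. f x = 0)"
proof -
  interpret f: Vector_Spaces.linear scale scale f by (rule f)
  have sub: "subspace (range f)"
    using f.subspace_image[of UNIV] by simp
  obtain C where C: "C \<subseteq> range f" "independent C" "range f \<subseteq> span C"
    using basis_exists[of "range f"] by metis
  have fin: "finite C" by (rule finiteI_independent[OF C(2)])
  have spanC: "span C = range f"
    by (rule span_subspace[OF C(1,3) sub])
  have "lin_trace scale f = (\<Sum>c\<in>C. representation C (f c) c)"
  proof (rule lin_trace_rank_expansion[OF fin, where p = "\<lambda>c x. representation C (f x) c" and v = "\<lambda>c. c"])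
    show "Vector_Spaces.linear scale (*) (\<lambda>x. representation C (f x) c)" for c
    proof -
      have "representation C (f (x + y)) c = representation C (f x) c + representation C (f y) c" for x y
        by (simp add: f.add representation_add[OF C(2)] spanC)
      moreover have "representation C (f (scale k x)) c = k * representation C (f x) c" for k x
        by (simp add: f.scale representation_scale[OF C(2)] spanC)
      ultimately show ?thesis
        by (simp add: Vector_Spaces.linear_iff vector_space_axioms vector_space_field)
    qed
    show "f x = (\<Sum>c\<in>C. scale (representation C (f x) c) c)" for x
      using fin C(2) by (simp add: sum_representation_eq spanC)
  qed
  also have "\<dots> = (\<Sum>c\<in>C. 1)"
  proof (rule sum.cong[OF HOL.refl])
    fix c assume c: "c \<in> C"
    then obtain x where "c = f x" using C(1) by blast
    then have "f c = c" by (simp add: idem)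
    then show "representation C (f c) c = 1"
      using representation_basis[OF C(2) c] by simp
  qed
  finally have "lin_trace scale f = of_nat (card C)" by simp
  moreover have "card C = 0 \<longleftrightarrow> (\<forall>x. f x = 0)"
  proof
    assume "card C = 0"
    then have "C = {}" using fin by simp
    then show "\<forall>x. f x = 0" using spanC by auto
  next
    assume "\<forall>x. f x = 0"
    then have "C \<subseteq> {0}" using C(1) by auto
    moreover have "0 \<notin> C" using C(2) dependent_zero by blast
    ultimately have "C = {}" by auto
    then show "card C = 0" by simp
  qed
  ultimately show ?thesis by (rule that)
qed

lemma sequence_recurs:
  fixes s :: "nat \<Rightarrow> 'b"
  obtains r where "s r \<in> span (s ` {..<r})" "independent (s ` {..<r})"
proof -
  define G where "G r = s ` {..<r}" for r :: nat
  have G_Suc: "G (Suc r) = insert (s r) (G r)" for r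
    by (auto simp: G_def lessThan_Suc)
  have fin: "finite (G r)" for r by (simp add: G_def)
  have "\<exists>r. s r \<in> span (G r)"
  proof (rule ccontr)
    assume "\<not> ?thesis"
    then have no: "s r \<notin> span (G r)" for r by blast
    have "independent (G r) \<and> card (G r) = r" for r
    proof (induction r)
      case (Suc r)
      have "s r \<notin> G r" using no[of r] span_base by blast
      then show ?case
        using Suc independent_insertI[OF no[of r]] by (simp add: G_Suc fin)
    qed (simp add: G_def independent_empty)
    then have "independent (G (Suc (dim UNIV)))" "card (G (Suc (dim UNIV))) = Suc (dim UNIV)" by blast+
    then show False
      using independent_card_le_dim[of "G (Suc (dim UNIV))" UNIV] by simp
  qed
  then obtain r where r: "s r \<in> span (G r)" and least: "\<And>i. i < r \<Longrightarrow> s i \<notin> span (G i)"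
    using exists_least_iff[of "\<lambda>r. s r \<in> span (G r)"] by metis
  have "independent (G i)" if "i \<le> r" for i
    using that
  proof (induction i)
    case (Suc i)
    then show ?case using independent_insertI[OF least[of i]] by (simp add: G_Suc)
  qed (simp add: G_def independent_empty)
  then show ?thesis using r that[of r] by (simp add: G_def)
qed

end

text \<open>
  Isomorphic representations have the same character.
\<close>

lemma lin_trace_conjugate:
  fixes s1 :: "'k::field \<Rightarrow> 'a::ab_group_add \<Rightarrow> 'a" and s2 :: "'k \<Rightarrow> 'b::ab_group_add \<Rightarrow> 'b"
  assumes "finite_dimensional_vector_space s1 B1" "finite_dimensional_vector_space s2 B2"
    and phi: "Vector_Spaces.linear s1 s2 \<phi>" and psi: "Vector_Spaces.linear s2 s1 \<psi>"
    and inv: "\<And>x. \<psi> (\<phi> x) = x" "\<And>y. \<phi> (\<psi> y) = y"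
    and f: "Vector_Spaces.linear s1 s1 f" and g: "\<And>x. g (\<phi> x) = \<phi> (f x)"
  shows "lin_trace s2 g = lin_trace s1 f"
proof -
  interpret V: finite_dimensional_vector_space s1 B1 by fact
  interpret W: finite_dimensional_vector_space s2 B2 by fact
  interpret phi: Vector_Spaces.linear s1 s2 \<phi> by fact
  let ?B = "V.extend_basis {}"
  let ?r = "V.representation ?B"
  have "lin_trace s2 g = (\<Sum>b\<in>?B. ?r (f (\<psi> (\<phi> b))) b)"
  proof (rule W.lin_trace_rank_expansion)
    show "finite ?B" by (rule V.finite_extend_basis)
    show "Vector_Spaces.linear s2 (*) (\<lambda>x. ?r (f (\<psi> x)) b)" for b
      using psi linear_comp[OF f V.linear_coord[of b]] by (simp add: Vector_Spaces.linear_iff)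
    show "g y = (\<Sum>b\<in>?B. s2 (?r (f (\<psi> y)) b) (\<phi> b))" for y
      using arg_cong[OF V.coordinates_expand[of "f (\<psi> y)"], of \<phi>] g[of "\<psi> y"]
      by (simp add: phi.sum phi.scale inv)
  qed
  then show ?thesis
    by (simp add: inv V.lin_trace_eq_sum_coords)
qed

text \<open>
  This replaces a dimension count for dual spaces. In the induction, the new functional \<open>q j\<close> is
  removed by passing to its kernel, and the coefficient of \<open>q j\<close> is read off at a vector on
  which \<open>q j\<close> takes the value \<open>1\<close>.
\<close>

lemma (in vector_space) functional_in_span:
  fixes q :: "'i \<Rightarrow> 'b \<Rightarrow> 'a"
  assumes "finite I" "subspace V"
    and "\<And>i x y. i \<in> I \<Longrightarrow> x \<in> V \<Longrightarrow> y \<in> V \<Longrightarrow> q i (x + y) = q i x + q i y"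
    and "\<And>i c x. i \<in> I \<Longrightarrow> x \<in> V \<Longrightarrow> q i (scale c x) = c * q i x"
    and "\<And>x y. x \<in> V \<Longrightarrow> y \<in> V \<Longrightarrow> p (x + y) = p x + p y"
    and "\<And>c x. x \<in> V \<Longrightarrow> p (scale c x) = c * p x"
    and "\<And>x. x \<in> V \<Longrightarrow> (\<And>i. i \<in> I \<Longrightarrow> q i x = 0) \<Longrightarrow> p x = 0"
  shows "\<exists>c. \<forall>x\<in>V. p x = (\<Sum>i\<in>I. c i * q i x)"
  using assms
proof (induction I arbitrary: V rule: finite_induct)
  case empty
  then show ?case by auto
next
  case (insert j I)
  define V' where "V' = {x \<in> V. q j x = 0}"
  have q0: "q j 0 = 0"
    using insert.prems(3)[of j 0 0] subspace_0[OF insert.prems(1)] by simp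
  have sub: "subspace V'"
    unfolding V'_def
    by (rule subspaceI) (use insert.prems(1-3) q0 in \<open>auto simp: subspace_0 subspace_add subspace_scale\<close>)
  have "\<exists>c. \<forall>x\<in>V'. p x = (\<Sum>i\<in>I. c i * q i x)"
  proof (rule insert.IH[OF sub])
    fix x assume "x \<in> V'" "\<And>i. i \<in> I \<Longrightarrow> q i x = 0"
    then show "p x = 0" by (intro insert.prems(6)) (auto simp: V'_def)
  qed (use insert.prems(2-5) in \<open>auto simp: V'_def\<close>)
  then obtain c where c: "\<And>x. x \<in> V' \<Longrightarrow> p x = (\<Sum>i\<in>I. c i * q i x)" by blast
  show ?case
  proof (cases "V' = V")
    case True
    then show ?thesis
      using c insert.hyps by (intro exI[of _ "c(j := 0)"]) (auto intro!: sum.cong)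
  next
    case False
    then obtain v where v: "v \<in> V" "q j v \<noteq> 0" unfolding V'_def by blast
    define u where "u = scale (inverse (q j v)) v"
    have u: "u \<in> V" "q j u = 1"
      using v insert.prems(1) insert.prems(3) by (auto simp: u_def subspace_scale)
    define a where "a = p u - (\<Sum>i\<in>I. c i * q i u)"
    have "p x = a * q j x + (\<Sum>i\<in>I. c i * q i x)" if x: "x \<in> V" for x
    proof -
      define y where "y = x + scale (- q j x) u"
      have sV: "scale (- q j x) u \<in> V" by (rule subspace_scale[OF insert.prems(1) u(1)])
      have yV: "y \<in> V" unfolding y_def by (rule subspace_add[OF insert.prems(1) x sV])
      have qy: "q i y = q i x + (- q j x) * q i u" if "i \<in> insert j I" for i
        unfolding y_def insert.prems(2)[OF that x sV] insert.prems(3)[OF that u(1)] by (rule HOL.refl)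
      have "q j y = 0" using qy[of j] u by simp
      then have "y \<in> V'" using yV u by (simp add: V'_def)
      then have "p y = (\<Sum>i\<in>I. c i * q i y)" by (rule c)
      also have "\<dots> = (\<Sum>i\<in>I. c i * (q i x + (- q j x) * q i u))"
        by (intro sum.cong) (simp_all add: qy)
      also have "\<dots> = (\<Sum>i\<in>I. c i * q i x) - q j x * (\<Sum>i\<in>I. c i * q i u)"
        by (simp add: algebra_simps sum.distrib sum_subtractf sum_distrib_left)
      finally have "p y = (\<Sum>i\<in>I. c i * q i x) - q j x * (\<Sum>i\<in>I. c i * q i u)" .
      moreover have "p y = p x + (- q j x) * p u"
        unfolding y_def insert.prems(4)[OF x sV] insert.prems(5)[OF u(1)] by (rule HOL.refl)
      ultimately show ?thesis by (simp add: a_def algebra_simps)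
    qed
    moreover have "(\<Sum>i\<in>I. (c(j := a)) i * q i x) = (\<Sum>i\<in>I. c i * q i x)" for x
      using insert.hyps by (intro sum.cong) auto
    ultimately show ?thesis
      using insert.hyps by (intro exI[of _ "c(j := a)"]) simp
  qed
qed

section \<open>Sweedler calculus\<close>

lemma formal_sum_eq_sum_list:
  fixes f :: "'t \<Rightarrow> 'x::comm_monoid_add"
  assumes "formal_sum_eq R xs ys"
    and "\<And>us vs. R us vs \<Longrightarrow> sum_list (map f us) = sum_list (map f vs)"
  shows "sum_list (map f xs) = sum_list (map f ys)"
  using assms(1)
proof induction
  case (base us vs)
  then show ?case by (rule assms(2))
qed (simp_all add: add.commute)

lemma sum_list_concat_map:
  fixes f :: "'b \<Rightarrow> 'c::comm_monoid_add"
  shows "sum_list (map f (concat (map g xs))) = (\<Sum>x\<leftarrow>xs. sum_list (map f (g x)))"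
  by (induction xs) auto

lemma sum_list_swap:
  fixes f :: "'a \<Rightarrow> 'h \<Rightarrow> 'c::comm_monoid_add"
  shows "(\<Sum>x\<leftarrow>xs. \<Sum>y\<leftarrow>ys. f x y) = (\<Sum>y\<leftarrow>ys. \<Sum>x\<leftarrow>xs. f x y)"
  by (induction xs) (simp_all add: sum_list_addf)

context k_algebra
begin

definition bilinear_on :: "('k \<Rightarrow> 'x \<Rightarrow> 'x) \<Rightarrow> ('h \<Rightarrow> 'h \<Rightarrow> 'x::ab_group_add) \<Rightarrow> bool" where
  "bilinear_on sX \<beta> \<longleftrightarrow>
     (\<forall>b. Vector_Spaces.linear scale sX (\<lambda>a. \<beta> a b)) \<and> (\<forall>a. Vector_Spaces.linear scale sX (\<beta> a))"

definition trilinear_on :: "('k \<Rightarrow> 'x \<Rightarrow> 'x) \<Rightarrow> ('h \<Rightarrow> 'h \<Rightarrow> 'h \<Rightarrow> 'x::ab_group_add) \<Rightarrow> bool" where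
  "trilinear_on sX \<tau> \<longleftrightarrow>
     (\<forall>b c. Vector_Spaces.linear scale sX (\<lambda>a. \<tau> a b c)) \<and>
     (\<forall>a c. Vector_Spaces.linear scale sX (\<lambda>b. \<tau> a b c)) \<and>
     (\<forall>a b. Vector_Spaces.linear scale sX (\<lambda>c. \<tau> a b c))"

lemma bilinear_onI:
  assumes "\<And>b. Vector_Spaces.linear scale sX (\<lambda>a. \<beta> a b)"
    and "\<And>a. Vector_Spaces.linear scale sX (\<lambda>b. \<beta> a b)"
  shows "bilinear_on sX \<beta>"
  using assms by (simp add: bilinear_on_def)

lemma trilinear_onI:
  assumes "\<And>b c. Vector_Spaces.linear scale sX (\<lambda>a. \<tau> a b c)"
    and "\<And>a c. Vector_Spaces.linear scale sX (\<lambda>b. \<tau> a b c)"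
    and "\<And>a b. Vector_Spaces.linear scale sX (\<lambda>c. \<tau> a b c)"
  shows "trilinear_on sX \<tau>"
  using assms by (simp add: trilinear_on_def)

lemma linear_scaleD: "Vector_Spaces.linear scale sX f \<Longrightarrow> f (scale c x) = sX c (f x)"
  and linear_addD: "Vector_Spaces.linear scale sX f \<Longrightarrow> f (x + y) = f x + f y"
  by (simp_all add: Vector_Spaces.linear_iff)

lemma linear_zeroD: "Vector_Spaces.linear scale sX f \<Longrightarrow> f 0 = 0"
  using linear_addD[of sX f 0 0] by simp

lemma
  assumes "Vector_Spaces.linear scale scale f"
  shows linear_mult_rightI: "Vector_Spaces.linear scale scale (\<lambda>x. f x * y)"
    and linear_mult_leftI: "Vector_Spaces.linear scale scale (\<lambda>x. y * f x)"
    and linear_scaleI: "Vector_Spaces.linear scale scale (\<lambda>x. scale c (f x))"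
  using assms
  by (simp_all add: Vector_Spaces.linear_iff distrib_left distrib_right scale_right_distrib
      scale_mult_left[symmetric] scale_mult_right[symmetric] scale_left_commute)

lemma linear_identI: "Vector_Spaces.linear scale scale (\<lambda>x. x)"
  by (simp add: Vector_Spaces.linear_iff vector_space_axioms)

lemma linear_scale_functionalI:
  assumes "Vector_Spaces.linear scale (*) p"
  shows "Vector_Spaces.linear scale scale (\<lambda>x. scale (p x) y)"
  using assms by (simp add: Vector_Spaces.linear_iff scale_left_distrib vector_space_axioms)

lemma
  assumes "Vector_Spaces.linear scale (*) p"
  shows linear_functional_mult_rightI: "Vector_Spaces.linear scale (*) (\<lambda>x. p x * c)"
    and linear_functional_mult_leftI: "Vector_Spaces.linear scale (*) (\<lambda>x. c * p x)"
  using assms by (simp_all add: Vector_Spaces.linear_iff algebra_simps)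

end

context hopf_algebra
begin

text \<open>
  The Sweedler sum \<open>\<Sum> \<beta> (x\<^sub>1, x\<^sub>2)\<close>. It is independent of the chosen representative of the coproduct
  as soon as \<open>\<beta>\<close> is bilinear, so every axiom on tensors becomes an equation between such sums.
\<close>

definition sw :: "'h \<Rightarrow> ('h \<Rightarrow> 'h \<Rightarrow> 'x::comm_monoid_add) \<Rightarrow> 'x" where
  "sw x \<beta> = (\<Sum>(a, b)\<leftarrow>\<Delta> x. \<beta> a b)"

lemma sum_list_tensor2_eq:
  assumes "tensor2_eq scale xs ys" and \<beta>: "bilinear_on sX \<beta>"
  shows "(\<Sum>(a, b)\<leftarrow>xs. \<beta> a b) = (\<Sum>(a, b)\<leftarrow>ys. \<beta> a b)"
proof (rule formal_sum_eq_sum_list[OF assms(1)])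
  have l: "Vector_Spaces.linear scale sX (\<lambda>a. \<beta> a b)" and r: "Vector_Spaces.linear scale sX (\<beta> a)" for a b
    using \<beta> by (auto simp: bilinear_on_def)
  fix us vs assume "tensor2_rel scale us vs"
  then show "(\<Sum>(a, b)\<leftarrow>us. \<beta> a b) = (\<Sum>(a, b)\<leftarrow>vs. \<beta> a b)"
    by cases (simp_all add: linear_zeroD[OF l] linear_addD[OF l] linear_addD[OF r]
        linear_scaleD[OF l] linear_scaleD[OF r])
qed

lemma sum_list_tensor3_eq:
  assumes "tensor3_eq scale xs ys" and \<tau>: "trilinear_on sX \<tau>"
  shows "(\<Sum>(a, b, c)\<leftarrow>xs. \<tau> a b c) = (\<Sum>(a, b, c)\<leftarrow>ys. \<tau> a b c)"
proof (rule formal_sum_eq_sum_list[OF assms(1)])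
  have l: "Vector_Spaces.linear scale sX (\<lambda>a. \<tau> a b c)"
    and m: "Vector_Spaces.linear scale sX (\<lambda>b. \<tau> a b c)"
    and r: "Vector_Spaces.linear scale sX (\<tau> a b)" for a b c
    using \<tau> by (auto simp: trilinear_on_def)
  fix us vs assume "tensor3_rel scale us vs"
  then show "(\<Sum>(a, b, c)\<leftarrow>us. \<tau> a b c) = (\<Sum>(a, b, c)\<leftarrow>vs. \<tau> a b c)"
    by cases (simp_all add: linear_zeroD[OF l] linear_addD[OF l] linear_addD[OF m] linear_addD[OF r]
        linear_scaleD[OF l] linear_scaleD[OF m] linear_scaleD[OF r])
qed

lemma sw_eq_sum_list:
  "tensor2_eq scale (\<Delta> x) xs \<Longrightarrow> bilinear_on sX \<beta> \<Longrightarrow> sw x \<beta> = (\<Sum>(a, b)\<leftarrow>xs. \<beta> a b)"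
  unfolding sw_def by (rule sum_list_tensor2_eq)

lemma sw_cong: "(\<And>a b. \<beta> a b = \<gamma> a b) \<Longrightarrow> sw x \<beta> = sw x \<gamma>"
  by (simp add: sw_def)

lemma sw_linear:
  assumes "Vector_Spaces.linear sX sY f"
  shows "f (sw x \<beta>) = sw x (\<lambda>a b. f (\<beta> a b))"
proof -
  interpret f: Vector_Spaces.linear sX sY f by (rule assms)
  have "f (\<Sum>(a, b)\<leftarrow>xs. \<beta> a b) = (\<Sum>(a, b)\<leftarrow>xs. f (\<beta> a b))" for xs
    by (induction xs) (auto simp: f.add)
  then show ?thesis by (simp add: sw_def)
qed

lemma sw_add:
  assumes "bilinear_on sX \<beta>" shows "sw (x + y) \<beta> = sw x \<beta> + sw y \<beta>"
  using sw_eq_sum_list[OF comult_add assms] by (simp add: sw_def)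

lemma sw_scale:
  assumes "bilinear_on sX \<beta>" shows "sw (scale c x) \<beta> = sX c (sw x \<beta>)"
proof -
  have l: "Vector_Spaces.linear scale sX (\<lambda>a. \<beta> a b)" for b
    using assms by (auto simp: bilinear_on_def)
  interpret X: vector_space sX
    using l[of 0] by (simp add: Vector_Spaces.linear_iff)
  have "Vector_Spaces.linear sX sX (sX c)"
    by (simp add: Vector_Spaces.linear_iff X.vector_space_axioms X.scale_right_distrib mult.commute)
  then have "sX c (sw x \<beta>) = sw x (\<lambda>a b. sX c (\<beta> a b))"
    using sw_linear by blast
  also have "\<dots> = sw x (\<lambda>a b. \<beta> (scale c a) b)"
    by (rule sw_cong) (simp add: linear_scaleD[OF l])
  also have "\<dots> = sw (scale c x) \<beta>"
    using sw_eq_sum_list[OF comult_scale assms, of c x]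
    by (simp add: sw_def case_prod_unfold comp_def)
  finally show ?thesis ..
qed

lemma sw_one: assumes "bilinear_on sX \<beta>" shows "sw 1 \<beta> = \<beta> 1 1"
  using sw_eq_sum_list[OF comult_one assms] by simp

lemma sw_mult:
  assumes "bilinear_on sX \<beta>"
  shows "sw (x * y) \<beta> = sw x (\<lambda>a b. sw y (\<lambda>p q. \<beta> (a * p) (b * q)))"
  using sw_eq_sum_list[OF comult_mult assms, of x y]
  by (simp add: sw_def case_prod_unfold sum_list_concat_map comp_def)

lemma sw_coassoc:
  assumes "trilinear_on sX \<tau>"
  shows "sw x (\<lambda>a b. sw a (\<lambda>p q. \<tau> p q b)) = sw x (\<lambda>a b. sw b (\<lambda>p q. \<tau> a p q))"
  using sum_list_tensor3_eq[OF coassoc assms, of x]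
  by (simp add: sw_def case_prod_unfold sum_list_concat_map comp_def)

lemma sw_swap:
  "sw x (\<lambda>a b. sw y (\<lambda>p q. \<beta> a b p q)) = sw y (\<lambda>p q. sw x (\<lambda>a b. \<beta> a b p q))"
  unfolding sw_def case_prod_unfold by (rule sum_list_swap)

lemma linear_swI:
  assumes \<beta>: "bilinear_on sX \<beta>" and f: "Vector_Spaces.linear scale scale f"
  shows "Vector_Spaces.linear scale sX (\<lambda>x. sw (f x) \<beta>)"
proof -
  have "vector_space sX"
    using \<beta> by (simp add: bilinear_on_def Vector_Spaces.linear_iff)
  then show ?thesis
    using f by (simp add: Vector_Spaces.linear_iff sw_add[OF \<beta>] sw_scale[OF \<beta>])
qed

lemma linear_sw_integrandI:
  assumes "\<And>a b. Vector_Spaces.linear scale sX (\<lambda>x. G x a b)"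
  shows "Vector_Spaces.linear scale sX (\<lambda>x. sw y (\<lambda>a b. G x a b))"
proof -
  have vs: "vector_space sX" using assms[of 0 0] by (simp add: Vector_Spaces.linear_iff)
  then interpret X: vector_space sX .
  have "Vector_Spaces.linear scale sX (\<lambda>x. \<Sum>(a, b)\<leftarrow>xs. G x a b)" for xs
  proof (induction xs)
    case Nil
    show ?case by (simp add: Vector_Spaces.linear_iff vector_space_axioms vs)
  next
    case (Cons u xs)
    obtain a b where "u = (a, b)" by force
    then show ?case using Cons assms[of a b]
      by (simp add: Vector_Spaces.linear_iff X.scale_right_distrib)
  qed
  then show ?thesis by (simp add: sw_def)
qed

lemma linear_antipodeI:
  "Vector_Spaces.linear scale scale f \<Longrightarrow> Vector_Spaces.linear scale scale (\<lambda>x. S (f x))"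
  by (rule linear_comp[OF _ antipode_linear])

lemma linear_counitI:
  "Vector_Spaces.linear scale scale f \<Longrightarrow> Vector_Spaces.linear scale (*) (\<lambda>x. \<epsilon> (f x))"
  by (rule linear_comp[OF _ counit_linear])

text \<open>
  In an integrand of a Sweedler sum each variable occurs exactly once, so these rules, applied
  backwards, settle all linearity side conditions.
\<close>

lemmas lin_intros =
  bilinear_onI trilinear_onI linear_identI linear_mult_rightI linear_mult_leftI linear_scaleI
  linear_scale_functionalI linear_functional_mult_rightI linear_functional_mult_leftI
  linear_swI linear_sw_integrandI linear_antipodeI linear_counitI

lemma sw_counit_left:
  assumes "Vector_Spaces.linear scale sX f"
  shows "sw x (\<lambda>a b. sX (\<epsilon> a) (f b)) = f x"
proof -
  have "f x = f (sw x (\<lambda>a b. scale (\<epsilon> a) b))"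
    using counit_left[of x] by (simp add: sw_def)
  then show ?thesis
    using sw_linear[OF assms, of x "\<lambda>a b. scale (\<epsilon> a) b"] by (simp add: linear_scaleD[OF assms])
qed

lemma sw_counit_right:
  assumes "Vector_Spaces.linear scale sX f"
  shows "sw x (\<lambda>a b. sX (\<epsilon> b) (f a)) = f x"
proof -
  have "f x = f (sw x (\<lambda>a b. scale (\<epsilon> b) a))"
    using counit_right[of x] by (simp add: sw_def)
  then show ?thesis
    using sw_linear[OF assms, of x "\<lambda>a b. scale (\<epsilon> b) a"] by (simp add: linear_scaleD[OF assms])
qed

lemma sw_antipode_left:
  assumes "Vector_Spaces.linear scale sX f"
  shows "sw x (\<lambda>a b. f (S a * b)) = sX (\<epsilon> x) (f 1)"
proof -
  have "sX (\<epsilon> x) (f 1) = f (sw x (\<lambda>a b. S a * b))"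
    using antipode_left[of x] by (simp add: sw_def linear_scaleD[OF assms])
  then show ?thesis
    by (simp add: sw_linear[OF assms])
qed

lemma sw_antipode_right:
  assumes "Vector_Spaces.linear scale sX f"
  shows "sw x (\<lambda>a b. f (a * S b)) = sX (\<epsilon> x) (f 1)"
proof -
  have "sX (\<epsilon> x) (f 1) = f (sw x (\<lambda>a b. a * S b))"
    using antipode_right[of x] by (simp add: sw_def linear_scaleD[OF assms])
  then show ?thesis
    by (simp add: sw_linear[OF assms])
qed

lemma antipode_one: "S 1 = 1"
proof -
  have "sw 1 (\<lambda>a b. S a * b) = S 1 * 1"
    by (rule sw_one[of scale]) (intro lin_intros)
  moreover have "sw 1 (\<lambda>a b. S a * b) = 1"
    using sw_antipode_left[OF linear_identI, of 1] by (simp add: counit_one)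
  ultimately show ?thesis by simp
qed

lemma counit_antipode: "\<epsilon> (S x) = \<epsilon> x"
proof -
  have "\<epsilon> x = sw x (\<lambda>a b. \<epsilon> (S a * b))"
    using sw_antipode_left[OF counit_linear, of x] by (simp add: counit_one)
  also have "\<dots> = sw x (\<lambda>a b. \<epsilon> b * \<epsilon> (S a))"
    by (rule sw_cong) (simp add: counit_mult)
  also have "\<dots> = \<epsilon> (S x)"
    by (rule sw_counit_right) (intro lin_intros)
  finally show ?thesis ..
qed

text \<open>
  Both sides equal \<open>\<Sum> S(x\<^sub>1 y\<^sub>1) x\<^sub>2 y\<^sub>2 S(y\<^sub>3) S(x\<^sub>3)\<close>: pairing the second and third legs collapses it to
  \<open>S (x y)\<close>, pairing the first two legs of the product to \<open>S y S x\<close>. This is the uniqueness of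
  convolution inverses.
\<close>

lemma antipode_mult: "S (x * y) = S y * S x"
proof -
  define F where "F x1 x2 x3 y1 y2 y3 = S (x1 * y1) * (x2 * y2) * (S y3 * S x3)"
    for x1 x2 x3 y1 y2 y3
  define E where "E = sw x (\<lambda>x1 x'. sw y (\<lambda>y1 y'. sw x' (\<lambda>x2 x3. sw y' (\<lambda>y2 y3.
    F x1 x2 x3 y1 y2 y3))))"
  have "E = sw x (\<lambda>x1 x'. sw y (\<lambda>y1 y'. scale (\<epsilon> x') (scale (\<epsilon> y') (S (x1 * y1)))))"
    unfolding E_def
  proof (intro sw_cong)
    fix x1 x' y1 y'
    have "sw x' (\<lambda>x2 x3. sw y' (\<lambda>y2 y3. F x1 x2 x3 y1 y2 y3))
      = sw x' (\<lambda>x2 x3. scale (\<epsilon> y') (S (x1 * y1) * (x2 * S x3)))"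
    proof (rule sw_cong)
      fix x2 x3
      show "sw y' (\<lambda>y2 y3. F x1 x2 x3 y1 y2 y3) = scale (\<epsilon> y') (S (x1 * y1) * (x2 * S x3))"
        using sw_antipode_right[where f = "\<lambda>z. S (x1 * y1) * (x2 * z * S x3)" and sX = scale and x = y']
        by (simp add: F_def mult.assoc lin_intros)
    qed
    also have "\<dots> = scale (\<epsilon> x') (scale (\<epsilon> y') (S (x1 * y1)))"
      using sw_antipode_right[where f = "\<lambda>z. scale (\<epsilon> y') (S (x1 * y1) * z)" and sX = scale and x = x']
      by (simp add: lin_intros)
    finally show "sw x' (\<lambda>x2 x3. sw y' (\<lambda>y2 y3. F x1 x2 x3 y1 y2 y3))
      = scale (\<epsilon> x') (scale (\<epsilon> y') (S (x1 * y1)))" .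
  qed
  also have "\<dots> = sw x (\<lambda>x1 x'. scale (\<epsilon> x') (S (x1 * y)))"
  proof (rule sw_cong)
    fix x1 x'
    show "sw y (\<lambda>y1 y'. scale (\<epsilon> x') (scale (\<epsilon> y') (S (x1 * y1)))) = scale (\<epsilon> x') (S (x1 * y))"
      using sw_counit_right[where f = "\<lambda>z. scale (\<epsilon> x') (S (x1 * z))" and sX = scale and x = y]
      by (simp add: lin_intros mult.commute)
  qed
  also have "\<dots> = S (x * y)"
    by (rule sw_counit_right) (intro lin_intros)
  finally have E1: "E = S (x * y)" .
  have "E = sw y (\<lambda>y1 y'. sw x (\<lambda>x1 x'. sw x' (\<lambda>x2 x3. sw y' (\<lambda>y2 y3. F x1 x2 x3 y1 y2 y3))))"
    unfolding E_def by (rule sw_swap)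
  also have "\<dots> = sw y (\<lambda>y1 y'. sw x (\<lambda>x' x3. sw x' (\<lambda>x1 x2. sw y' (\<lambda>y2 y3. F x1 x2 x3 y1 y2 y3))))"
    unfolding F_def by (intro sw_cong sw_coassoc[symmetric, of scale] lin_intros)
  also have "\<dots> = sw x (\<lambda>x' x3. sw x' (\<lambda>x1 x2. sw y (\<lambda>y1 y'. sw y' (\<lambda>y2 y3. F x1 x2 x3 y1 y2 y3))))"
    by (subst sw_swap, intro sw_cong, rule sw_swap)
  also have "\<dots> = sw x (\<lambda>x' x3. sw x' (\<lambda>x1 x2. sw y (\<lambda>y' y3. sw y' (\<lambda>y1 y2. F x1 x2 x3 y1 y2 y3))))"
    unfolding F_def by (intro sw_cong sw_coassoc[symmetric, of scale] lin_intros)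
  also have "\<dots> = sw x (\<lambda>x' x3. sw y (\<lambda>y' y3. sw x' (\<lambda>x1 x2. sw y' (\<lambda>y1 y2. F x1 x2 x3 y1 y2 y3))))"
    by (intro sw_cong sw_swap)
  also have "\<dots> = sw x (\<lambda>x' x3. sw y (\<lambda>y' y3. sw (x' * y') (\<lambda>a b. S a * b * (S y3 * S x3))))"
    unfolding F_def by (intro sw_cong sw_mult[symmetric, of scale "\<lambda>a b. S a * b * (S _ * S _)"] lin_intros)
  also have "\<dots> = sw x (\<lambda>x' x3. sw y (\<lambda>y' y3. scale (\<epsilon> x') (scale (\<epsilon> y') (S y3 * S x3))))"
  proof (intro sw_cong)
    fix x' x3 y' y3
    show "sw (x' * y') (\<lambda>a b. S a * b * (S y3 * S x3)) = scale (\<epsilon> x') (scale (\<epsilon> y') (S y3 * S x3))"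
      using sw_antipode_left[where f = "\<lambda>z. z * (S y3 * S x3)" and sX = scale and x = "x' * y'"]
      by (simp add: lin_intros counit_mult)
  qed
  also have "\<dots> = sw x (\<lambda>x' x3. scale (\<epsilon> x') (S y * S x3))"
  proof (rule sw_cong)
    fix x' x3
    show "sw y (\<lambda>y' y3. scale (\<epsilon> x') (scale (\<epsilon> y') (S y3 * S x3))) = scale (\<epsilon> x') (S y * S x3)"
      using sw_counit_left[where f = "\<lambda>z. scale (\<epsilon> x') (S z * S x3)" and sX = scale and x = y]
      by (simp add: lin_intros mult.commute)
  qed
  also have "\<dots> = S y * S x"
    by (rule sw_counit_left) (intro lin_intros)
  finally show ?thesis using E1 by simp
qed

text \<open>
  Reading the two nested coproducts as \<open>x\<^sub>1 \<otimes> x\<^sub>2 \<otimes> x\<^sub>3 \<otimes> x\<^sub>4\<close>, the middle legs cancel in the form \<open>x\<^sub>2 S(x\<^sub>3)\<close>.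
\<close>

lemma sw_middle_antipode:
  assumes \<tau>: "trilinear_on sX \<tau>"
  shows "sw x (\<lambda>a b. sw a (\<lambda>r s. sw b (\<lambda>t u. \<tau> r (s * S t) u))) = sw x (\<lambda>r u. \<tau> r 1 u)"
proof -
  have l1: "Vector_Spaces.linear scale scale f \<Longrightarrow> Vector_Spaces.linear scale sX (\<lambda>a. \<tau> (f a) b c)"
    and l2: "Vector_Spaces.linear scale scale f \<Longrightarrow> Vector_Spaces.linear scale sX (\<lambda>b. \<tau> a (f b) c)"
    and l3: "Vector_Spaces.linear scale scale f \<Longrightarrow> Vector_Spaces.linear scale sX (\<lambda>c. \<tau> a b (f c))"
    for f a b c
    using \<tau> linear_comp[of scale scale f sX] unfolding trilinear_on_def by blast+
  have "sw x (\<lambda>a b. sw a (\<lambda>r s. sw b (\<lambda>t u. \<tau> r (s * S t) u)))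
      = sw x (\<lambda>r b. sw b (\<lambda>s c. sw c (\<lambda>t u. \<tau> r (s * S t) u)))"
    by (intro sw_coassoc[of sX] lin_intros l1 l2 l3)
  also have "\<dots> = sw x (\<lambda>r b. sw b (\<lambda>c u. sw c (\<lambda>s t. \<tau> r (s * S t) u)))"
    by (intro sw_cong sw_coassoc[symmetric, of sX] lin_intros l1 l2 l3)
  also have "\<dots> = sw x (\<lambda>r b. sw b (\<lambda>c u. sX (\<epsilon> c) (\<tau> r 1 u)))"
    by (intro sw_cong sw_antipode_right lin_intros l2)
  also have "\<dots> = sw x (\<lambda>r u. \<tau> r 1 u)"
    by (intro sw_cong sw_counit_left lin_intros l3)
  finally show ?thesis .
qed

text \<open>
  The antipode reverses the coproduct. Again two ways to collapse one sum,
  \<open>\<Delta> (S x\<^sub>1) \<Delta> (x\<^sub>2) (S x\<^sub>4 \<otimes> S x\<^sub>3)\<close>, are compared: \<open>S x\<^sub>1\<close> against \<open>x\<^sub>2\<close>, or \<open>x\<^sub>2\<close> against the last two legs.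
\<close>

lemma sw_antipode:
  assumes \<beta>: "bilinear_on sX \<beta>"
  shows "sw (S x) \<beta> = sw x (\<lambda>a b. \<beta> (S b) (S a))"
proof -
  have l1: "Vector_Spaces.linear scale scale f \<Longrightarrow> Vector_Spaces.linear scale sX (\<lambda>a. \<beta> (f a) b)"
    and l2: "Vector_Spaces.linear scale scale f \<Longrightarrow> Vector_Spaces.linear scale sX (\<lambda>b. \<beta> a (f b))"
    for f a b
    using \<beta> linear_comp[of scale scale f sX] unfolding bilinear_on_def by blast+
  have vs: "vector_space sX" using \<beta> by (simp add: bilinear_on_def Vector_Spaces.linear_iff)
  define F where "F y z v = sw (S y) (\<lambda>p q. sw z (\<lambda>r s. sw v (\<lambda>t u. \<beta> (p * r * S u) (q * s * S t))))"
    for y z v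
  have tri: "trilinear_on sX F"
    unfolding F_def by (intro lin_intros l1 l2)
  have "sw x (\<lambda>a b. sw a (\<lambda>y z. F y z b)) = sw x (\<lambda>a b. sX (\<epsilon> a) (sw b (\<lambda>t u. \<beta> (S u) (S t))))"
  proof (rule sw_cong)
    fix a b
    let ?\<gamma> = "\<lambda>p q. sw b (\<lambda>t u. \<beta> (p * S u) (q * S t))"
    have bil: "bilinear_on sX ?\<gamma>" by (intro lin_intros l1 l2)
    have "sw a (\<lambda>y z. F y z b) = sw a (\<lambda>y z. sw (S y * z) ?\<gamma>)"
      unfolding F_def by (intro sw_cong) (simp add: sw_mult[OF bil])
    also have "\<dots> = sX (\<epsilon> a) (sw 1 ?\<gamma>)"
      by (rule sw_antipode_left) (intro linear_swI bil linear_identI)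
    also have "sw 1 ?\<gamma> = sw b (\<lambda>t u. \<beta> (S u) (S t))"
      using sw_one[OF bil] by simp
    finally show "sw a (\<lambda>y z. F y z b) = sX (\<epsilon> a) (sw b (\<lambda>t u. \<beta> (S u) (S t)))" .
  qed
  also have "\<dots> = sw x (\<lambda>t u. \<beta> (S u) (S t))"
    by (rule sw_counit_left) (intro lin_intros l1 l2)
  finally have 1: "sw x (\<lambda>a b. sw a (\<lambda>y z. F y z b)) = sw x (\<lambda>t u. \<beta> (S u) (S t))" .
  have "sw x (\<lambda>a b. sw a (\<lambda>y z. F y z b)) = sw x (\<lambda>y b. sw b (\<lambda>z v. F y z v))"
    by (rule sw_coassoc[OF tri])
  also have "\<dots> = sw x (\<lambda>y b. sX (\<epsilon> b) (sw (S y) \<beta>))"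
  proof (rule sw_cong)
    fix y b
    have "sw b (\<lambda>z v. F y z v)
      = sw (S y) (\<lambda>p q. sw b (\<lambda>z v. sw z (\<lambda>r s. sw v (\<lambda>t u. \<beta> (p * r * S u) (q * (s * S t))))))"
      unfolding F_def by (simp add: mult.assoc sw_swap[of b "S y"])
    also have "\<dots> = sw (S y) (\<lambda>p q. sw b (\<lambda>r u. \<beta> (p * (r * S u)) (q * 1)))"
    proof (rule sw_cong)
      fix p q
      show "sw b (\<lambda>z v. sw z (\<lambda>r s. sw v (\<lambda>t u. \<beta> (p * r * S u) (q * (s * S t)))))
        = sw b (\<lambda>r u. \<beta> (p * (r * S u)) (q * 1))"
        using sw_middle_antipode[where x = b and sX = sX and \<tau> = "\<lambda>r m u. \<beta> (p * r * S u) (q * m)"]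
        by (simp add: mult.assoc lin_intros l1 l2)
    qed
    also have "\<dots> = sw (S y) (\<lambda>p q. sX (\<epsilon> b) (\<beta> p q))"
      using sw_antipode_right[where x = b and sX = sX and f = "\<lambda>z. \<beta> (_ * z) (_ * 1)"]
      by (intro sw_cong) (simp add: lin_intros l1)
    also have "\<dots> = sX (\<epsilon> b) (sw (S y) \<beta>)"
    proof -
      interpret X: vector_space sX by (rule vs)
      have "Vector_Spaces.linear sX sX (sX (\<epsilon> b))"
        by (simp add: Vector_Spaces.linear_iff vs X.scale_right_distrib X.scale_left_commute)
      from sw_linear[OF this] show ?thesis by simp
    qed
    finally show "sw b (\<lambda>z v. F y z v) = sX (\<epsilon> b) (sw (S y) \<beta>)" .
  qed
  also have "\<dots> = sw (S x) \<beta>"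
    by (rule sw_counit_right) (intro lin_intros \<beta>)
  finally show ?thesis using 1 by simp
qed

end

section \<open>Integrals of a semisimple Hopf algebra\<close>

locale semisimple_hopf_algebra = hopf_algebra scale \<Delta> \<epsilon> S
  for scale :: "'k::{alg_closed_field, field_char_0} \<Rightarrow> 'h::ring_1 \<Rightarrow> 'h"
    and \<Delta> :: "'h \<Rightarrow> ('h \<times> 'h) list" and \<epsilon> :: "'h \<Rightarrow> 'k" and S :: "'h \<Rightarrow> 'h" +
  assumes semisimple: "semisimple_algebra scale"
begin

text \<open>
  The kernel of the counit is a left ideal. A complement of it is a line on which \<open>H\<close> acts through
  \<open>\<epsilon>\<close>, and it contains an element of counit \<open>1\<close>.
\<close>

lemma left_integral_exists: "\<exists>L. \<epsilon> L = 1 \<and> (\<forall>x. x * L = scale (\<epsilon> x) L)"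
proof -
  interpret eps: Vector_Spaces.linear scale "(*)" \<epsilon> by (rule counit_linear)
  let ?K = "{x. \<epsilon> x = 0}"
  have "is_left_ideal scale ?K"
    unfolding is_left_ideal_def using eps.subspace_kernel by (simp add: counit_mult)
  then obtain L' where L': "is_left_ideal scale L'" "?K \<inter> L' = {0}"
    and dec: "\<And>x. \<exists>y\<in>?K. \<exists>z\<in>L'. x = y + z"
    using semisimple unfolding semisimple_algebra_def by metis
  obtain y L where yL: "\<epsilon> y = 0" "L \<in> L'" "1 = y + L" using dec[of 1] by auto
  have eL: "\<epsilon> L = 1" using yL counit_one eps.add[of y L] by simp
  have "x * L = scale (\<epsilon> x) L" for x
  proof -
    have "x * L \<in> L'" "scale (\<epsilon> x) L \<in> L'"
      using L'(1) yL(2) by (auto simp: is_left_ideal_def subspace_scale)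
    then have "x * L - scale (\<epsilon> x) L \<in> L'"
      using L'(1) by (auto simp: is_left_ideal_def subspace_diff)
    moreover have "\<epsilon> (x * L - scale (\<epsilon> x) L) = 0"
      by (simp add: eps.diff eps.scale counit_mult eL)
    ultimately have "x * L - scale (\<epsilon> x) L \<in> {0}"
      using L'(2) by blast
    then show ?thesis by simp
  qed
  then show ?thesis using eL by blast
qed

definition integral (\<open>\<Lambda>\<close>) where
  "\<Lambda> = (SOME L. \<epsilon> L = 1 \<and> (\<forall>x. x * L = scale (\<epsilon> x) L))"

lemma counit_integral: "\<epsilon> \<Lambda> = 1" and integral_left: "x * \<Lambda> = scale (\<epsilon> x) \<Lambda>"
  using someI_ex[OF left_integral_exists] by (auto simp: integral_def)

lemma sw_integral_left:
  assumes \<beta>: "bilinear_on sX \<beta>"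
  shows "sw (x * \<Lambda>) \<beta> = sX (\<epsilon> x) (sw \<Lambda> \<beta>)"
  by (simp add: integral_left sw_scale[OF \<beta>])

lemma bilinear_compI:
  assumes \<beta>: "bilinear_on sX \<beta>"
  shows "Vector_Spaces.linear scale scale f \<Longrightarrow> Vector_Spaces.linear scale sX (\<lambda>a. \<beta> (f a) b)"
    and "Vector_Spaces.linear scale scale f \<Longrightarrow> Vector_Spaces.linear scale sX (\<lambda>b. \<beta> a (f b))"
  using \<beta> linear_comp[of scale scale f sX] unfolding bilinear_on_def by blast+

text \<open>
  \<open>\<Sum> \<Lambda>\<^sub>1 \<otimes> h \<Lambda>\<^sub>2 = \<Sum> S(h) \<Lambda>\<^sub>1 \<otimes> \<Lambda>\<^sub>2\<close>: expand \<open>\<Sum> S(h\<^sub>1) h\<^sub>2 \<Lambda>\<^sub>1 \<otimes> h\<^sub>3 \<Lambda>\<^sub>2\<close> either by the antipode axiom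
  or by \<open>h \<Lambda> = \<epsilon>(h) \<Lambda>\<close>.
\<close>

lemma integral_slide_right:
  assumes \<beta>: "bilinear_on sX \<beta>"
  shows "sw \<Lambda> (\<lambda>a b. \<beta> a (h * b)) = sw \<Lambda> (\<lambda>a b. \<beta> (S h * a) b)"
proof -
  note lb = bilinear_compI[OF \<beta>]
  let ?F = "\<lambda>p r s. sw \<Lambda> (\<lambda>a b. \<beta> (S p * r * a) (s * b))"
  have "sw h (\<lambda>p q. sw q (\<lambda>r s. ?F p r s)) = sw h (\<lambda>p q. sX (\<epsilon> q) (sw \<Lambda> (\<lambda>a b. \<beta> (S p * a) b)))"
  proof (rule sw_cong)
    fix p q
    have bil: "bilinear_on sX (\<lambda>a b. \<beta> (S p * a) b)" by (intro lin_intros lb)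
    show "sw q (\<lambda>r s. ?F p r s) = sX (\<epsilon> q) (sw \<Lambda> (\<lambda>a b. \<beta> (S p * a) b))"
      using sw_integral_left[OF bil, of q] sw_mult[OF bil, of q \<Lambda>] by (simp add: mult.assoc)
  qed
  also have "\<dots> = sw \<Lambda> (\<lambda>a b. \<beta> (S h * a) b)"
    by (rule sw_counit_right) (intro lin_intros lb)
  finally have 1: "sw h (\<lambda>p q. sw q (\<lambda>r s. ?F p r s)) = sw \<Lambda> (\<lambda>a b. \<beta> (S h * a) b)" .
  have "sw h (\<lambda>p q. sw q (\<lambda>r s. ?F p r s)) = sw h (\<lambda>q s. sw q (\<lambda>p r. ?F p r s))"
    by (intro sw_coassoc[symmetric, of sX] lin_intros lb)
  also have "\<dots> = sw h (\<lambda>q s. sX (\<epsilon> q) (sw \<Lambda> (\<lambda>a b. \<beta> (1 * a) (s * b))))"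
    by (intro sw_cong sw_antipode_left lin_intros lb)
  also have "\<dots> = sw \<Lambda> (\<lambda>a b. \<beta> (1 * a) (h * b))"
    by (rule sw_counit_left) (intro lin_intros lb)
  finally show ?thesis using 1 by simp
qed

text \<open>
  So \<open>\<Sum> \<Lambda>\<^sub>1 \<otimes> S(\<Lambda>\<^sub>2)\<close> is a separability element of \<open>H\<close>: it commutes with \<open>H\<close>, and its
  product \<open>\<Sum> \<Lambda>\<^sub>1 S(\<Lambda>\<^sub>2)\<close> is \<open>\<epsilon>(\<Lambda>) 1 = 1\<close>.
\<close>

lemma integral_casimir:
  assumes \<beta>: "bilinear_on sX \<beta>"
  shows "sw \<Lambda> (\<lambda>a b. \<beta> (h * a) (S b)) = sw \<Lambda> (\<lambda>a b. \<beta> a (S b * h))"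
proof -
  note lb = bilinear_compI[OF \<beta>]
  let ?F = "\<lambda>p r s. sw \<Lambda> (\<lambda>a b. \<beta> (p * a) (S (r * b) * s))"
  have "sw h (\<lambda>q s. sw q (\<lambda>p r. ?F p r s)) = sw h (\<lambda>q s. sX (\<epsilon> q) (sw \<Lambda> (\<lambda>a b. \<beta> a (S b * s))))"
  proof (rule sw_cong)
    fix q s
    have bil: "bilinear_on sX (\<lambda>a b. \<beta> a (S b * s))" by (intro lin_intros lb)
    show "sw q (\<lambda>p r. ?F p r s) = sX (\<epsilon> q) (sw \<Lambda> (\<lambda>a b. \<beta> a (S b * s)))"
      using sw_integral_left[OF bil, of q] sw_mult[OF bil, of q \<Lambda>] by simp
  qed
  also have "\<dots> = sw \<Lambda> (\<lambda>a b. \<beta> a (S b * h))"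
    by (rule sw_counit_left) (intro lin_intros lb)
  finally have 1: "sw h (\<lambda>q s. sw q (\<lambda>p r. ?F p r s)) = sw \<Lambda> (\<lambda>a b. \<beta> a (S b * h))" .
  have "sw h (\<lambda>q s. sw q (\<lambda>p r. ?F p r s)) = sw h (\<lambda>p q. sw q (\<lambda>r s. ?F p r s))"
    by (intro sw_coassoc[of sX] lin_intros lb)
  also have "\<dots> = sw h (\<lambda>p q. sX (\<epsilon> q) (sw \<Lambda> (\<lambda>a b. \<beta> (p * a) (S b * 1))))"
    unfolding antipode_mult mult.assoc[of "S _" "S _"]
    by (intro sw_cong sw_antipode_left lin_intros lb)
  also have "\<dots> = sw \<Lambda> (\<lambda>a b. \<beta> (h * a) (S b * 1))"
    by (rule sw_counit_right) (intro lin_intros lb)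
  finally show ?thesis using 1 by simp
qed

lemma sum_sw: "(\<Sum>i\<in>I. sw x (\<lambda>a b. \<beta> i a b)) = sw x (\<lambda>a b. \<Sum>i\<in>I. \<beta> i a b)"
proof -
  have "(\<Sum>i\<in>I. \<Sum>(a, b)\<leftarrow>xs. \<beta> i a b) = (\<Sum>(a, b)\<leftarrow>xs. \<Sum>i\<in>I. \<beta> i a b)" for xs
    by (induction xs) (auto simp: sum.distrib)
  then show ?thesis by (simp add: sw_def)
qed

lemma sw_zero: "sw x (\<lambda>a b. 0) = 0"
proof -
  have "(\<Sum>(a, b)\<leftarrow>xs. 0) = 0" for xs :: "('h \<times> 'h) list" by (induction xs) auto
  then show ?thesis by (simp add: sw_def)
qed

text \<open>
  Separable algebras over a field are finite-dimensional. Write \<open>h = \<Sum> \<Lambda>\<^sub>1 (S(\<Lambda>\<^sub>2) h)\<close> and expand the second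
  factor in a basis. By the Casimir property the coordinate at \<open>c\<close> contributes
  \<open>\<Sum> h \<Lambda>\<^sub>1 \<langle>c\<^sup>*, S(\<Lambda>\<^sub>2)\<rangle> c\<close>, which is zero outside a finite set of basis vectors that does not depend on \<open>h\<close>.
\<close>

lemma finite_spanning_set: "\<exists>A. finite A \<and> span A = UNIV"
proof -
  define B where "B = extend_basis {}"
  have B: "independent B" "span B = UNIV"
    using independent_extend_basis[OF independent_empty] span_extend_basis[OF independent_empty]
    by (auto simp: B_def)
  let ?r = "representation B"
  have lin: "Vector_Spaces.linear scale (*) (\<lambda>x. ?r x c)" for c
    using B by (auto simp: Vector_Spaces.linear_iff representation_add representation_scale
        vector_space_axioms vector_space_field)
  define supp where "supp x = {c. ?r x c \<noteq> 0}" for x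
  have supp: "finite (supp x)" for x
    unfolding supp_def by (rule finite_representation)
  \<comment> \<open>The basis vectors that occur in the factors \<open>S(\<Lambda>\<^sub>2)\<close> alone; this set is independent of \<open>h\<close>.\<close>
  define J where "J = (\<Union>(a, b)\<in>set (\<Delta> \<Lambda>). supp (S b))"
  have J: "finite J" unfolding J_def using supp by auto
  define A where "A = (\<lambda>(a, c). a * c) ` (fst ` set (\<Delta> \<Lambda>) \<times> J)"
  have "h \<in> span A" for h
  proof -
    define K where "K = J \<union> (\<Union>(a, b)\<in>set (\<Delta> \<Lambda>). supp (S b * h))"
    have K: "finite K" unfolding K_def using supp J by auto
    have h: "h = sw \<Lambda> (\<lambda>a b. a * (S b * h))"
      using sw_antipode_right[where f = "\<lambda>z. z * h" and sX = scale and x = \<Lambda>]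
      by (simp add: lin_intros counit_integral mult.assoc)
    also have "\<dots> = sw \<Lambda> (\<lambda>a b. \<Sum>c\<in>K. scale (?r (S b * h) c) (a * c))"
    proof -
      have "a * (S b * h) = (\<Sum>c\<in>K. scale (?r (S b * h) c) (a * c))" if "(a, b) \<in> set (\<Delta> \<Lambda>)" for a b
      proof -
        have "supp (S b * h) \<subseteq> K" unfolding K_def using that by blast
        then have "(\<Sum>c\<in>K. scale (?r (S b * h) c) c) = (\<Sum>c\<in>supp (S b * h). scale (?r (S b * h) c) c)"
          using K by (intro sum.mono_neutral_right) (auto simp: supp_def)
        also have "\<dots> = S b * h"
          unfolding supp_def using B by (intro sum_nonzero_representation_eq) auto
        finally show ?thesis
          by (metis (mono_tags, lifting) scale_mult_right sum.cong sum_distrib_left)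
      qed
      then show ?thesis unfolding sw_def by (intro arg_cong[of _ _ sum_list] map_cong) auto
    qed
    also have "\<dots> = (\<Sum>c\<in>K. sw \<Lambda> (\<lambda>a b. scale (?r (S b * h) c) (a * c)))"
      by (simp add: sum_sw)
    also have "\<dots> = (\<Sum>c\<in>J. sw \<Lambda> (\<lambda>a b. scale (?r (S b * h) c) (a * c)))"
    proof (rule sum.mono_neutral_right[OF K])
      show "J \<subseteq> K" by (auto simp: K_def)
      show "\<forall>c\<in>K - J. sw \<Lambda> (\<lambda>a b. scale (?r (S b * h) c) (a * c)) = 0"
      proof
        fix c assume c: "c \<in> K - J"
        have "bilinear_on scale (\<lambda>a b. scale (?r b c) (a * c))"
          by (intro lin_intros lin)
        from integral_casimir[OF this, of h]
        have "sw \<Lambda> (\<lambda>a b. scale (?r (S b * h) c) (a * c)) = sw \<Lambda> (\<lambda>a b. scale (?r (S b) c) (h * a * c))"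
          by simp
        also have "\<dots> = sw \<Lambda> (\<lambda>a b. 0)"
        proof -
          have "?r (S b) c = 0" if "(a, b) \<in> set (\<Delta> \<Lambda>)" for a b
            using c that by (auto simp: J_def supp_def)
          then show ?thesis unfolding sw_def by (intro arg_cong[of _ _ sum_list] map_cong) auto
        qed
        finally show "sw \<Lambda> (\<lambda>a b. scale (?r (S b * h) c) (a * c)) = 0" by (simp add: sw_zero)
      qed
    qed
    also have "\<dots> \<in> span A"
    proof (rule span_sum)
      fix c assume c: "c \<in> J"
      have "(\<Sum>(a, b)\<leftarrow>xs. scale (?r (S b * h) c) (a * c)) \<in> span A" if "set xs \<subseteq> set (\<Delta> \<Lambda>)" for xs
        using that
      proof (induction xs)
        case (Cons u xs)
        obtain a b where u: "u = (a, b)" by force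
        then have "a * c \<in> A" using Cons.prems c by (force simp: A_def)
        then show ?case using Cons u by (simp add: span_add span_scale span_base)
      qed (simp add: span_zero)
      then show "sw \<Lambda> (\<lambda>a b. scale (?r (S b * h) c) (a * c)) \<in> span A"
        by (simp add: sw_def)
    qed
    finally show ?thesis .
  qed
  moreover have "finite A" using J by (simp add: A_def)
  ultimately show ?thesis by blast
qed

end

sublocale semisimple_hopf_algebra \<subseteq> finite_dimensional_vector_space scale "extend_basis {}"
proof
  obtain A where "finite A" "span A = UNIV" using finite_spanning_set by blast
  then show "finite (extend_basis {})"
    using independent_span_bound[OF _ independent_extend_basis[OF independent_empty], of A] by simp
qed (simp_all add: independent_extend_basis[OF independent_empty] span_extend_basis[OF independent_empty])

context semisimple_hopf_algebra
begin

text \<open>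
  With the twist by \<open>S\<^sup>2\<close> this trace is a right integral of the dual Hopf algebra, whatever the order of
  the antipode. Its value at \<open>1\<close> is the trace of \<open>S\<^sup>2\<close>.
\<close>

definition \<mu> :: "'h \<Rightarrow> 'k" where
  "\<mu> x = lin_trace scale (\<lambda>h. S (S h) * x)"

abbreviation coord :: "'h \<Rightarrow> 'h \<Rightarrow> 'k" where
  "coord \<equiv> representation (extend_basis {})"

lemma linear_coordI:
  "Vector_Spaces.linear scale scale f \<Longrightarrow> Vector_Spaces.linear scale (*) (\<lambda>x. coord (f x) c)"
  by (rule linear_comp[OF _ linear_coord])

lemma eq_by_functionals:
  assumes "\<And>p. Vector_Spaces.linear scale (*) p \<Longrightarrow> p x = p y"
  shows "x = y"
proof -
  have "coord x c = coord y c" for c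
    by (rule assms[OF linear_coord])
  then have "(\<Sum>c\<in>extend_basis {}. scale (coord x c) c) = (\<Sum>c\<in>extend_basis {}. scale (coord y c) c)"
    by (simp only:)
  then show ?thesis by (simp only: coordinates_expand)
qed

lemma linear_sumI:
  fixes s2 :: "'k \<Rightarrow> 'x::ab_group_add \<Rightarrow> 'x"
  assumes "vector_space s2" "\<And>i. i \<in> I \<Longrightarrow> Vector_Spaces.linear scale s2 (F i)"
  shows "Vector_Spaces.linear scale s2 (\<lambda>x. \<Sum>i\<in>I. F i x)"
proof -
  interpret X: vector_space s2 by fact
  show ?thesis
    using assms(2) by (simp add: Vector_Spaces.linear_iff vector_space_axioms X.vector_space_axioms
        sum.distrib X.scale_sum_right)
qed

lemma linear_lin_trace_mult: 
  "Vector_Spaces.linear scale (*) (\<lambda>x. lin_trace scale (\<lambda>h. f h * x))"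
  unfolding lin_trace_eq_sum_coords
  by (intro linear_sumI vector_space_field linear_coordI lin_intros)

lemma linear_mu: "Vector_Spaces.linear scale (*) \<mu>"
  using linear_lin_trace_mult[of "\<lambda>h. S (S h)"] by (simp add: \<mu>_def[abs_def])

lemma linear_muI:
  "Vector_Spaces.linear scale scale f \<Longrightarrow> Vector_Spaces.linear scale (*) (\<lambda>x. \<mu> (f x))"
  by (rule linear_comp[OF _ linear_mu])

lemmas mu_scale = linear_scaleD[OF linear_mu]

lemmas lin_rules = lin_intros linear_muI linear_coordI

text \<open>
  Expand the trace along a basis \<open>c\<close> with dual basis \<open>c\<^sup>*\<close> and slide \<open>S (S c)\<close> to the other tensor factor, where
  it becomes \<open>S c\<close>; the sum \<open>\<Sum>\<^sub>c \<langle>c\<^sup>*, \<Lambda>\<^sub>1\<rangle> S(c) \<Lambda>\<^sub>2\<close> is \<open>\<Sum> S(\<Lambda>\<^sub>1) \<Lambda>\<^sub>2 = 1\<close>.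
\<close>

lemma mu_integral: "sw \<Lambda> (\<lambda>a b. scale (\<mu> a) b) = 1"
proof -
  let ?B = "extend_basis {}"
  have "sw \<Lambda> (\<lambda>a b. scale (\<mu> a) b) = sw \<Lambda> (\<lambda>a b. \<Sum>c\<in>?B. scale (coord (S (S c) * a) c) b)"
    by (simp add: \<mu>_def lin_trace_eq_sum_coords scale_sum_left)
  also have "\<dots> = (\<Sum>c\<in>?B. sw \<Lambda> (\<lambda>a b. scale (coord (S (S c) * a) c) b))"
    by (simp add: sum_sw)
  also have "\<dots> = (\<Sum>c\<in>?B. sw \<Lambda> (\<lambda>a b. scale (coord a c) (S c * b)))"
    by (intro sum.cong[OF HOL.refl] integral_slide_right[symmetric, of scale] lin_rules)
  also have "\<dots> = sw \<Lambda> (\<lambda>a b. \<Sum>c\<in>?B. scale (coord a c) (S c * b))"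
    by (simp add: sum_sw)
  also have "\<dots> = sw \<Lambda> (\<lambda>a b. S a * b)"
  proof (rule sw_cong)
    interpret l: Vector_Spaces.linear scale scale S by (rule antipode_linear)
    fix a b
    have "S a = (\<Sum>c\<in>?B. scale (coord a c) (S c))"
      using arg_cong[OF coordinates_expand[of a], of S] by (simp add: l.sum l.scale)
    then show "(\<Sum>c\<in>?B. scale (coord a c) (S c * b)) = S a * b"
      by (simp add: sum_distrib_right scale_mult_left)
  qed
  also have "\<dots> = 1"
    using sw_antipode_left[OF linear_identI, of \<Lambda>] by (simp add: counit_integral)
  finally show ?thesis .
qed

text \<open>
  The functionals \<open>\<mu> (- \<Lambda>\<^sub>1)\<close> and the vectors \<open>S(\<Lambda>\<^sub>2)\<close> act as a pair of dual bases; in particular \<open>\<mu>\<close> is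
  nondegenerate.
\<close>

lemma mu_expand_antipode: "sw \<Lambda> (\<lambda>a b. scale (\<mu> (h * a)) (S b)) = h"
proof -
  have "sw \<Lambda> (\<lambda>a b. scale (\<mu> (h * a)) (S b)) = sw \<Lambda> (\<lambda>a b. scale (\<mu> a) (S b * h))"
    by (intro integral_casimir[of scale] lin_rules)
  also have "\<dots> = S (sw \<Lambda> (\<lambda>a b. scale (\<mu> a) b)) * h"
    using sw_linear[where f = "\<lambda>x. S x * h" and sX = scale and sY = scale and x = \<Lambda> and \<beta> = "\<lambda>a b. scale (\<mu> a) b"]
    by (simp add: lin_rules linear_scaleD[OF antipode_linear] scale_mult_left)
  finally show ?thesis by (simp add: mu_integral antipode_one)
qed

lemma mu_expand: "sw \<Lambda> (\<lambda>a b. scale (\<mu> (S h * a)) b) = h"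
proof -
  have "sw \<Lambda> (\<lambda>a b. scale (\<mu> (S h * a)) b) = sw \<Lambda> (\<lambda>a b. scale (\<mu> a) (h * b))"
    by (intro integral_slide_right[symmetric, of scale] lin_rules)
  also have "\<dots> = h * sw \<Lambda> (\<lambda>a b. scale (\<mu> a) b)"
    using sw_linear[where f = "\<lambda>x. h * x" and sX = scale and sY = scale and x = \<Lambda> and \<beta> = "\<lambda>a b. scale (\<mu> a) b"]
    by (simp add: lin_rules scale_mult_right)
  finally show ?thesis by (simp add: mu_integral)
qed

lemma antipode_eq_0D: "S h = 0 \<Longrightarrow> h = 0"
  using mu_expand[of h] by (simp add: linear_zeroD[OF linear_mu] sw_zero)

lemma inj_antipode: "inj S"
proof -
  interpret l: Vector_Spaces.linear scale scale S by (rule antipode_linear)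
  show ?thesis using antipode_eq_0D by (simp add: l.inj_iff_eq_0)
qed

lemma antipode_eq_iff: "S x = S y \<longleftrightarrow> x = y"
  using inj_antipode by (simp add: inj_eq)

lemma surj_antipode: obtains x where "y = S x"
  using linear_inj_imp_surj[OF antipode_linear inj_antipode] by (metis surjD)

lemma mu_left_nondegenerate: "(\<And>y. \<mu> (x * y) = 0) \<Longrightarrow> x = 0"
  using mu_expand_antipode[of x] by (simp add: sw_zero)

lemma mu_left_cancel: "(\<And>y. \<mu> (x * y) = \<mu> (x' * y)) \<Longrightarrow> x = x'"
proof -
  interpret m: Vector_Spaces.linear scale "(*)" \<mu> by (rule linear_mu)
  assume "\<And>y. \<mu> (x * y) = \<mu> (x' * y)"
  then have "\<mu> ((x - x') * y) = 0" for y by (simp add: left_diff_distrib m.diff)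
  then show "x = x'" using mu_left_nondegenerate[of "x - x'"] by simp
qed

text \<open>
  \<open>S\<^sup>2\<close> is the Nakayama automorphism of \<open>\<mu>\<close>; this is the cyclicity of the trace that defines \<open>\<mu>\<close>.
\<close>

lemma mu_nakayama: "\<mu> (x * y) = \<mu> (S (S y) * x)"
proof -
  have "\<mu> (x * y) = lin_trace scale (\<lambda>h. (S (S h) * x) * y)"
    by (simp add: \<mu>_def mult.assoc)
  also have "\<dots> = lin_trace scale (\<lambda>h. S (S (h * y)) * x)"
    by (rule lin_trace_commute[of "\<lambda>h. h * y" "\<lambda>h. S (S h) * x"]) (intro lin_rules)+
  also have "\<dots> = \<mu> (S (S y) * x)"
    by (simp add: \<mu>_def antipode_mult mult.assoc)
  finally show ?thesis .
qed

lemma mu_right_cancel: "(\<And>y. \<mu> (y * x) = \<mu> (y * x')) \<Longrightarrow> x = x'"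
  using mu_left_cancel[of "S (S x)" "S (S x')"] by (simp add: mu_nakayama[of _ x] mu_nakayama[of _ x'] antipode_eq_iff)

lemma mu_expand_right: "sw \<Lambda> (\<lambda>a b. scale (\<mu> (S b * y)) a) = y"
proof (rule mu_right_cancel)
  fix h
  have "\<mu> (h * sw \<Lambda> (\<lambda>a b. scale (\<mu> (S b * y)) a)) = sw \<Lambda> (\<lambda>a b. \<mu> (S b * y) * \<mu> (h * a))"
    using sw_linear[where f = "\<lambda>x. \<mu> (h * x)" and sX = scale and sY = "(*)" and x = \<Lambda>
        and \<beta> = "\<lambda>a b. scale (\<mu> (S b * y)) a"]
    by (simp add: lin_rules scale_mult_right[symmetric] mu_scale)
  also have "\<dots> = \<mu> (sw \<Lambda> (\<lambda>a b. scale (\<mu> (h * a)) (S b)) * y)"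
    using sw_linear[where f = "\<lambda>x. \<mu> (x * y)" and sX = scale and sY = "(*)" and x = \<Lambda>
        and \<beta> = "\<lambda>a b. scale (\<mu> (h * a)) (S b)"]
    by (simp add: lin_rules scale_mult_left[symmetric] mu_scale mult.commute)
  finally show "\<mu> (h * sw \<Lambda> (\<lambda>a b. scale (\<mu> (S b * y)) a)) = \<mu> (h * y)"
    by (simp add: mu_expand_antipode)
qed

text \<open>
  Fourier inversion: a functional \<open>q\<close> is recovered from \<open>\<Sum> q(\<Lambda>\<^sub>1) \<Lambda>\<^sub>2\<close>. Identities between functionals can
  therefore be checked after this transform, where \<open>\<mu>\<close> becomes \<open>1\<close>.
\<close>

lemma functional_from_transform:
  assumes q: "Vector_Spaces.linear scale (*) q"
  shows "q y = \<mu> (S (sw \<Lambda> (\<lambda>a b. scale (q a) b)) * y)"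
proof -
  have "q y = q (sw \<Lambda> (\<lambda>a b. scale (\<mu> (S b * y)) a))" by (simp add: mu_expand_right)
  also have "\<dots> = sw \<Lambda> (\<lambda>a b. \<mu> (S b * y) * q a)"
    by (simp add: sw_linear[OF q] linear_scaleD[OF q])
  also have "\<dots> = \<mu> (S (sw \<Lambda> (\<lambda>a b. scale (q a) b)) * y)"
    using sw_linear[where f = "\<lambda>x. \<mu> (S x * y)" and sX = scale and sY = "(*)" and x = \<Lambda>
        and \<beta> = "\<lambda>a b. scale (q a) b"]
    by (simp add: lin_rules linear_scaleD[OF antipode_linear] scale_mult_left[symmetric] mu_scale mult.commute)
  finally show ?thesis .
qed

lemma functional_eq_by_transform:
  assumes "Vector_Spaces.linear scale (*) q" "Vector_Spaces.linear scale (*) q'"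
    and "sw \<Lambda> (\<lambda>a b. scale (q a) b) = sw \<Lambda> (\<lambda>a b. scale (q' a) b)"
  shows "q y = q' y"
  by (simp only: functional_from_transform[OF assms(1), of y] functional_from_transform[OF assms(2), of y] assms(3))

lemma mu_right_integral: "sw h (\<lambda>a b. scale (\<mu> a) b) = scale (\<mu> h) 1"
proof (rule eq_by_functionals)
  fix p :: "'h \<Rightarrow> 'k" assume p: "Vector_Spaces.linear scale (*) p"
  note lp = linear_comp[OF _ p]
  have "sw h (\<lambda>a b. \<mu> a * p b) = \<mu> h * p 1"
  proof (rule functional_eq_by_transform[where q = "\<lambda>h. sw h (\<lambda>a b. \<mu> a * p b)" and q' = "\<lambda>h. \<mu> h * p 1"])
    show "Vector_Spaces.linear scale (*) (\<lambda>h. sw h (\<lambda>a b. \<mu> a * p b))"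
      "Vector_Spaces.linear scale (*) (\<lambda>h. \<mu> h * p 1)"
      by (intro lin_rules lp)+
    have "sw \<Lambda> (\<lambda>x y. scale (sw x (\<lambda>a b. \<mu> a * p b)) y)
        = sw \<Lambda> (\<lambda>x y. sw x (\<lambda>a b. scale (\<mu> a * p b) y))"
    proof (rule sw_cong)
      fix x y
      have "Vector_Spaces.linear (*) scale (\<lambda>c. scale c y)"
        by (simp add: Vector_Spaces.linear_iff vector_space_axioms vector_space_field scale_left_distrib)
      from sw_linear[OF this]
      show "scale (sw x (\<lambda>a b. \<mu> a * p b)) y = sw x (\<lambda>a b. scale (\<mu> a * p b) y)" .
    qed
    also have "\<dots> = sw \<Lambda> (\<lambda>a z. sw z (\<lambda>b y. scale (\<mu> a * p b) y))"
      by (intro sw_coassoc[of scale] lin_rules lp)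
    also have "\<dots> = sw \<Lambda> (\<lambda>a z. sw (scale (\<mu> a) z) (\<lambda>b y. scale (p b) y))"
    proof (rule sw_cong)
      fix a z
      have "bilinear_on scale (\<lambda>b y. scale (p b) y)" by (intro lin_rules lp)
      then show "sw z (\<lambda>b y. scale (\<mu> a * p b) y) = sw (scale (\<mu> a) z) (\<lambda>b y. scale (p b) y)"
        using sw_linear[OF linear_scaleI[OF linear_identI], of "\<mu> a" z "\<lambda>b y. scale (p b) y"]
        by (simp add: sw_scale)
    qed
    also have "\<dots> = sw (sw \<Lambda> (\<lambda>a z. scale (\<mu> a) z)) (\<lambda>b y. scale (p b) y)"
      by (intro sw_linear[of scale scale, symmetric] lin_rules lp)
    also have "\<dots> = scale (p 1) 1"
      unfolding mu_integral by (intro sw_one[of scale] lin_rules lp)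
    also have "\<dots> = scale (p 1) (sw \<Lambda> (\<lambda>x y. scale (\<mu> x) y))" by (simp add: mu_integral)
    also have "\<dots> = sw \<Lambda> (\<lambda>x y. scale (\<mu> x * p 1) y)"
      using sw_linear[OF linear_scaleI[OF linear_identI], of "p 1" \<Lambda> "\<lambda>x y. scale (\<mu> x) y"]
      by (simp add: mult.commute)
    finally show "sw \<Lambda> (\<lambda>x y. scale (sw x (\<lambda>a b. \<mu> a * p b)) y) = sw \<Lambda> (\<lambda>x y. scale (\<mu> x * p 1) y)" .
  qed
  then show "p (sw h (\<lambda>a b. scale (\<mu> a) b)) = p (scale (\<mu> h) 1)"
    by (simp add: sw_linear[OF p] linear_scaleD[OF p])
qed

end

context semisimple_hopf_algebra
begin

lemma antipode_integral: "S \<Lambda> = \<Lambda>"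
proof -
  obtain y where y: "\<Lambda> = S y" by (rule surj_antipode)
  have "S \<Lambda> * \<Lambda> = \<Lambda>"
    by (simp add: integral_left counit_antipode counit_integral)
  then have "\<Lambda> = S \<Lambda> * \<Lambda>" ..
  also have "\<dots> = S (y * \<Lambda>)" by (simp only: antipode_mult y[symmetric])
  also have "\<dots> = scale (\<epsilon> y) (S \<Lambda>)"
    by (simp add: integral_left linear_scaleD[OF antipode_linear])
  also have "\<dots> = S \<Lambda>"
    by (simp only: counit_antipode[of y, symmetric] y[symmetric] counit_integral scale_one)
  finally show ?thesis ..
qed

lemma integral_right: "\<Lambda> * x = scale (\<epsilon> x) \<Lambda>"
proof -
  obtain y where y: "x = S y" by (rule surj_antipode)
  have "\<Lambda> * x = S (y * \<Lambda>)" by (simp add: y antipode_mult antipode_integral)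
  then show ?thesis
    by (simp add: y integral_left linear_scaleD[OF antipode_linear] antipode_integral counit_antipode)
qed

lemma mu_of_integral: "\<mu> \<Lambda> = 1"
proof -
  have "\<mu> \<Lambda> = sw \<Lambda> (\<lambda>a b. \<epsilon> b * \<mu> a)"
    by (rule sw_counit_right[symmetric]) (rule linear_mu)
  also have "\<dots> = \<epsilon> (sw \<Lambda> (\<lambda>a b. scale (\<mu> a) b))"
    by (simp add: sw_linear[OF counit_linear] linear_scaleD[OF counit_linear] mult.commute)
  finally show ?thesis by (simp add: mu_integral counit_one)
qed

text \<open>
  The trace computed with the dual bases \<open>\<mu> (- \<Lambda>\<^sub>1)\<close> and \<open>S(\<Lambda>\<^sub>2)\<close>.
\<close>

lemma lin_trace_via_mu:
  assumes f: "Vector_Spaces.linear scale scale f"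
  shows "lin_trace scale f = sw \<Lambda> (\<lambda>a b. \<mu> (f (S b) * a))"
proof -
  let ?B = "extend_basis {}"
  have "lin_trace scale f = (\<Sum>c\<in>?B. coord (f (sw \<Lambda> (\<lambda>a b. scale (\<mu> (c * a)) (S b)))) c)"
    by (simp add: lin_trace_eq_sum_coords mu_expand_antipode)
  also have "\<dots> = (\<Sum>c\<in>?B. sw \<Lambda> (\<lambda>a b. \<mu> (c * a) * coord (f (S b)) c))"
    by (simp add: sw_linear[OF f] sw_linear[OF linear_coord] linear_scaleD[OF f] linear_scaleD[OF linear_coord])
  also have "\<dots> = sw \<Lambda> (\<lambda>a b. \<Sum>c\<in>?B. coord (f (S b)) c * \<mu> (c * a))"
    by (simp add: sum_sw mult.commute)
  also have "\<dots> = sw \<Lambda> (\<lambda>a b. \<mu> (f (S b) * a))"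
  proof (rule sw_cong)
    fix a b
    interpret l: Vector_Spaces.linear scale "(*)" "\<lambda>x. \<mu> (x * a)" by (intro lin_rules)
    show "(\<Sum>c\<in>?B. coord (f (S b)) c * \<mu> (c * a)) = \<mu> (f (S b) * a)"
      using arg_cong[OF coordinates_expand[of "f (S b)"], of "\<lambda>x. \<mu> (x * a)"]
      by (simp only: l.sum l.scale)
  qed
  finally show ?thesis .
qed

definition \<chi> :: "'h \<Rightarrow> 'k" where "\<chi> x = lin_trace scale (\<lambda>h. x * h)"

lemma linear_chi: "Vector_Spaces.linear scale (*) \<chi>"
  unfolding \<chi>_def[abs_def] lin_trace_eq_sum_coords
  by (intro linear_sumI vector_space_field lin_rules)

lemma linear_chiI: "Vector_Spaces.linear scale scale f \<Longrightarrow> Vector_Spaces.linear scale (*) (\<lambda>x. \<chi> (f x))"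
  by (rule linear_comp[OF _ linear_chi])

lemma chi_commute: "\<chi> (x * y) = \<chi> (y * x)"
  unfolding \<chi>_def mult.assoc by (rule lin_trace_commute) (intro lin_rules)+

text \<open>
  This element is the density of the regular character with respect to \<open>\<mu>\<close>. As \<open>\<chi>\<close> is symmetric while \<open>\<mu>\<close> is
  symmetric only up to \<open>S\<^sup>2\<close>, conjugation by it is \<open>S\<^sup>2\<close>.
\<close>

definition w :: 'h where "w = sw \<Lambda> (\<lambda>a b. S b * a)"

lemma chi_eq_mu: "\<chi> x = \<mu> (x * w)"
proof -
  have "\<chi> x = sw \<Lambda> (\<lambda>a b. \<mu> (x * S b * a))"
    unfolding \<chi>_def by (rule lin_trace_via_mu) (intro lin_rules)
  also have "\<dots> = \<mu> (x * w)"
    unfolding w_def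
    using sw_linear[where f = "\<lambda>z. \<mu> (x * z)" and sX = scale and sY = "(*)" and x = \<Lambda>
        and \<beta> = "\<lambda>a b. S b * a"]
    by (simp add: lin_rules mult.assoc)
  finally show ?thesis .
qed

lemma w_intertwines: "w * x = S (S x) * w"
proof (rule mu_right_cancel)
  fix b
  have "\<mu> (b * (S (S x) * w)) = \<chi> (S (S x) * b)"
    by (simp add: chi_eq_mu mult.assoc[symmetric] chi_commute[of "S (S x)", unfolded chi_eq_mu])
  also have "\<dots> = \<mu> (S (S x) * (b * w))" by (simp add: chi_eq_mu mult.assoc)
  also have "\<dots> = \<mu> (b * (w * x))" by (simp only: mu_nakayama[symmetric] mult.assoc)
  finally show "\<mu> (b * (w * x)) = \<mu> (b * (S (S x) * w))" ..
qed

section \<open>The modular element\<close>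

text \<open>
  The transform of a right integral \<open>q\<close> is \<open>q(\<Lambda>) 1\<close>, a multiple of the transform of \<open>\<mu>\<close>.
\<close>

lemma right_integral_unique:
  assumes q: "Vector_Spaces.linear scale (*) q"
    and int: "\<And>x. sw x (\<lambda>a b. scale (q a) b) = scale (q x) 1"
  shows "q x = q \<Lambda> * \<mu> x"
proof (rule functional_eq_by_transform[where q' = "\<lambda>x. q \<Lambda> * \<mu> x"])
  show "sw \<Lambda> (\<lambda>a b. scale (q a) b) = sw \<Lambda> (\<lambda>a b. scale (q \<Lambda> * \<mu> a) b)"
    using sw_linear[OF linear_scaleI[OF linear_identI], of "q \<Lambda>" \<Lambda> "\<lambda>a b. scale (\<mu> a) b"]
    by (simp add: int mu_integral)
qed (intro q lin_rules linear_mu)+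

text \<open>
  The grouplike element that measures how far the right integral \<open>\<mu>\<close> is from being a left integral.
\<close>

definition g :: 'h where "g = sw \<Lambda> (\<lambda>a b. scale (\<mu> b) a)"

text \<open>
  For each functional \<open>p\<close> the convolution \<open>p * \<mu>\<close> is again a right integral, hence a multiple of \<open>\<mu>\<close>; the factor
  is found by evaluating at \<open>\<Lambda>\<close>.
\<close>

lemma mu_left_quasi_integral: "sw h (\<lambda>a b. scale (\<mu> b) a) = scale (\<mu> h) g"
proof (rule eq_by_functionals)
  fix p :: "'h \<Rightarrow> 'k" assume p: "Vector_Spaces.linear scale (*) p"
  note lp = linear_comp[OF _ p]
  define q where "q x = sw x (\<lambda>a b. p a * \<mu> b)" for x
  have q: "Vector_Spaces.linear scale (*) q"
    unfolding q_def by (intro lin_rules lp)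
  have "sw x (\<lambda>a b. scale (q a) b) = scale (q x) 1" for x
  proof -
    have lin: "Vector_Spaces.linear (*) scale (\<lambda>c. scale c y)" for y
      by (simp add: Vector_Spaces.linear_iff vector_space_axioms vector_space_field scale_left_distrib)
    have "sw x (\<lambda>a b. scale (q a) b) = sw x (\<lambda>a b. sw a (\<lambda>c d. scale (p c * \<mu> d) b))"
      unfolding q_def by (intro sw_cong sw_linear[OF lin])
    also have "\<dots> = sw x (\<lambda>c z. sw z (\<lambda>d b. scale (p c * \<mu> d) b))"
      by (intro sw_coassoc[of scale] lin_rules lp)
    also have "\<dots> = sw x (\<lambda>c z. scale (p c * \<mu> z) 1)"
    proof (rule sw_cong)
      fix c z
      show "sw z (\<lambda>d b. scale (p c * \<mu> d) b) = scale (p c * \<mu> z) 1"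
        using sw_linear[OF linear_scaleI[OF linear_identI], of "p c" z "\<lambda>d b. scale (\<mu> d) b"]
        by (simp add: mu_right_integral)
    qed
    also have "\<dots> = scale (q x) 1"
      unfolding q_def by (intro sw_linear[OF lin, symmetric])
    finally show ?thesis .
  qed
  from right_integral_unique[OF q this, of h]
  have "q h = q \<Lambda> * \<mu> h" .
  moreover have "q \<Lambda> = p g"
    by (simp add: q_def g_def sw_linear[OF p] linear_scaleD[OF p] mult.commute)
  ultimately show "p (sw h (\<lambda>a b. scale (\<mu> b) a)) = p (scale (\<mu> h) g)"
    by (simp add: q_def sw_linear[OF p] linear_scaleD[OF p] mult.commute)
qed

text \<open>
  By coassociativity \<open>\<Delta> g = \<Sum> \<Lambda>\<^sub>1 \<otimes> \<Lambda>\<^sub>2 \<mu>(\<Lambda>\<^sub>3) = \<Sum> \<Lambda>\<^sub>1 \<mu>(\<Lambda>\<^sub>2) \<otimes> g = g \<otimes> g\<close>.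
\<close>

lemma sw_grouplike:
  assumes \<beta>: "bilinear_on sX \<beta>"
  shows "sw g \<beta> = \<beta> g g"
proof -
  note lb = bilinear_compI[OF \<beta>]
  have r: "Vector_Spaces.linear scale sX (\<beta> c)" for c using \<beta> by (simp add: bilinear_on_def)
  interpret X: vector_space sX using r[of 0] by (simp add: Vector_Spaces.linear_iff)
  have lX: "Vector_Spaces.linear sX sX (sX c)" for c
    by (simp add: Vector_Spaces.linear_iff X.vector_space_axioms X.scale_right_distrib mult.commute)
  have lXI: "Vector_Spaces.linear scale sX f \<Longrightarrow> Vector_Spaces.linear scale sX (\<lambda>x. sX c (f x))" for f c
    by (simp add: Vector_Spaces.linear_iff X.scale_right_distrib mult.commute)
  have "sw g \<beta> = sw \<Lambda> (\<lambda>a b. sw (scale (\<mu> b) a) \<beta>)"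
    unfolding g_def by (intro sw_linear[of scale sX] lin_rules \<beta>)
  also have "\<dots> = sw \<Lambda> (\<lambda>a b. sw a (\<lambda>c d. sX (\<mu> b) (\<beta> c d)))"
    by (simp add: sw_scale[OF \<beta>] sw_linear[OF lX])
  also have "\<dots> = sw \<Lambda> (\<lambda>c z. sw z (\<lambda>d b. sX (\<mu> b) (\<beta> c d)))"
  proof (intro sw_coassoc[of sX] trilinear_onI lXI lb lin_rules)
    show "Vector_Spaces.linear scale sX (\<lambda>c. sX (\<mu> c) (\<beta> a b))" for a b
      using linear_mu by (simp add: Vector_Spaces.linear_iff X.vector_space_axioms X.scale_left_distrib)
  qed
  also have "\<dots> = sw \<Lambda> (\<lambda>c z. \<beta> c (sw z (\<lambda>d b. scale (\<mu> b) d)))"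
    by (simp add: sw_linear[OF r] linear_scaleD[OF r])
  also have "\<dots> = sw \<Lambda> (\<lambda>c z. \<beta> (scale (\<mu> z) c) g)"
    using lb(1)[OF linear_identI]
    by (simp add: mu_left_quasi_integral linear_scaleD[OF r] linear_scaleD[OF lb(1)[OF linear_identI]])
  also have "\<dots> = \<beta> g g"
    using sw_linear[OF lb(1)[OF linear_identI, of g], of \<Lambda> "\<lambda>c z. scale (\<mu> z) c"] by (simp add: g_def)
  finally show ?thesis .
qed

lemma counit_grouplike: "\<epsilon> g = 1"
proof -
  have "\<epsilon> g = sw \<Lambda> (\<lambda>a b. \<epsilon> a * \<mu> b)"
    by (simp add: g_def sw_linear[OF counit_linear] linear_scaleD[OF counit_linear] mult.commute)
  also have "\<dots> = \<mu> \<Lambda>" by (rule sw_counit_left) (rule linear_mu)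
  finally show ?thesis by (simp add: mu_of_integral)
qed

lemma antipode_grouplike: "S g * g = 1" "g * S g = 1" "S (S g) = g"
proof -
  show 1: "S g * g = 1"
    using sw_grouplike[of scale "\<lambda>a b. S a * b"] sw_antipode_left[OF linear_identI, of g]
    by (simp add: lin_rules counit_grouplike)
  show 2: "g * S g = 1"
    using sw_grouplike[of scale "\<lambda>a b. a * S b"] sw_antipode_right[OF linear_identI, of g]
    by (simp add: lin_rules counit_grouplike)
  have "S (S g) * S g = 1" using 2 by (metis antipode_mult antipode_one)
  then show "S (S g) = g" by (metis 1 mult.assoc mult_1_left mult_1_right)
qed

text \<open>
  The functional \<open>x \<mapsto> \<mu> (S(x) g)\<close> is a right integral, since right translation by \<open>g\<close> turns \<open>\<mu>\<close> into a
  left integral and the antipode exchanges the two sides. Its value at \<open>\<Lambda>\<close> is \<open>1\<close>.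
\<close>

lemma mu_antipode: "\<mu> x = \<mu> (S x * g)"
proof -
  define q where "q x = \<mu> (S x * g)" for x
  have q: "Vector_Spaces.linear scale (*) q" unfolding q_def by (intro lin_rules)
  have "sw x (\<lambda>a b. scale (q a) b) = scale (q x) 1" for x
  proof -
    have bil: "bilinear_on scale (\<lambda>u v. scale (\<mu> v) u)"
      by (intro lin_rules linear_mu)
    have bil': "bilinear_on scale (\<lambda>a b. scale (\<mu> (b * g)) (a * g))"
      by (intro lin_rules)
    have "scale (q x) g = sw (S x * g) (\<lambda>u v. scale (\<mu> v) u)"
      by (simp add: q_def mu_left_quasi_integral)
    also have "\<dots> = sw (S x) (\<lambda>a b. sw g (\<lambda>c d. scale (\<mu> (b * d)) (a * c)))"
      by (rule sw_mult[OF bil])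
    also have "\<dots> = sw (S x) (\<lambda>a b. scale (\<mu> (b * g)) (a * g))"
      by (intro sw_cong sw_grouplike[of scale] lin_rules)
    also have "\<dots> = sw x (\<lambda>a b. scale (q a) (S b * g))"
      unfolding q_def by (rule sw_antipode[OF bil'])
    also have "\<dots> = S (sw x (\<lambda>a b. scale (q a) b)) * g"
      using sw_linear[where f = "\<lambda>z. S z * g" and sX = scale and sY = scale and x = x
          and \<beta> = "\<lambda>a b. scale (q a) b"]
      by (simp add: lin_rules linear_scaleD[OF antipode_linear] scale_mult_left)
    finally have "scale (q x) g * S g = S (sw x (\<lambda>a b. scale (q a) b)) * g * S g" by simp
    then have 1: "scale (q x) 1 = S (sw x (\<lambda>a b. scale (q a) b))"
      by (simp add: mult.assoc antipode_grouplike scale_mult_left[symmetric])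
    have "S (scale (q x) 1) = scale (q x) 1"
      by (simp only: linear_scaleD[OF antipode_linear] antipode_one)
    from HOL.trans[OF this 1] have "S (scale (q x) 1) = S (sw x (\<lambda>a b. scale (q a) b))" .
    then show ?thesis by (simp only: antipode_eq_iff)
  qed
  from right_integral_unique[OF q this, of x]
  show ?thesis
    by (simp add: q_def antipode_integral integral_right counit_grouplike mu_of_integral)
qed

text \<open>
  Radford's formula in the unimodular case. The Nakayama automorphism of \<open>\<mu>\<close> is computed twice, once directly and once
  after rewriting \<open>\<mu>\<close> as \<open>x \<mapsto> \<mu> (S(x) g)\<close>; the results agree only if \<open>S\<^sup>4\<close> is conjugation by \<open>g\<close>.
\<close>

lemma antipode_power4: "g * b = S (S (S (S b))) * g"
proof (rule mu_left_cancel)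
  fix a
  obtain x where x: "a = S x" by (rule surj_antipode)
  obtain y where y: "b = S y" by (rule surj_antipode)
  have "\<mu> (x * y) = \<mu> (S y * (S x * g))"
    by (simp add: mu_antipode[of "x * y"] antipode_mult mult.assoc)
  also have "\<dots> = \<mu> (S (S (S x)) * (g * S y))"
    by (simp only: mu_nakayama[of "S y"] antipode_mult antipode_grouplike mult.assoc)
  also have "\<dots> = \<mu> (g * b * a)"
    by (simp only: x y mu_nakayama[of "g * S y" "S x", symmetric])
  finally have 1: "\<mu> (x * y) = \<mu> (g * b * a)" .
  have "\<mu> (x * y) = \<mu> (S (S y) * x)" by (rule mu_nakayama)
  also have "\<dots> = \<mu> (S x * (S (S (S y)) * g))"
    by (simp add: mu_antipode[of "S (S y) * x"] antipode_mult mult.assoc)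
  also have "\<dots> = \<mu> (S (S (S (S b))) * g * a)"
    by (simp only: mu_nakayama[of "S x"] antipode_mult antipode_grouplike x y)
  finally show "\<mu> (g * b * a) = \<mu> (S (S (S (S b))) * g * a)" using 1 by simp
qed

lemma sw_grouplike_power:
  assumes \<beta>: "bilinear_on sX \<beta>"
  shows "sw (g ^ i) \<beta> = \<beta> (g ^ i) (g ^ i)"
  using assms
proof (induction i arbitrary: \<beta>)
  case 0
  then show ?case by (simp add: sw_one)
next
  case (Suc i)
  note lb = bilinear_compI[OF Suc.prems]
  have "sw (g ^ Suc i) \<beta> = sw g (\<lambda>a b. sw (g ^ i) (\<lambda>c d. \<beta> (a * c) (b * d)))"
    by (simp add: sw_mult[OF Suc.prems])
  also have "\<dots> = sw g (\<lambda>a b. \<beta> (a * g ^ i) (b * g ^ i))"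
    by (intro sw_cong Suc.IH lin_rules lb)
  also have "\<dots> = \<beta> (g ^ Suc i) (g ^ Suc i)"
    using sw_grouplike[of sX "\<lambda>a b. \<beta> (a * g ^ i) (b * g ^ i)"] by (simp add: lin_rules lb)
  finally show ?case .
qed

lemma g_power_cancel: "g ^ i * x = g ^ i * y \<Longrightarrow> x = y"
proof (induction i arbitrary: x y)
  case (Suc i)
  then have "g * (g ^ i * x) = g * (g ^ i * y)" by (simp add: mult.assoc)
  then have "S g * g * (g ^ i * x) = S g * g * (g ^ i * y)" by (simp add: mult.assoc)
  then show ?case using Suc.IH by (simp add: antipode_grouplike)
qed simp

text \<open>
  Distinct grouplike elements are linearly independent. So if \<open>g\<^sup>r\<close> is a combination of independent
  lower powers of \<open>g\<close>, comparing coefficients in \<open>\<Delta> (g\<^sup>r) = g\<^sup>r \<otimes> g\<^sup>r\<close> shows that \<open>g\<^sup>r\<close> is one of them.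
\<close>

lemma grouplike_finite_order: "\<exists>m>0. g ^ m = 1"
proof -
  define G where "G r = (\<lambda>i. g ^ i) ` {..<r}" for r :: nat
  obtain r where r: "g ^ r \<in> span (G r)" and ind: "independent (G r)"
    unfolding G_def by (rule sequence_recurs)
  define B where "B = extend_basis (G r)"
  have B: "independent B" "G r \<subseteq> B" "span B = UNIV"
    using ind by (simp_all add: B_def independent_extend_basis extend_basis_superset span_extend_basis)
  define p where "p c x = representation B x c" for c x
  have p: "Vector_Spaces.linear scale (*) (p c)" for c
    unfolding p_def using B by (intro linear_coordinate)
  have pB: "p c d = (if c = d then 1 else 0)" if "d \<in> B" for c d
    using representation_basis[OF B(1) that] by (auto simp: p_def)
  have finG: "finite (G r)" by (simp add: G_def)
  define a where "a c = representation (G r) (g ^ r) c" for c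
  have expand: "g ^ r = (\<Sum>c\<in>G r. scale (a c) c)"
    unfolding a_def using ind r finG by (simp add: sum_representation_eq)
  have pa: "p c (g ^ r) = a c" if "c \<in> G r" for c
  proof -
    interpret p: Vector_Spaces.linear scale "(*)" "p c" by (rule p)
    have "p c (g ^ r) = (\<Sum>d\<in>G r. a d * p c d)"
      unfolding expand by (simp add: p.sum p.scale)
    also have "\<dots> = (\<Sum>d\<in>G r. if c = d then a d else 0)"
      using B by (intro sum.cong) (auto simp: pB subsetD)
    finally show ?thesis using that finG by (simp add: sum.delta)
  qed
  have aa: "a c * a d = (if c = d then a c else 0)" if c: "c \<in> G r" and d: "d \<in> G r" for c d
  proof -
    have bil: "bilinear_on (*) (\<lambda>x y. p c x * p d y)"
      by (intro lin_rules linear_comp[OF _ p])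
    interpret s: Vector_Spaces.linear scale "(*)" "\<lambda>x. sw x (\<lambda>x y. p c x * p d y)"
      by (intro lin_rules bil)
    have "a c * a d = sw (g ^ r) (\<lambda>x y. p c x * p d y)"
      by (simp only: sw_grouplike_power[OF bil] pa c d)
    also have "\<dots> = (\<Sum>e\<in>G r. a e * sw e (\<lambda>x y. p c x * p d y))"
      unfolding expand by (simp add: s.sum s.scale)
    also have "\<dots> = (\<Sum>e\<in>G r. if e = c then (if c = d then a c else 0) else 0)"
    proof (rule sum.cong[OF HOL.refl])
      fix e assume e: "e \<in> G r"
      then have "sw e (\<lambda>x y. p c x * p d y) = p c e * p d e"
        using sw_grouplike_power[OF bil] by (auto simp: G_def)
      then show "a e * sw e (\<lambda>x y. p c x * p d y) = (if e = c then (if c = d then a c else 0) else 0)"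
        using e B by (auto simp: pB subsetD)
    qed
    finally show ?thesis using c finG by (simp add: sum.delta)
  qed
  have "g ^ r \<noteq> 0"
    using g_power_cancel[of r 1 0] by auto
  then obtain c where c: "c \<in> G r" "a c \<noteq> 0"
    using expand by (metis (mono_tags, lifting) scale_zero_left sum.neutral)
  have ac: "a c = 1" using aa[OF c(1) c(1)] c(2) by simp
  have "a d = 0" if "d \<in> G r" "d \<noteq> c" for d
    using aa[OF c(1) that(1)] that(2) ac by auto
  then have "g ^ r = (\<Sum>d\<in>G r. if d = c then c else 0)"
    unfolding expand by (intro sum.cong) (auto simp: ac)
  then have "g ^ r = c" using c finG by (simp add: sum.delta)
  then obtain i where i: "i < r" "g ^ r = g ^ i" using c by (auto simp: G_def)
  then have "g ^ i * g ^ (r - i) = g ^ i * 1"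
    by (simp add: power_add[symmetric])
  then have "g ^ (r - i) = 1" by (rule g_power_cancel)
  then show ?thesis using i by (intro exI[of _ "r - i"]) simp
qed

end

context semisimple_hopf_algebra
begin

section \<open>The trace form\<close>

lemma commute_span_powers:
  assumes "t \<in> span (range (\<lambda>i. x ^ i))" "x * y = y * x"
  shows "t * y = y * t"
  using assms(1)
proof (induction rule: span_induct_alt)
  case (step c z t)
  then obtain i where "z = x ^ i" by auto
  moreover have "x ^ i * y = y * x ^ i"
    using assms(2) by (rule power_commuting_commutes)
  ultimately show ?case
    using step by (simp add: distrib_left distrib_right scale_mult_left[symmetric] scale_mult_right[symmetric])
qed simp

lemma span_powers_subset:
  assumes "subspace A" "1 \<in> A" "x \<in> A" "\<And>y z. y \<in> A \<Longrightarrow> z \<in> A \<Longrightarrow> y * z \<in> A"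
  shows "span (range (\<lambda>i. x ^ i)) \<subseteq> A"
proof (rule span_minimal[OF _ assms(1)])
  have "x ^ i \<in> A" for i by (induction i) (auto intro: assms)
  then show "range (\<lambda>i. x ^ i) \<subseteq> A" by blast
qed

text \<open>
  Fitting's lemma inside the algebra generated by \<open>x\<close>. The spaces spanned by the powers of exponent
  at least \<open>k\<close> decrease and stabilise, so \<open>x\<^sup>k = x\<^sup>2\<^sup>k t\<close> with \<open>t\<close> a polynomial in \<open>x\<close>; then \<open>x\<^sup>k t\<close> is an idempotent
  that fixes \<open>x\<^sup>k\<close>. The bound \<open>k \<ge> 1\<close> keeps the idempotent in every ideal that contains \<open>x\<close>.
\<close>

lemma fitting_idempotent:
  obtains k t where "k \<ge> 1" "t \<in> span (range (\<lambda>i. x ^ i))"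
    "(x ^ k * t) * (x ^ k * t) = x ^ k * t" "x ^ k * (x ^ k * t) = x ^ k"
proof -
  define W where "W k = span ((\<lambda>i. x ^ i) ` {k..})" for k :: nat
  obtain k where k: "k \<ge> 1" and least: "\<And>j. j \<ge> 1 \<Longrightarrow> dim (W k) \<le> dim (W j)"
    using ex_has_least_nat[of "\<lambda>k. k \<ge> 1" 1 "\<lambda>k. dim (W k)"] by auto
  have "W (2 * k) = W k"
    unfolding W_def
  proof (rule subspace_dim_equal)
    show "span ((\<lambda>i. x ^ i) ` {2 * k..}) \<subseteq> span ((\<lambda>i. x ^ i) ` {k..})"
      by (rule span_mono) auto
    show "dim (span ((\<lambda>i. x ^ i) ` {k..})) \<le> dim (span ((\<lambda>i. x ^ i) ` {2 * k..}))"
      using least[of "2 * k"] k unfolding W_def by simp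
  qed auto
  moreover have "x ^ k \<in> W k" unfolding W_def by (intro span_base) auto
  ultimately have "x ^ k \<in> W (2 * k)" by simp
  moreover have "W (2 * k) = (\<lambda>y. x ^ (2 * k) * y) ` span (range (\<lambda>i. x ^ i))"
  proof -
    interpret l: Vector_Spaces.linear scale scale "\<lambda>y. x ^ (2 * k) * y" by (intro lin_rules)
    have "(\<lambda>i. x ^ i) ` {2 * k..} = (\<lambda>y. x ^ (2 * k) * y) ` range (\<lambda>i. x ^ i)"
    proof -
      have "\<exists>j. x ^ i = x ^ (2 * k) * x ^ j" if "i \<ge> 2 * k" for i
        using that by (intro exI[of _ "i - 2 * k"]) (simp add: power_add[symmetric])
      moreover have "x ^ (2 * k) * x ^ j \<in> (\<lambda>i. x ^ i) ` {2 * k..}" for j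
        by (rule image_eqI[of _ _ "2 * k + j"]) (simp_all add: power_add)
      ultimately show ?thesis by (auto simp: image_iff)
    qed
    then show ?thesis unfolding W_def by (simp add: l.span_image)
  qed
  ultimately obtain t where t: "t \<in> span (range (\<lambda>i. x ^ i))" "x ^ k = x ^ (2 * k) * t" by blast
  have c: "t * x ^ k = x ^ k * t"
    by (rule commute_span_powers[OF t(1)]) (simp add: power_commutes)
  have e: "x ^ k * (x ^ k * t) = x ^ k"
    using t(2) by (simp add: mult_2 power_add mult.assoc)
  moreover have "(x ^ k * t) * (x ^ k * t) = x ^ k * t"
    using e c by (metis mult.assoc)
  ultimately show ?thesis using that k t(1) by blast
qed

lemma chi_idempotent:
  assumes "p * p = p"
  obtains r where "\<chi> p = of_nat r" "r = 0 \<longleftrightarrow> p = 0"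
proof -
  obtain r where r: "lin_trace scale (\<lambda>h. p * h) = of_nat r" "r = 0 \<longleftrightarrow> (\<forall>x. p * x = 0)"
  proof (rule lin_trace_idempotent)
    show "Vector_Spaces.linear scale scale (\<lambda>h. p * h)" by (intro lin_rules)
    show "p * (p * x) = p * x" for x by (simp add: assms mult.assoc[symmetric])
  qed auto
  have "(\<forall>x. p * x = 0) \<longleftrightarrow> p = 0" by (metis mult_1_right mult_zero_left)
  then show ?thesis using that r by (simp add: \<chi>_def)
qed

text \<open>
  The Fitting idempotent of \<open>x\<close> is a multiple of \<open>x\<close>, so its trace is zero, and therefore it vanishes.
\<close>

lemma trace_radical_nilpotent:
  assumes A: "subspace A" "1 \<in> A" "\<And>y z. y \<in> A \<Longrightarrow> z \<in> A \<Longrightarrow> y * z \<in> A"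
    and x: "x \<in> A" and rad: "\<And>y. y \<in> A \<Longrightarrow> \<chi> (x * y) = 0"
  shows "\<exists>k. x ^ k = 0"
proof -
  obtain k t where k: "k \<ge> 1" and t: "t \<in> span (range (\<lambda>i. x ^ i))"
    and p: "(x ^ k * t) * (x ^ k * t) = x ^ k * t" "x ^ k * (x ^ k * t) = x ^ k"
    by (rule fitting_idempotent)
  have t: "t \<in> A" using span_powers_subset[OF A(1,2) x A(3)] t by blast
  have "x ^ i \<in> A" for i by (induction i) (auto intro: A x)
  then have "\<chi> (x * (x ^ (k - 1) * t)) = 0" by (intro rad A t)
  moreover have "x * (x ^ (k - 1) * t) = x ^ k * t"
    using k by (cases k) (auto simp: mult.assoc)
  ultimately have "\<chi> (x ^ k * t) = 0" by simp
  moreover obtain r where "\<chi> (x ^ k * t) = of_nat r" "r = 0 \<longleftrightarrow> x ^ k * t = 0"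
    using chi_idempotent[OF p(1)] by blast
  ultimately have "x ^ k * t = 0" by simp
  then show ?thesis using p(2) by auto
qed

text \<open>
  Semisimplicity in terms of elements: \<open>a\<close> and \<open>b\<close> are the components of \<open>1\<close> in \<open>I\<close> and in a complement.
\<close>

lemma left_ideal_complement:
  assumes "is_left_ideal scale I"
  obtains a b where "a \<in> I" "1 = a + b" "\<And>x. x \<in> I \<Longrightarrow> x * b = 0"
proof -
  obtain L where L: "is_left_ideal scale L" "I \<inter> L = {0}" and dec: "\<And>x. \<exists>y\<in>I. \<exists>z\<in>L. x = y + z"
    using semisimple assms unfolding semisimple_algebra_def by metis
  obtain a b where ab: "a \<in> I" "b \<in> L" "1 = a + b" using dec by blast
  have "x * b = 0" if "x \<in> I" for x
  proof -
    have "x * b \<in> L" using L(1) ab(2) by (simp add: is_left_ideal_def)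
    moreover have "x * b = x - x * a" using ab(3) by (metis add_diff_cancel_left' distrib_left mult_1_right)
    moreover have "x - x * a \<in> I"
      using assms ab(1) that by (simp add: is_left_ideal_def subspace_diff)
    ultimately have "x * b \<in> I \<inter> L" by simp
    then show ?thesis using L(2) by blast
  qed
  then show ?thesis using that ab by blast
qed

text \<open>
  The left ideal \<open>H x\<close> has a right identity \<open>h x\<close>.
\<close>

lemma von_neumann_regular:
  fixes x :: 'h
  obtains h where "x * h * x = x"
proof -
  interpret l: Vector_Spaces.linear scale scale "\<lambda>h. h * x" by (intro lin_rules)
  have "y * (h * x) \<in> range (\<lambda>h. h * x)" for y h
    by (rule image_eqI[of _ _ "y * h"]) (simp_all add: mult.assoc)
  then have "is_left_ideal scale (range (\<lambda>h. h * x))"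
    using l.subspace_image[of UNIV] by (auto simp: is_left_ideal_def)
  then obtain a b where a: "a \<in> range (\<lambda>h. h * x)" "1 = a + b"
    and b: "\<And>y. y \<in> range (\<lambda>h. h * x) \<Longrightarrow> y * b = 0"
    by (rule left_ideal_complement) blast
  obtain h where h: "a = h * x" using a by blast
  have "x * b = 0" using b[of x] by (metis mult_1_left rangeI)
  then have "x * a = x" using a(2) by (metis add.right_neutral distrib_left mult_1_right)
  then show ?thesis using that[of h] by (simp add: h mult.assoc)
qed

lemma square_zero_trace: "x * x = 0 \<Longrightarrow> \<chi> x = 0"
proof -
  assume x: "x * x = 0"
  obtain h where h: "x * h * x = x" by (rule von_neumann_regular)
  have "\<chi> x = \<chi> (x * (x * h))" using h chi_commute[of x "x * h"] by simp
  also have "x * (x * h) = 0" by (simp add: mult.assoc[symmetric] x)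
  finally show ?thesis by (simp add: linear_zeroD[OF linear_chi])
qed

text \<open>
  The radical of the form is a left ideal of nilpotent elements, and it has a right identity that lies in it.
\<close>

lemma chi_nondegenerate:
  assumes "\<And>y. \<chi> (x * y) = 0"
  shows "x = 0"
proof -
  define I where "I = {x. \<forall>y. \<chi> (x * y) = 0}"
  have "\<chi> (z * x * y) = \<chi> (x * (y * z))" for x y z
    using chi_commute[of z "x * y"] by (simp add: mult.assoc)
  then have "is_left_ideal scale I"
    unfolding is_left_ideal_def I_def
    by (auto intro!: subspaceI simp: distrib_right scale_mult_left[symmetric] linear_zeroD[OF linear_chi]
        linear_addD[OF linear_chi] linear_scaleD[OF linear_chi])
  then obtain a b where ab: "a \<in> I" "1 = a + b" and b: "\<And>x. x \<in> I \<Longrightarrow> x * b = 0"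
    by (rule left_ideal_complement) blast
  have xa: "x * a = x" if "x \<in> I" for x
    using b[OF that] ab(2) by (metis add.right_neutral distrib_left mult_1_right)
  obtain k where k: "a ^ k = 0"
    using trace_radical_nilpotent[of UNIV a] ab(1) by (auto simp: I_def)
  have "a * a ^ i = a" for i
  proof (induction i)
    case (Suc i)
    have "a * a ^ Suc i = (a * a ^ i) * a" by (simp add: power_commutes mult.assoc)
    then show ?case using Suc xa[OF ab(1)] by simp
  qed simp
  then have "a = 0" using k by (metis mult_zero_right)
  then show ?thesis using xa[of x] assms by (simp add: I_def)
qed

text \<open>
  A functional on a subspace that vanishes on the radical of the trace form is given by that form.
  Allowing a radical matters for the counit of \<open>N\<close>, which is represented before the form on \<open>N\<close> is known to be
  nondegenerate.
\<close>

lemma functional_as_chi: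
  assumes A: "subspace A"
    and add: "\<And>x y. x \<in> A \<Longrightarrow> y \<in> A \<Longrightarrow> p (x + y) = p x + p y"
    and sc: "\<And>c x. x \<in> A \<Longrightarrow> p (scale c x) = c * p x"
    and van: "\<And>x. x \<in> A \<Longrightarrow> (\<And>y. y \<in> A \<Longrightarrow> \<chi> (x * y) = 0) \<Longrightarrow> p x = 0"
  shows "\<exists>z\<in>A. \<forall>x\<in>A. p x = \<chi> (x * z)"
proof -
  obtain B where B: "B \<subseteq> A" "independent B" "A \<subseteq> span B"
    using basis_exists[of A] by metis
  have fin: "finite B" by (rule finiteI_independent[OF B(2)])
  have "\<exists>c. \<forall>x\<in>A. p x = (\<Sum>b\<in>B. c b * \<chi> (x * b))"
  proof (rule functional_in_span[OF fin A, where q = "\<lambda>b x. \<chi> (x * b)"])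
    fix x assume x: "x \<in> A" and 0: "\<And>b. b \<in> B \<Longrightarrow> \<chi> (x * b) = 0"
    interpret l: Vector_Spaces.linear scale "(*)" "\<lambda>y. \<chi> (x * y)" by (intro lin_rules linear_chiI)
    have "\<chi> (x * y) = 0" if "y \<in> A" for y
      using l.eq_0_on_span[of B y] 0 B(3) that by blast
    then show "p x = 0" by (rule van[OF x])
  qed (auto simp: add sc distrib_right scale_mult_left[symmetric] linear_addD[OF linear_chi] linear_scaleD[OF linear_chi])
  then obtain c where c: "\<And>x. x \<in> A \<Longrightarrow> p x = (\<Sum>b\<in>B. c b * \<chi> (x * b))" by blast
  show ?thesis
  proof (intro bexI ballI)
    show "(\<Sum>b\<in>B. scale (c b) b) \<in> A"
      using B(1) by (intro subspace_sum[OF A] subspace_scale[OF A]) auto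
    fix x assume "x \<in> A"
    interpret l: Vector_Spaces.linear scale "(*)" "\<lambda>y. \<chi> (x * y)" by (intro lin_rules linear_chiI)
    show "p x = \<chi> (x * (\<Sum>b\<in>B. scale (c b) b))"
      by (simp add: c[OF \<open>x \<in> A\<close>] l.sum l.scale)
  qed
qed

lemma functional_as_chi_UNIV:
  assumes p: "Vector_Spaces.linear scale (*) p"
  shows "\<exists>z. \<forall>x. p x = \<chi> (x * z)"
proof -
  have "p x = 0" if "\<And>y. y \<in> UNIV \<Longrightarrow> \<chi> (x * y) = 0" for x
  proof -
    have "x = 0" by (rule chi_nondegenerate) (simp add: that)
    then show ?thesis by (simp add: linear_zeroD[OF p])
  qed
  then show ?thesis
    using functional_as_chi[OF subspace_UNIV linear_addD[OF p] linear_scaleD[OF p]] by blast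
qed

section \<open>Central idempotents\<close>

definition bimult_trace :: "'h \<Rightarrow> 'h \<Rightarrow> 'k" where
  "bimult_trace a b = lin_trace scale (\<lambda>x. a * x * b)"

lemma bimult_trace_one: "bimult_trace a 1 = \<chi> a"
  by (simp add: bimult_trace_def \<chi>_def)

lemma bimult_trace_move_left: "bimult_trace (a * c) b = bimult_trace (c * a) b"
proof -
  have "bimult_trace (a * c) b = lin_trace scale (\<lambda>x. a * (c * x * b))"
    by (simp add: bimult_trace_def mult.assoc)
  also have "\<dots> = lin_trace scale (\<lambda>x. c * (a * x) * b)"
    by (rule lin_trace_commute) (intro lin_rules)+
  finally show ?thesis by (simp add: bimult_trace_def mult.assoc)
qed

text \<open>
  The form \<open>\<chi> (x y)\<close> is symmetric, so a basis \<open>c\<close> and its dual basis \<open>d\<close> may be exchanged in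
  \<open>Tr (L\<^sub>a R\<^sub>b) = \<Sum> \<chi> (a c b d)\<close>.
\<close>

lemma bimult_trace_commute: "bimult_trace a b = bimult_trace b a"
proof -
  let ?B = "extend_basis {}"
  have "\<exists>d. \<forall>x. coord x c = \<chi> (x * d)" for c
    by (rule functional_as_chi_UNIV[OF linear_coord])
  then obtain d where d: "\<And>x c. coord x c = \<chi> (x * d c)" by metis
  have expand: "x = (\<Sum>c\<in>?B. scale (\<chi> (x * c)) (d c))" for x
  proof -
    have "\<chi> ((x - (\<Sum>c\<in>?B. scale (\<chi> (x * c)) (d c))) * y) = 0" for y
    proof -
      interpret l: Vector_Spaces.linear scale "(*)" "\<lambda>z. \<chi> (z * y)" by (intro lin_rules linear_chiI)
      interpret m: Vector_Spaces.linear scale "(*)" "\<lambda>y. \<chi> (x * y)" by (intro lin_rules linear_chiI)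
      have "\<chi> (x * y) = (\<Sum>c\<in>?B. coord y c * \<chi> (x * c))"
        using arg_cong[OF coordinates_expand[of y], of "\<lambda>y. \<chi> (x * y)"] by (simp only: m.sum m.scale)
      then show ?thesis
        by (simp add: l.diff l.sum l.scale d chi_commute[of y] mult.commute)
    qed
    then have "x - (\<Sum>c\<in>?B. scale (\<chi> (x * c)) (d c)) = 0" by (rule chi_nondegenerate)
    then show ?thesis by simp
  qed
  have "bimult_trace a b = (\<Sum>c\<in>?B. \<chi> (a * c * b * d c))"
    by (simp add: bimult_trace_def lin_trace_eq_sum_coords d)
  also have "\<dots> = (\<Sum>c\<in>?B. \<chi> (b * d c * a * c))"
    by (intro sum.cong HOL.refl) (metis chi_commute mult.assoc)
  also have "\<dots> = bimult_trace b a"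
    unfolding bimult_trace_def
  proof (rule lin_trace_rank_expansion[symmetric, where p = "\<lambda>c x. \<chi> (b * x * a * c)"])
    show "b * x * a = (\<Sum>c\<in>?B. scale (\<chi> (b * x * a * c)) (d c))" for x
      by (rule expand)
  qed (auto intro!: lin_rules linear_chiI)
  finally show ?thesis .
qed

definition central :: "'h \<Rightarrow> bool" where "central z \<longleftrightarrow> (\<forall>x. z * x = x * z)"

lemma centralD: "central z \<Longrightarrow> z * x = x * z"
  by (simp add: central_def)

lemma central_mult: "central y \<Longrightarrow> central z \<Longrightarrow> central (y * z)"
  unfolding central_def by (metis mult.assoc)

lemma central_diff: "central y \<Longrightarrow> central z \<Longrightarrow> central (y - z)"
  unfolding central_def by (simp add: left_diff_distrib right_diff_distrib)

lemma central_scale: "central y \<Longrightarrow> central (scale c y)"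
  unfolding central_def by (simp add: scale_mult_left[symmetric] scale_mult_right[symmetric])

lemma subspace_central: "subspace {z. central z}"
  by (rule subspaceI)
    (auto simp: central_def distrib_left distrib_right scale_mult_left[symmetric] scale_mult_right[symmetric])

lemma central_one: "central 1" by (simp add: central_def)

lemma central_power: "central y \<Longrightarrow> central (y ^ k)"
  by (induction k) (auto intro: central_mult central_one)

text \<open>
  The functional \<open>a \<mapsto> Tr (L\<^sub>a R\<^sub>b)\<close> is \<open>\<chi> (- z)\<close> for some \<open>z\<close>; it is a trace, so \<open>z\<close> is central.
\<close>

lemma bimult_trace_casimir:
  obtains z where "central z" "\<And>a. bimult_trace a b = \<chi> (a * z)"
proof -
  have lin: "Vector_Spaces.linear scale (*) (\<lambda>a. bimult_trace a b)"
    unfolding bimult_trace_def lin_trace_eq_sum_coords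
    by (intro linear_sumI vector_space_field lin_rules)
  obtain z where z: "\<And>a. bimult_trace a b = \<chi> (a * z)"
    using functional_as_chi_UNIV[OF lin] by blast
  interpret l: Vector_Spaces.linear scale "(*)" \<chi> by (rule linear_chi)
  have "z * c = c * z" for c
  proof -
    have "\<chi> ((z * c - c * z) * a) = 0" for a
    proof -
      have "\<chi> (z * c * a) = \<chi> (c * a * z)" by (metis chi_commute mult.assoc)
      also have "\<dots> = \<chi> (a * c * z)" by (metis z bimult_trace_move_left)
      also have "\<dots> = \<chi> (c * z * a)" by (metis chi_commute mult.assoc)
      finally have "\<chi> (z * c * a) = \<chi> (c * z * a)" .
      then show ?thesis by (simp add: left_diff_distrib l.diff)
    qed
    then have "z * c - c * z = 0" by (rule chi_nondegenerate)
    then show ?thesis by simp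
  qed
  then have "central z" by (simp add: central_def)
  then show ?thesis using z by (rule that)
qed

lemma central_nilpotent_eq_0:
  assumes "central y" "y ^ k = 0"
  shows "y = 0"
proof -
  have sq: "z = 0" if z: "central z" "z * z = 0" for z
  proof -
    obtain h where "z * h * z = z" by (rule von_neumann_regular)
    moreover have "z * h * z = z * z * h" using centralD[OF z(1), of "z * h"] by (simp add: mult.assoc)
    ultimately show ?thesis using z(2) by simp
  qed
  show ?thesis
    using assms(2)
  proof (induction k rule: less_induct)
    case (less k)
    show ?case
    proof (cases "k \<le> 1")
      case True
      then show ?thesis using less.prems
        by (cases k) auto
    next
      case False
      then have "2 * (k - 1) = k + (k - 2)" by simp
      then have "y ^ (k - 1) * y ^ (k - 1) = y ^ k * y ^ (k - 2)"
        by (simp only: power_add[symmetric] mult_2[symmetric])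
      then have "y ^ (k - 1) * y ^ (k - 1) = 0"
        by (simp only: less.prems mult_zero_left)
      then have "y ^ (k - 1) = 0"
        by (rule sq[OF central_power[OF assms(1)]])
      then show ?thesis using False by (intro less.IH[of "k - 1"]) auto
    qed
  qed
qed

text \<open>
  A decomposition of \<open>1\<close> into orthogonal nonzero central idempotents. One with the largest number of
  members corresponds to the decomposition of \<open>H\<close> into simple blocks.
\<close>

definition central_partition :: "'h set \<Rightarrow> bool" where
  "central_partition E \<longleftrightarrow> finite E \<and> (\<forall>e\<in>E. central e \<and> e * e = e \<and> e \<noteq> 0) \<and>
     (\<forall>e\<in>E. \<forall>f\<in>E. e \<noteq> f \<longrightarrow> e * f = 0) \<and> (\<Sum>e\<in>E. e) = 1"

lemma card_central_partition_le:
  assumes "central_partition E"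
  shows "card E \<le> dim UNIV"
proof (rule independent_card_le_dim)
  show "independent E"
  proof (rule independent_if_scalars_zero)
    show "finite E" using assms by (simp add: central_partition_def)
    fix c e assume sum: "(\<Sum>x\<in>E. scale (c x) x) = 0" and e: "e \<in> E"
    have "0 = (\<Sum>x\<in>E. scale (c x) x) * e" by (simp add: sum)
    also have "\<dots> = (\<Sum>x\<in>E. if x = e then scale (c e) e else 0)"
      unfolding sum_distrib_right using assms e
      by (intro sum.cong) (auto simp: central_partition_def scale_mult_left[symmetric])
    also have "\<dots> = scale (c e) e"
      using assms e by (simp add: central_partition_def sum.delta)
    finally show "c e = 0" using assms e by (simp add: central_partition_def)
  qed
qed simp

lemma maximal_central_partition:
  obtains E where "central_partition E" "\<And>F. central_partition F \<Longrightarrow> card F \<le> card E"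
proof -
  have "central_partition {1}" by (simp add: central_partition_def central_one)
  moreover have "\<forall>F. central_partition F \<longrightarrow> card F < Suc (dim UNIV)"
    using card_central_partition_le by (auto simp: less_Suc_eq_le)
  ultimately have "\<exists>E. central_partition E \<and> (\<forall>F. central_partition F \<longrightarrow> card F \<le> card E)"
    by (rule ex_has_greatest_nat)
  then show ?thesis using that by metis
qed

text \<open>
  In a finest partition the corner \<open>Z e\<close> of the centre is a field. The Fitting idempotent \<open>q\<close> of a
  nonzero \<open>y \<in> Z e\<close> is nonzero because \<open>y\<close> is not nilpotent; if it differed from \<open>e\<close>, then \<open>e\<close> could be
  split into \<open>q\<close> and \<open>e - q\<close>.
\<close>

lemma maximal_partition_corner:
  assumes E: "central_partition E" and max: "\<And>F. central_partition F \<Longrightarrow> card F \<le> card E"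
    and e: "e \<in> E" and y: "central y" "y * e = y" "y \<noteq> 0"
  obtains t where "t * y = e"
proof -
  obtain k t where k: "k \<ge> 1" and t: "t \<in> span (range (\<lambda>i. y ^ i))"
    and p: "(y ^ k * t) * (y ^ k * t) = y ^ k * t" "y ^ k * (y ^ k * t) = y ^ k"
    by (rule fitting_idempotent)
  define q where "q = y ^ k * t"
  have ct: "central t"
    using span_powers_subset[OF subspace_central, of y] t y(1) central_mult central_one by auto
  have cq: "central q" unfolding q_def by (intro central_mult central_power y ct)
  have qq: "q * q = q" using p by (simp add: q_def)
  have eE: "central e" "e * e = e" "e \<noteq> 0" and fin: "finite E" using E e by (auto simp: central_partition_def)
  have "e * y = y" using y(2) centralD[OF eE(1), of y] by simp
  then have eq: "e * q = q"
    using k unfolding q_def by (cases k) (simp_all add: mult.assoc[symmetric])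
  have qe: "q * e = q" using eq centralD[OF eE(1)] by simp
  have q0: "q \<noteq> 0"
  proof
    assume "q = 0"
    then have "y ^ k = 0" using p(2) by (simp add: q_def)
    then show False using central_nilpotent_eq_0[OF y(1)] y(3) by blast
  qed
  have "q = e"
  proof (rule ccontr)
    assume ne: "q \<noteq> e"
    define F where "F = insert q (insert (e - q) (E - {e}))"
    have q_other: "q * f = 0" "f * q = 0" if "f \<in> E - {e}" for f
    proof -
      have ef: "e * f = 0" "f * e = 0" using that e E by (auto simp: central_partition_def)
      show "q * f = 0" by (metis qe ef(1) mult.assoc mult_zero_right)
      show "f * q = 0" by (metis eq ef(2) mult.assoc mult_zero_left)
    qed
    have e_other: "e * f = 0" "f * e = 0" if "f \<in> E - {e}" for f
      using that e E by (auto simp: central_partition_def)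
    have q_notin: "q \<notin> E - {e}" using q_other(1)[of q] qq q0 by auto
    have d_idem: "(e - q) * (e - q) = e - q"
      by (simp add: left_diff_distrib right_diff_distrib eE qq eq qe)
    have d_notin: "e - q \<notin> E - {e}"
    proof
      assume a: "e - q \<in> E - {e}"
      then have "(e - q) * (e - q) = 0"
        using q_other(1)[OF a] e_other(1)[OF a] by (simp add: left_diff_distrib)
      then show False using d_idem ne by simp
    qed
    have qd: "q * (e - q) = 0" "(e - q) * q = 0"
      by (simp_all add: left_diff_distrib right_diff_distrib qq eq qe)
    have dq: "e - q \<noteq> q" using qd qq q0 by metis
    have "central_partition F"
      unfolding central_partition_def
    proof (intro conjI)
      show "finite F" using fin by (simp add: F_def)
      show "\<forall>f\<in>F. central f \<and> f * f = f \<and> f \<noteq> 0"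
        using E cq qq q0 d_idem ne central_diff[OF eE(1) cq] by (auto simp: F_def central_partition_def)
      show "\<forall>f\<in>F. \<forall>h\<in>F. f \<noteq> h \<longrightarrow> f * h = 0"
        using E q_other e_other qd
        by (auto simp: F_def central_partition_def left_diff_distrib right_diff_distrib)
      have "(\<Sum>f\<in>F. f) = q + (e - q + (\<Sum>f\<in>E - {e}. f))"
        unfolding F_def using fin q_notin d_notin dq by (subst sum.insert; simp)+
      also have "\<dots> = (\<Sum>f\<in>E. f)"
        using fin e by (simp add: sum.remove)
      finally show "(\<Sum>f\<in>F. f) = 1" using E by (simp add: central_partition_def)
    qed
    moreover have "card F = Suc (card E)"
    proof -
      have "card F = Suc (Suc (card (E - {e})))"
        unfolding F_def using fin q_notin d_notin dq by simp
      then show ?thesis using fin e by (metis card_Suc_Diff1)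
    qed
    ultimately show False using max by fastforce
  qed
  moreover have "q = (t * y ^ (k - 1)) * y"
  proof -
    have "q = t * y ^ k" by (simp add: q_def centralD[OF ct])
    then show ?thesis using k by (cases k) (simp_all add: mult.assoc power_commutes)
  qed
  ultimately show ?thesis using that by blast
qed

lemma in_span_sequence:
  fixes s :: "nat \<Rightarrow> 'h"
  assumes "x \<in> span (s ` {..<r})"
  shows "\<exists>c. x = (\<Sum>i<r. scale (c i) (s i))"
  using assms
proof (induction rule: span_induct_alt)
  case base
  show ?case by (intro exI[of _ "\<lambda>_. 0"]) simp
next
  case (step a v x)
  then obtain c j where c: "x = (\<Sum>i<r. scale (c i) (s i))" and j: "j < r" "v = s j" by auto
  have "(\<Sum>i<r. scale ((c(j := c j + a)) i) (s i)) = (\<Sum>i<r. scale (c i) (s i) + (if i = j then scale a (s j) else 0))"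
    by (intro sum.cong) (auto simp: scale_left_distrib)
  then show ?case
    using j c by (intro exI[of _ "c(j := c j + a)"]) (simp add: sum.distrib)
qed

text \<open>
  The eigenvector lies in the cyclic space of \<open>x\<close>, which keeps it in the corner that contains \<open>x\<close>. A polynomial
  \<open>q\<close> of least degree with \<open>q(u) x = 0\<close> has a root \<open>\<alpha>\<close>, and \<open>q(u) / (u - \<alpha>)\<close> applied to \<open>x\<close> is the eigenvector.
\<close>

lemma eigenvalue_exists:
  fixes u x :: 'h
  assumes "x \<noteq> 0"
  obtains \<alpha> v where "v \<noteq> 0" "u * v = scale \<alpha> v" "v \<in> span (range (\<lambda>i. u ^ i * x))"
proof -
  define ev where "ev q = (\<Sum>i\<le>degree q. scale (coeff q i) (u ^ i * x))" for q :: "'k poly"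
  have ev: "ev q = (\<Sum>i\<le>n. scale (coeff q i) (u ^ i * x))" if "degree q \<le> n" for q n
    unfolding ev_def using that by (intro sum.mono_neutral_left) (auto simp: coeff_eq_0)
  obtain r where r: "u ^ r * x \<in> span ((\<lambda>i. u ^ i * x) ` {..<r})"
    using sequence_recurs[of "\<lambda>i. u ^ i * x"] by blast
  then obtain c where c: "u ^ r * x = (\<Sum>i<r. scale (c i) (u ^ i * x))"
    using in_span_sequence by blast
  define q0 where "q0 = monom 1 r - (\<Sum>i<r. monom (c i) i)"
  have co: "coeff q0 i = (if i = r then 1 else if i < r then - c i else 0)" for i
    by (auto simp: q0_def coeff_sum coeff_monom sum.delta)
  have deg: "degree q0 \<le> r" by (rule degree_le) (simp add: co)
  have "ev q0 = (\<Sum>i<r. scale (- c i) (u ^ i * x)) + u ^ r * x"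
    by (simp add: ev[OF deg] lessThan_Suc_atMost[symmetric] co)
  then have "ev q0 = 0" using c by (simp add: sum_negf)
  moreover have "q0 \<noteq> 0" using co[of r] by auto
  ultimately obtain q where q: "q \<noteq> 0" "ev q = 0"
    and least: "\<And>p. p \<noteq> 0 \<Longrightarrow> ev p = 0 \<Longrightarrow> degree q \<le> degree p"
    using ex_has_least_nat[of "\<lambda>q. q \<noteq> 0 \<and> ev q = 0" q0 degree] by blast
  have "degree q > 0"
  proof (rule ccontr)
    assume "\<not> degree q > 0"
    then obtain a where "q = [:a:]" by (metis degree_eq_zeroE not_gr_zero)
    then show False using q assms by (simp add: ev_def)
  qed
  then obtain \<alpha> where "poly q \<alpha> = 0" using alg_closed_imp_poly_has_root by blast
  then obtain p where p: "q = [:- \<alpha>, 1:] * p" by (auto simp: poly_eq_0_iff_dvd dvd_def)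
  have p0: "p \<noteq> 0" using q p by auto
  have "degree q = Suc (degree p)" unfolding p using p0 by (subst degree_mult_eq) auto
  then have vnz: "ev p \<noteq> 0" using least[OF p0] by auto
  define n where "n = Suc (degree p)"
  have "ev q = (\<Sum>i\<le>n. scale (coeff q i) (u ^ i * x))"
    by (rule ev) (simp add: n_def \<open>degree q = Suc (degree p)\<close>)
  also have "\<dots> = (\<Sum>i\<le>n. scale (- \<alpha> * coeff p i) (u ^ i * x)) + (\<Sum>i\<le>n. scale (coeff (pCons 0 p) i) (u ^ i * x))"
    by (simp add: p scale_left_diff_distrib sum_subtractf sum_negf)
  also have "(\<Sum>i\<le>n. scale (- \<alpha> * coeff p i) (u ^ i * x)) = scale (- \<alpha>) (\<Sum>i\<le>n. scale (coeff p i) (u ^ i * x))"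
    by (simp add: scale_sum_right)
  also have "(\<Sum>i\<le>n. scale (coeff p i) (u ^ i * x)) = ev p"
    by (rule ev[symmetric]) (simp add: n_def)
  also have "(\<Sum>i\<le>n. scale (coeff (pCons 0 p) i) (u ^ i * x)) = u * ev p"
    unfolding n_def sum.atMost_Suc_shift
    by (simp add: ev_def sum_distrib_left scale_mult_right mult.assoc)
  finally have "u * ev p = scale \<alpha> (ev p)" using q by simp
  moreover have "ev p \<in> span (range (\<lambda>i. u ^ i * x))"
    unfolding ev_def by (intro span_sum span_scale span_base) auto
  ultimately show ?thesis using that vnz by blast
qed

text \<open>
  The corner \<open>Z e\<close> is a field that is finite over an algebraically closed one.
\<close>

lemma maximal_partition_scalar:
  assumes E: "central_partition E" and max: "\<And>F. central_partition F \<Longrightarrow> card F \<le> card E"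
    and e: "e \<in> E" and z: "central z"
  obtains \<alpha> where "z * e = scale \<alpha> e"
proof -
  have eE: "central e" "e * e = e" "e \<noteq> 0" using E e by (auto simp: central_partition_def)
  obtain \<alpha> v where v: "v \<noteq> 0" "z * v = scale \<alpha> v" "v \<in> span (range (\<lambda>i. z ^ i * e))"
    by (rule eigenvalue_exists[OF eE(3)])
  have ev: "e * v = v"
    using v(3)
  proof (induction rule: span_induct_alt)
    case (step c a b)
    then obtain i where "a = z ^ i * e" by auto
    then have "e * a = a" by (metis centralD central_power z eE(2) mult.assoc)
    then show ?case using step by (simp add: distrib_left scale_mult_right[symmetric])
  qed simp
  define y where "y = z * e - scale \<alpha> e"
  have "y * v = 0" by (simp add: y_def left_diff_distrib mult.assoc ev v(2) scale_mult_left[symmetric])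
  have "y = 0"
  proof (rule ccontr)
    assume "y \<noteq> 0"
    moreover have "central y" unfolding y_def by (intro central_diff central_mult central_scale z eE)
    moreover have "y * e = y"
      by (simp add: y_def left_diff_distrib mult.assoc eE scale_mult_left[symmetric])
    ultimately obtain t where "t * y = e" using maximal_partition_corner[OF E max e] by metis
    then have "v = t * (y * v)" by (metis ev mult.assoc)
    then show False using \<open>y * v = 0\<close> v(1) by simp
  qed
  then have "z * e = scale \<alpha> e" by (simp add: y_def)
  then show ?thesis by (rule that)
qed

text \<open>
  On a block \<open>e = End(V)\<close> with \<open>dim V = d\<close> this reads \<open>Tr (L\<^sub>a R\<^sub>b) = tr\<^sub>V(a) tr\<^sub>V(b)\<close>, with \<open>\<chi> = d tr\<^sub>V\<close> and \<open>\<chi> e = d\<^sup>2\<close>. Here it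
  follows from the fact that the central element representing \<open>Tr (L\<^sub>a R\<^sub>b)\<close> acts on \<open>e\<close> by a scalar.
\<close>

lemma bimult_trace_decomposition:
  assumes E: "central_partition E" and max: "\<And>F. central_partition F \<Longrightarrow> card F \<le> card E"
  shows "bimult_trace a b = (\<Sum>e\<in>E. \<chi> (a * e) * \<chi> (b * e) / \<chi> e)"
proof -
  obtain z where z: "central z" and tr: "\<And>a. bimult_trace a b = \<chi> (a * z)"
    by (rule bimult_trace_casimir[of b]) blast
  have summand: "\<chi> (a * z * e) = \<chi> (a * e) * \<chi> (b * e) / \<chi> e" if e: "e \<in> E" for e
  proof -
    have eE: "central e" "e * e = e" "e \<noteq> 0" using E e by (auto simp: central_partition_def)
    obtain \<alpha> where \<alpha>: "z * e = scale \<alpha> e" by (rule maximal_partition_scalar[OF E max e z])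
    obtain r where "\<chi> e = of_nat r" "r = 0 \<longleftrightarrow> e = 0" using chi_idempotent[OF eE(2)] by blast
    then have nz: "\<chi> e \<noteq> 0" using eE by auto
    have "bimult_trace e b = bimult_trace 1 (b * e)"
      unfolding bimult_trace_def by (metis centralD[OF eE(1)] mult.assoc mult_1_left)
    also have "\<dots> = \<chi> (b * e)" by (subst bimult_trace_commute) (rule bimult_trace_one)
    finally have "\<chi> (b * e) = \<chi> (e * z)" using tr by simp
    also have "\<dots> = \<alpha> * \<chi> e"
      using \<alpha> centralD[OF z, of e] by (simp add: linear_scaleD[OF linear_chi])
    finally have "\<alpha> = \<chi> (b * e) / \<chi> e" using nz by simp
    then show ?thesis
      by (simp add: mult.assoc \<alpha> scale_mult_right[symmetric] linear_scaleD[OF linear_chi])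
  qed
  interpret l: Vector_Spaces.linear scale "(*)" \<chi> by (rule linear_chi)
  have "bimult_trace a b = \<chi> (a * z * (\<Sum>e\<in>E. e))"
    using E by (simp add: tr central_partition_def)
  also have "\<dots> = (\<Sum>e\<in>E. \<chi> (a * z * e))" by (simp add: sum_distrib_left l.sum)
  finally show ?thesis by (simp add: summand)
qed

end

section \<open>Positivity\<close>

lemma card_roots_of_unity:
  assumes "M > 0"
  shows "card {\<alpha>::'k::{alg_closed_field, field_char_0}. \<alpha> ^ M = 1} = M"
proof -
  define p :: "'k poly" where "p = monom 1 M - 1"
  have co: "coeff p i = (if i = M then 1 else 0) - (if i = 0 then 1 else 0)" for i
    by (auto simp: p_def coeff_monom coeff_1)
  have deg: "degree p = M"
  proof (rule antisym)
    show "degree p \<le> M" by (rule degree_le) (use assms in \<open>simp add: co\<close>)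
    show "M \<le> degree p" by (rule le_degree) (use assms in \<open>simp add: co\<close>)
  qed
  then have p0: "p \<noteq> 0" using assms by auto
  have roots: "poly p \<alpha> = 0 \<longleftrightarrow> \<alpha> ^ M = 1" for \<alpha>
    by (simp add: p_def poly_monom)
  have "pderiv p = monom (of_nat M) (M - 1)" by (simp add: p_def pderiv_diff pderiv_monom)
  then have "rsquarefree p"
    unfolding rsquarefree_roots using assms by (auto simp: roots poly_monom power_0_left)
  then have ord: "order \<alpha> p = 1" if "poly p \<alpha> = 0" for \<alpha>
    using that p0 unfolding rsquarefree_def order_root by metis
  obtain A where A: "size A = degree p" "p = smult (lead_coeff p) (\<Prod>x\<in>#A. [:-x, 1:])"
    using alg_closed_imp_factorization[OF p0] by blast
  have "proots p = (\<Sum>x\<in>#A. proots [:-x, 1:])"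
  proof -
    have "proots p = proots (\<Prod>x\<in>#A. [:-x, 1:])"
      using arg_cong[OF A(2), of proots] p0 by simp
    also have "\<dots> = (\<Sum>x\<in>#A. proots [:-x, 1:])"
    proof -
      have "0 \<notin># image_mset (\<lambda>x. [:-x, 1:]) A" by auto
      from proots_prod_mset[OF this] show ?thesis by (simp add: multiset.map_comp comp_def)
    qed
    finally show ?thesis .
  qed
  then have "size (proots p) = M" by (simp add: deg A(1))
  moreover have "size (proots p) = (\<Sum>\<alpha>\<in>{\<alpha>. poly p \<alpha> = 0}. order \<alpha> p)"
    using p0 by (simp add: size_multiset_overloaded_eq)
  ultimately show ?thesis by (simp add: ord roots)
qed

text \<open>
  For \<open>j \<noteq> 1\<close> some root \<open>\<beta>\<close> satisfies \<open>\<beta>\<^sup>j \<noteq> \<beta>\<close>, as this is an equation of degree less than \<open>M\<close>; multiplication by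
  \<open>\<beta>\<close> permutes the roots and rescales the sum by a factor other than \<open>1\<close>.
\<close>

lemma sum_roots_of_unity:
  assumes "M \<ge> 2" "j < M"
  shows "(\<Sum>\<alpha>\<in>{\<alpha>::'k::{alg_closed_field, field_char_0}. \<alpha> ^ M = 1}. \<alpha> * inverse \<alpha> ^ j) =
    (if j = 1 then of_nat M else 0)"
proof -
  let ?R = "{\<alpha>::'k. \<alpha> ^ M = 1}"
  have nz: "\<alpha> \<noteq> 0" if "\<alpha> \<in> ?R" for \<alpha> using that assms by (auto simp: power_0_left)
  show ?thesis
  proof (cases "j = 1")
    case True
    then have "(\<Sum>\<alpha>\<in>?R. \<alpha> * inverse \<alpha> ^ j) = (\<Sum>\<alpha>\<in>?R. 1)"
      using nz by (intro sum.cong) auto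
    then show ?thesis using True card_roots_of_unity[where 'k = 'k, of M] assms by simp
  next
    case False
    have "\<exists>\<beta>\<in>?R. \<beta> * inverse \<beta> ^ j \<noteq> 1"
    proof (rule ccontr)
      assume "\<not> ?thesis"
      then have all: "\<beta> * inverse \<beta> ^ j = 1" if "\<beta> \<in> ?R" for \<beta> using that by blast
      define p :: "'k poly" where "p = monom 1 1 - monom 1 j"
      have "coeff p 1 = 1" using False by (simp add: p_def coeff_monom)
      then have p0: "p \<noteq> 0" by auto
      have "degree p < M"
      proof -
        have "degree p \<le> max 1 j"
          unfolding p_def by (rule degree_diff_le_max[THEN order_trans]) (simp add: degree_monom_eq)
        then show ?thesis using assms by simp
      qed
      have "?R \<subseteq> {x. poly p x = 0}"
        using all nz by (auto simp: p_def poly_monom power_inverse field_simps)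
      then have "card ?R \<le> card {x. poly p x = 0}"
        by (intro card_mono poly_roots_finite p0)
      also have "\<dots> \<le> degree p" by (rule card_poly_roots_bound[OF p0])
      finally show False
        using \<open>degree p < M\<close> card_roots_of_unity[where 'k = 'k, of M] assms by simp
    qed
    then obtain \<beta> where \<beta>: "\<beta> \<in> ?R" "\<beta> * inverse \<beta> ^ j \<noteq> 1" by blast
    let ?s = "\<Sum>\<alpha>\<in>?R. \<alpha> * inverse \<alpha> ^ j"
    have "?s = (\<Sum>\<alpha>\<in>?R. (\<beta> * \<alpha>) * inverse (\<beta> * \<alpha>) ^ j)"
      by (rule sum.reindex_bij_witness[of _ "\<lambda>\<alpha>. \<beta> * \<alpha>" "\<lambda>\<alpha>. inverse \<beta> * \<alpha>"])
        (use \<beta>(1) nz[OF \<beta>(1)] in \<open>auto simp: power_mult_distrib power_inverse field_simps\<close>)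
    also have "\<dots> = (\<beta> * inverse \<beta> ^ j) * ?s"
      unfolding sum_distrib_left by (intro sum.cong) (simp_all add: power_mult_distrib mult_ac)
    finally have "(1 - \<beta> * inverse \<beta> ^ j) * ?s = 0" by (simp add: algebra_simps)
    then show ?thesis using \<beta>(2) False by simp
  qed
qed

text \<open>
  A coordinate function of the field, viewed as a vector space over the rational numbers. It transports
  identities with rational coefficients to an ordered field.
\<close>

lemma rational_functional:
  fixes x :: "'k::field_char_0"
  assumes "x \<noteq> 0"
  obtains \<theta> :: "'k \<Rightarrow> rat"
  where "\<theta> x \<noteq> 0" "\<And>y z. \<theta> (y + z) = \<theta> y + \<theta> z" "\<And>r y. \<theta> (of_rat r * y) = r * \<theta> y"
proof -
  interpret Q: vector_space "\<lambda>(r::rat) (y::'k). of_rat r * y"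
    by unfold_locales (simp_all add: algebra_simps of_rat_add of_rat_mult)
  define B where "B = Q.extend_basis {x}"
  have ind: "Q.independent {x}" using assms by simp
  have B: "Q.independent B" "x \<in> B" "Q.span B = UNIV"
    using Q.independent_extend_basis[OF ind] Q.extend_basis_superset[OF ind] Q.span_extend_basis[OF ind]
    by (auto simp: B_def)
  show ?thesis
  proof (rule that[of "\<lambda>y. Q.representation B y x"])
    show "Q.representation B x x \<noteq> 0" using Q.representation_basis[OF B(1,2)] by simp
  qed (use B in \<open>auto simp: Q.representation_add Q.representation_scale\<close>)
qed

context semisimple_hopf_algebra
begin

text \<open>
  For an element \<open>v\<close> of the corner \<open>e H e\<close> with \<open>v\<^sup>M = e\<close>, the projection onto the \<open>\<alpha>\<close>-eigenspace of \<open>v\<close>.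
\<close>

definition eigenprojection :: "'h \<Rightarrow> 'h \<Rightarrow> nat \<Rightarrow> 'k \<Rightarrow> 'h" where
  "eigenprojection e v M \<alpha> = scale (1 / of_nat M) (\<Sum>j<M. scale (inverse \<alpha> ^ j) (v ^ j * e))"

context
  fixes e v :: 'h and M :: nat
  assumes M: "M > 0" and ee: "e * e = e" and ev: "e * v = v" "v * e = v" and vM: "v ^ M * e = e"
begin

lemma e_power: "e * v ^ j = v ^ j * e"
  using ev by (metis power_commuting_commutes)

lemma eigenprojection_eigen:
  assumes "\<alpha> ^ M = 1"
  shows "v * eigenprojection e v M \<alpha> = scale \<alpha> (eigenprojection e v M \<alpha>)"
proof -
  have \<alpha>: "\<alpha> \<noteq> 0" using assms M by (auto simp: power_0_left)
  define F where "F j = scale (\<alpha> * inverse \<alpha> ^ j) (v ^ j * e)" for j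
  have "F M = F 0" using assms vM by (simp add: F_def power_inverse)
  have "(\<Sum>j<M. v * scale (inverse \<alpha> ^ j) (v ^ j * e)) = (\<Sum>j<M. F (Suc j))"
    using \<alpha> by (intro sum.cong) (simp_all add: F_def scale_mult_right[symmetric] mult.assoc)
  also have "\<dots> = (\<Sum>j<M. F j)"
    using sum.lessThan_Suc_shift[of F M] sum.lessThan_Suc[of F M] \<open>F M = F 0\<close> by simp
  also have "\<dots> = scale \<alpha> (\<Sum>j<M. scale (inverse \<alpha> ^ j) (v ^ j * e))"
    by (simp add: F_def scale_sum_right)
  finally show ?thesis
    by (simp add: eigenprojection_def scale_mult_right[symmetric] sum_distrib_left scale_left_commute
        mult.commute)
qed

lemma eigenprojection_idempotent:
  assumes "\<alpha> ^ M = 1"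
  shows "eigenprojection e v M \<alpha> * eigenprojection e v M \<alpha> = eigenprojection e v M \<alpha>"
proof -
  let ?f = "eigenprojection e v M \<alpha>"
  have \<alpha>: "\<alpha> \<noteq> 0" using assms M by (auto simp: power_0_left)
  have "e * (v ^ j * e) = v ^ j * e" for j
    by (metis e_power ee mult.assoc)
  then have ef: "e * ?f = ?f"
    by (simp add: eigenprojection_def scale_mult_right[symmetric] sum_distrib_left)
  have vf: "v ^ j * ?f = scale (\<alpha> ^ j) ?f" for j
  proof (induction j)
    case (Suc j)
    have "v ^ Suc j * ?f = v ^ j * (v * ?f)" by (simp add: power_commutes mult.assoc[symmetric])
    then show ?case
      using Suc by (simp add: eigenprojection_eigen[OF assms] scale_mult_right[symmetric] mult.commute)
  qed simp
  have "?f * ?f = scale (1 / of_nat M) (\<Sum>j<M. scale (inverse \<alpha> ^ j) (v ^ j * (e * ?f)))"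
    by (subst (1) eigenprojection_def)
      (simp add: scale_mult_left[symmetric] sum_distrib_right mult.assoc)
  also have "\<dots> = scale (1 / of_nat M) (\<Sum>j<M. ?f)"
    using \<alpha> by (simp add: ef vf power_inverse)
  also have "\<dots> = ?f" using M by (simp add: sum_constant_scale del: sum_constant)
  finally show ?thesis .
qed

lemma sum_eigenprojections:
  assumes "M \<ge> 2"
  shows "(\<Sum>\<alpha>\<in>{\<alpha>. \<alpha> ^ M = 1}. scale \<alpha> (eigenprojection e v M \<alpha>)) = v"
proof -
  let ?R = "{\<alpha>::'k. \<alpha> ^ M = 1}"
  have "(\<Sum>\<alpha>\<in>?R. scale \<alpha> (eigenprojection e v M \<alpha>))
      = scale (1 / of_nat M) (\<Sum>\<alpha>\<in>?R. \<Sum>j<M. scale (\<alpha> * inverse \<alpha> ^ j) (v ^ j * e))"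
    by (simp add: eigenprojection_def scale_sum_right mult_ac)
  also have "(\<Sum>\<alpha>\<in>?R. \<Sum>j<M. scale (\<alpha> * inverse \<alpha> ^ j) (v ^ j * e))
      = (\<Sum>j<M. scale (\<Sum>\<alpha>\<in>?R. \<alpha> * inverse \<alpha> ^ j) (v ^ j * e))"
    by (subst sum.swap) (simp add: scale_sum_left)
  also have "\<dots> = (\<Sum>j<M. if j = 1 then scale (of_nat M) v else 0)"
    using assms by (intro sum.cong) (auto simp: sum_roots_of_unity ev)
  also have "\<dots> = scale (of_nat M) v" using assms by (simp add: sum.delta)
  finally show ?thesis using M by simp
qed

text \<open>
  The summand of index \<open>j\<close> vanishes for even \<open>j\<close>, so the difference is determined by the traces of the odd powers
  of \<open>v\<close>.
\<close>

lemma chi_eigenprojection_difference: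
  "\<chi> (eigenprojection e v M \<alpha>) - \<chi> (eigenprojection e v M (- \<alpha>)) =
     (\<Sum>j<M. (1 - (- 1) ^ j) * inverse \<alpha> ^ j / of_nat M * \<chi> (v ^ j * e))"
proof -
  interpret l: Vector_Spaces.linear scale "(*)" \<chi> by (rule linear_chi)
  have "inverse (- \<alpha>) ^ j = (- 1) ^ j * inverse \<alpha> ^ j" for j
    by (metis inverse_minus_eq power_minus)
  then show ?thesis
    by (simp add: eigenprojection_def l.scale l.sum sum_distrib_left sum_subtractf[symmetric]
        left_diff_distrib diff_divide_distrib)
qed

end

lemma chi_integral: "\<chi> \<Lambda> = 1"
proof -
  have "\<chi> \<Lambda> = lin_trace scale (\<lambda>h. \<Sum>i\<in>{()}. scale (\<epsilon> h) \<Lambda>)"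
    by (simp add: \<chi>_def integral_right)
  also have "\<dots> = (\<Sum>i\<in>{()}. \<epsilon> \<Lambda>)"
    by (rule lin_trace_rank_expansion) (auto simp: counit_linear)
  finally show ?thesis by (simp add: counit_integral)
qed

text \<open>
  The trace form of the regular character is nondegenerate and has density \<open>w\<close>.
\<close>

lemma w_inverse: obtains w' where "w * w' = 1" "w' * w = 1"
proof -
  have lin: "Vector_Spaces.linear scale scale (\<lambda>x. w * x)" by (intro lin_rules)
  have 0: "x = 0" if "w * x = 0" for x
  proof -
    have "S (S x) * w = 0" using that by (simp add: w_intertwines[symmetric])
    then have "\<chi> (y * S (S x)) = 0" for y by (simp add: chi_eq_mu mult.assoc linear_zeroD[OF linear_mu])
    then have "S (S x) = 0" by (intro chi_nondegenerate) (simp add: chi_commute)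
    then show ?thesis using antipode_eq_0D by blast
  qed
  then have "inj (\<lambda>x. w * x)"
    by (intro injI) (metis eq_iff_diff_eq_0 right_diff_distrib)
  then have "surj (\<lambda>x. w * x)" by (rule linear_inj_imp_surj[OF lin])
  then obtain w' where w': "w * w' = 1" by (metis surjD)
  have "w * (w' * w - 1) = 0"
    by (simp add: right_diff_distrib mult.assoc[symmetric] w')
  then have "w' * w = 1" using 0[of "w' * w - 1"] by simp
  then show ?thesis using w' that by blast
qed

text \<open>
  Conjugation by \<open>w\<^sup>2\<close> and conjugation by \<open>g\<close> are both \<open>S\<^sup>4\<close>.
\<close>

lemma w_squared: obtains z where "central z" "w * w = g * z"
proof
  show "central (S g * w * w)"
    unfolding central_def
  proof
    fix x
    have "w * w * x = S (S (S (S x))) * w * w"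
      by (metis w_intertwines mult.assoc)
    then have "S g * w * w * x = S g * (S (S (S (S x))) * w * w)"
      by (simp only: mult.assoc)
    also have "S (S (S (S x))) = g * x * S g"
      by (simp add: antipode_power4 mult.assoc antipode_grouplike)
    finally show "S g * w * w * x = x * (S g * w * w)"
      by (simp add: mult.assoc[symmetric] antipode_grouplike)
  qed
  show "w * w = g * (S g * w * w)" by (simp add: mult.assoc[symmetric] antipode_grouplike)
qed

text \<open>
  Let \<open>e\<close> run through a finest central partition and let \<open>v\<^sub>e\<close> be \<open>w e\<close>, rescaled so that \<open>v\<^sub>e\<^sup>2 = g e\<close>; it
  has finite order. Since \<open>S\<^sup>2\<close> is conjugation by \<open>w\<close>, the value \<open>\<mu> (g\<^sup>i\<^sup>+\<^sup>1)\<close> equals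
  \<open>\<Sum>\<^sub>e \<chi> (v\<^sub>e) \<chi> (v\<^sub>e\<^sup>2\<^sup>i\<^sup>+\<^sup>1) / \<chi> (e)\<close>. If these values all vanish, then so does \<open>\<Sum>\<^sub>e s\<^sub>e(\<alpha>) \<chi> (v\<^sub>e) / \<chi> (e)\<close> for every root of unity \<open>\<alpha>\<close>,
  where the integer \<open>s\<^sub>e(\<alpha>)\<close> is the difference of the multiplicities of the eigenvalues \<open>\<alpha>\<close> and \<open>- \<alpha>\<close>
  of \<open>v\<^sub>e\<close>. On the other hand \<open>2 \<chi> (v\<^sub>e) = \<Sum>\<^sub>\<alpha> s\<^sub>e(\<alpha>) \<alpha>\<close>. Apply a rational functional \<open>\<theta>\<close> to the vanishing sums, multiply by \<open>\<theta>(\<alpha>)\<close> and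
  add them up: the result is \<open>\<Sum>\<^sub>e 2 \<theta>(\<chi> (v\<^sub>e))\<^sup>2 / \<chi> (e) = 0\<close>. But \<open>\<chi> (v\<^sub>e) \<noteq> 0\<close> when \<open>e\<close> is the integral,
  and \<open>\<theta>\<close> can be chosen to be nonzero there.
\<close>

lemma mu_nonzero_on_grouplike_power: "\<exists>i. \<mu> (g ^ Suc i) \<noteq> 0"
proof (rule ccontr)
  assume "\<not> ?thesis"
  then have vanish: "\<mu> (g ^ Suc i) = 0" for i by blast
  obtain m where m: "m > 0" "g ^ m = 1" using grouplike_finite_order by blast
  obtain E where E: "central_partition E" and max: "\<And>F. central_partition F \<Longrightarrow> card F \<le> card E"
    by (rule maximal_central_partition) blast
  have finE: "finite E" and sumE: "(\<Sum>e\<in>E. e) = 1" using E by (auto simp: central_partition_def)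
  have eE: "central e" "e * e = e" "e \<noteq> 0" if "e \<in> E" for e
    using E that by (auto simp: central_partition_def)
  obtain w' where w': "w * w' = 1" "w' * w = 1" by (rule w_inverse)
  obtain z where z: "central z" "w * w = g * z" by (rule w_squared)
  have "\<exists>\<delta>. \<delta> \<noteq> 0 \<and> w * w * e = scale (\<delta> * \<delta>) (g * e)" if e: "e \<in> E" for e
  proof -
    obtain \<gamma> where \<gamma>: "z * e = scale \<gamma> e" by (rule maximal_partition_scalar[OF E max e z(1)])
    have we: "w * w * e = scale \<gamma> (g * e)"
      by (simp add: z(2) mult.assoc \<gamma> scale_mult_right[symmetric])
    have "\<gamma> \<noteq> 0"
    proof
      assume "\<gamma> = 0"
      then have "w' * w' * (w * w * e) = 0" using we by simp
      moreover have "w' * w' * (w * w * e) = e"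
        by (metis mult.assoc mult_1_left w'(2))
      ultimately show False using eE(3)[OF e] by simp
    qed
    obtain \<delta> where "\<delta> ^ 2 = \<gamma>" using nth_root_exists[of 2 \<gamma>] by auto
    then show ?thesis using \<open>\<gamma> \<noteq> 0\<close> we by (intro exI[of _ \<delta>]) (auto simp: power2_eq_square)
  qed
  then obtain \<delta> where \<delta>: "\<And>e. e \<in> E \<Longrightarrow> \<delta> e \<noteq> 0"
    and ww: "\<And>e. e \<in> E \<Longrightarrow> w * w * e = scale (\<delta> e * \<delta> e) (g * e)" by metis
  define v where "v e = scale (inverse (\<delta> e)) (w * e)" for e
  have we: "w * e = scale (\<delta> e) (v e)" if "e \<in> E" for e
    using \<delta>[OF that] by (simp add: v_def)
  have ev: "e * v e = v e" "v e * e = v e" if "e \<in> E" for e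
    using eE[OF that] by (simp_all add: v_def scale_mult_left[symmetric] scale_mult_right[symmetric] mult.assoc
        centralD[OF eE(1)[OF that], of "w * e"])
  have vv: "v e * v e = g * e" if e: "e \<in> E" for e
  proof -
    have "w * e * (w * e) = w * w * e"
      by (metis centralD eE(1,2)[OF e] mult.assoc)
    then show ?thesis
      using ww[OF e] \<delta>[OF e]
      by (simp add: v_def scale_mult_left[symmetric] scale_mult_right[symmetric] field_simps)
  qed
  have v_even: "v e ^ (2 * i) * e = g ^ i * e" if e: "e \<in> E" for e i
  proof (induction i)
    case (Suc i)
    have "v e ^ (2 * Suc i) * e = v e * v e * (v e ^ (2 * i) * e)"
      by (simp add: mult.assoc)
    also have "\<dots> = g * (e * (g ^ i * e))" using Suc vv[OF e] by (simp add: mult.assoc)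
    also have "\<dots> = g ^ Suc i * e"
      by (metis centralD eE(1,2)[OF e] mult.assoc power_Suc)
    finally show ?case .
  qed simp
  define M where "M = 2 * m"
  have M: "M > 0" "M \<ge> 2" "even M" using m by (auto simp: M_def)
  have vM: "v e ^ M * e = e" if "e \<in> E" for e
    using v_even[OF that, of m] m(2) by (simp add: M_def)
  have "\<exists>r. \<chi> e = of_nat r \<and> r \<noteq> 0" if "e \<in> E" for e
    using chi_idempotent[OF eE(2)[OF that]] eE(3)[OF that] by metis
  then obtain n where n: "\<And>e. e \<in> E \<Longrightarrow> \<chi> e = of_nat (n e)" "\<And>e. e \<in> E \<Longrightarrow> n e \<noteq> 0" by metis
  have mu_w: "\<mu> x = bimult_trace w (w' * x)" for x
  proof -
    have "S (S h) = w * h * w'" for h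
      by (simp only: w_intertwines[of h] mult.assoc w'(1) mult_1_right)
    then show ?thesis by (simp add: \<mu>_def bimult_trace_def mult.assoc)
  qed
  \<comment> \<open>The exponent of \<open>g\<close> is at least \<open>1\<close>, so that \<open>w\<inverse> g\<^sup>i\<^sup>+\<^sup>1 e\<close> is, up to a scalar, a positive power of \<open>v e\<close>.\<close>
  have rel_odd: "(\<Sum>e\<in>E. \<chi> (v e) * \<chi> (v e ^ Suc (2 * i) * e) / of_nat (n e)) = 0" for i
  proof -
    have "\<chi> (w * e) * \<chi> (w' * g ^ Suc i * e) = \<chi> (v e) * \<chi> (v e ^ Suc (2 * i) * e)" if e: "e \<in> E" for e
    proof -
      have "w' * g ^ Suc i * e = w' * (v e ^ (2 * Suc i) * e)" by (simp only: v_even[OF e] mult.assoc)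
      also have "\<dots> = w' * (v e * (v e ^ Suc (2 * i) * e))" by (simp add: mult.assoc)
      also have "\<dots> = scale (inverse (\<delta> e)) (e * (v e ^ Suc (2 * i) * e))"
        by (simp add: v_def[of e] scale_mult_left[symmetric] scale_mult_right[symmetric] mult.assoc[symmetric] w'(2)
            del: power_Suc)
      also have "e * (v e ^ Suc (2 * i) * e) = v e ^ Suc (2 * i) * e"
        by (metis centralD eE(1,2)[OF e] mult.assoc)
      finally show ?thesis
        using \<delta>[OF e] by (simp add: we[OF e] linear_scaleD[OF linear_chi])
    qed
    moreover have "0 = (\<Sum>e\<in>E. \<chi> (w * e) * \<chi> (w' * g ^ Suc i * e) / \<chi> e)"
      using vanish[of i] mu_w[of "g ^ Suc i"] bimult_trace_decomposition[OF E max, of w "w' * g ^ Suc i"] by simp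
    ultimately show ?thesis using n(1) by (simp cong: sum.cong)
  qed
  have rel: "(\<Sum>e\<in>E. \<chi> (v e) * \<chi> (v e ^ j * e) / of_nat (n e)) = 0" if "odd j" for j
    using that rel_odd by (auto elim!: oddE)
  define f where "f e \<alpha> = eigenprojection e (v e) M \<alpha>" for e \<alpha>
  let ?R = "{\<alpha>::'k. \<alpha> ^ M = 1}"
  have negR: "- \<alpha> \<in> ?R" if "\<alpha> \<in> ?R" for \<alpha>
    using that M(3) by (simp add: power_minus_even)
  have "\<exists>r. \<chi> (f e \<alpha>) = of_nat r" if "e \<in> E" "\<alpha> \<in> ?R" for e \<alpha>
    using chi_idempotent[OF eigenprojection_idempotent[OF M(1) eE(2) ev vM, of e \<alpha>]] that
    unfolding f_def by blast
  then have "\<exists>r. \<forall>e\<in>E. \<forall>\<alpha>\<in>?R. \<chi> (f e \<alpha>) = of_nat (r e \<alpha>)" by metis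
  then obtain r where r: "\<And>e \<alpha>. e \<in> E \<Longrightarrow> \<alpha> \<in> ?R \<Longrightarrow> \<chi> (f e \<alpha>) = of_nat (r e \<alpha>)" by blast
  define s :: "'h \<Rightarrow> 'k \<Rightarrow> rat" where "s e \<alpha> = of_nat (r e \<alpha>) - of_nat (r e (- \<alpha>))" for e \<alpha>
  have s: "of_rat (s e \<alpha>) = \<chi> (f e \<alpha>) - \<chi> (f e (- \<alpha>))" if "e \<in> E" "\<alpha> \<in> ?R" for e \<alpha>
    using that negR[OF that(2)] by (simp add: s_def r of_rat_diff)
  have s_rel: "(\<Sum>e\<in>E. of_rat (s e \<alpha> / of_nat (n e)) * \<chi> (v e)) = 0" if \<alpha>: "\<alpha> \<in> ?R" for \<alpha>
  proof -
    let ?c = "\<lambda>j. (1 - (- 1) ^ j) * inverse \<alpha> ^ j / of_nat M :: 'k"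
    have "(\<Sum>e\<in>E. of_rat (s e \<alpha> / of_nat (n e)) * \<chi> (v e))
        = (\<Sum>e\<in>E. \<Sum>j<M. ?c j * (\<chi> (v e) * \<chi> (v e ^ j * e) / of_nat (n e)))"
    proof (rule sum.cong[OF HOL.refl])
      fix e assume e: "e \<in> E"
      have "of_rat (s e \<alpha>) = (\<Sum>j<M. ?c j * \<chi> (v e ^ j * e))"
        unfolding s[OF e \<alpha>] f_def
        by (rule chi_eigenprojection_difference[OF M(1) eE(2)[OF e] ev[OF e] vM[OF e]])
      then show "of_rat (s e \<alpha> / of_nat (n e)) * \<chi> (v e)
          = (\<Sum>j<M. ?c j * (\<chi> (v e) * \<chi> (v e ^ j * e) / of_nat (n e)))"
        by (simp add: of_rat_divide sum_distrib_right sum_distrib_left sum_divide_distrib mult_ac)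
    qed
    also have "\<dots> = (\<Sum>j<M. ?c j * (\<Sum>e\<in>E. \<chi> (v e) * \<chi> (v e ^ j * e) / of_nat (n e)))"
      by (subst sum.swap) (simp add: sum_distrib_left)
    also have "\<dots> = 0"
    proof (rule sum.neutral, rule ballI)
      fix j
      show "?c j * (\<Sum>e\<in>E. \<chi> (v e) * \<chi> (v e ^ j * e) / of_nat (n e)) = 0"
        by (cases "odd j") (simp_all add: rel)
    qed
    finally show ?thesis .
  qed
  \<comment> \<open>The substitution \<open>\<alpha> \<mapsto> - \<alpha>\<close> of the roots needs \<open>M\<close> even, which is why \<open>M\<close> is twice the order of \<open>g\<close>.\<close>
  have two_v: "(\<Sum>\<alpha>\<in>?R. of_rat (s e \<alpha>) * \<alpha>) = of_rat 2 * \<chi> (v e)" if e: "e \<in> E" for e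
  proof -
    interpret l: Vector_Spaces.linear scale "(*)" \<chi> by (rule linear_chi)
    have "\<chi> (v e) = \<chi> (\<Sum>\<alpha>\<in>?R. scale \<alpha> (f e \<alpha>))"
      unfolding f_def sum_eigenprojections[OF M(1) eE(2)[OF e] ev[OF e] vM[OF e] M(2)] ..
    then have 1: "\<chi> (v e) = (\<Sum>\<alpha>\<in>?R. \<alpha> * \<chi> (f e \<alpha>))" by (simp add: l.sum l.scale)
    also have "\<dots> = (\<Sum>\<alpha>\<in>?R. - \<alpha> * \<chi> (f e (- \<alpha>)))"
      by (rule sum.reindex_bij_witness[of _ uminus uminus]) (use negR in auto)
    finally have 2: "\<chi> (v e) = - (\<Sum>\<alpha>\<in>?R. \<alpha> * \<chi> (f e (- \<alpha>)))" by (simp add: sum_negf)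
    have "(\<Sum>\<alpha>\<in>?R. of_rat (s e \<alpha>) * \<alpha>) = (\<Sum>\<alpha>\<in>?R. \<alpha> * \<chi> (f e \<alpha>)) - (\<Sum>\<alpha>\<in>?R. \<alpha> * \<chi> (f e (- \<alpha>)))"
      unfolding sum_subtractf[symmetric] using e by (intro sum.cong) (simp_all add: s algebra_simps)
    also have "\<dots> = \<chi> (v e) + \<chi> (v e)" using 1 2 by simp
    finally show ?thesis by simp
  qed
  \<comment> \<open>The integral \<open>\<Lambda>\<close> is central of counit \<open>1\<close>, hence a member of the partition, and \<open>w \<Lambda> = \<epsilon>(w) \<Lambda>\<close>.\<close>
  have "\<exists>e\<in>E. \<chi> (v e) \<noteq> 0"
  proof -
    have "\<Lambda> * (\<Sum>e\<in>E. e) = \<Lambda>" by (simp add: sumE)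
    then have "\<Lambda> = (\<Sum>e\<in>E. \<Lambda> * e)" by (simp only: sum_distrib_left)
    moreover have "\<Lambda> \<noteq> 0" using counit_integral linear_zeroD[OF counit_linear] by auto
    ultimately obtain e where e: "e \<in> E" "\<Lambda> * e \<noteq> 0" by (metis sum.neutral)
    have cL: "central \<Lambda>" by (simp add: central_def integral_left integral_right)
    obtain \<alpha> where \<alpha>: "\<Lambda> * e = scale \<alpha> e" by (rule maximal_partition_scalar[OF E max e(1) cL])
    have "\<epsilon> e * \<epsilon> e = \<epsilon> e" using eE(2)[OF e(1)] by (metis counit_mult)
    moreover have "\<epsilon> e \<noteq> 0" using e(2) by (auto simp: integral_right)
    ultimately have e1: "\<epsilon> e = 1" by simp
    then have "\<Lambda> = scale \<alpha> e" using \<alpha> by (simp add: integral_right)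
    moreover from this have "\<alpha> = 1"
      using counit_integral linear_scaleD[OF counit_linear, of \<alpha> e] e1 by simp
    ultimately have "e = \<Lambda>" by simp
    have "\<epsilon> w * \<epsilon> w' = 1" using w'(1) by (metis counit_mult counit_one)
    then have "\<epsilon> w \<noteq> 0" by auto
    then have "\<chi> (v e) \<noteq> 0"
      using \<delta>[OF e(1)] unfolding v_def \<open>e = \<Lambda>\<close>
      by (simp add: integral_left linear_scaleD[OF linear_chi] chi_integral)
    then show ?thesis using e(1) by blast
  qed
  then obtain e0 where e0: "e0 \<in> E" "\<chi> (v e0) \<noteq> 0" by blast
  obtain \<theta> :: "'k \<Rightarrow> rat" where \<theta>0: "\<theta> (\<chi> (v e0)) \<noteq> 0"
    and \<theta>_add: "\<And>y z. \<theta> (y + z) = \<theta> y + \<theta> z" and \<theta>_scale: "\<And>r y. \<theta> (of_rat r * y) = r * \<theta> y"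
    by (rule rational_functional[OF e0(2)]) blast
  have \<theta>_zero: "\<theta> 0 = 0" using \<theta>_add[of 0 0] by simp
  have \<theta>_sum: "\<theta> (\<Sum>i\<in>I. h i) = (\<Sum>i\<in>I. \<theta> (h i))" for I and h :: "'i \<Rightarrow> 'k"
    by (induction I rule: infinite_finite_induct) (simp_all add: \<theta>_zero \<theta>_add)
  have "0 = (\<Sum>\<alpha>\<in>?R. \<theta> \<alpha> * \<theta> (\<Sum>e\<in>E. of_rat (s e \<alpha> / of_nat (n e)) * \<chi> (v e)))"
    by (simp add: s_rel \<theta>_zero)
  also have "\<dots> = (\<Sum>\<alpha>\<in>?R. \<Sum>e\<in>E. \<theta> (\<chi> (v e)) / of_nat (n e) * (s e \<alpha> * \<theta> \<alpha>))"
    unfolding \<theta>_sum \<theta>_scale sum_distrib_left by (simp add: mult_ac)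
  also have "\<dots> = (\<Sum>e\<in>E. \<theta> (\<chi> (v e)) / of_nat (n e) * (\<Sum>\<alpha>\<in>?R. s e \<alpha> * \<theta> \<alpha>))"
    by (subst sum.swap) (simp add: sum_distrib_left)
  also have "\<dots> = (\<Sum>e\<in>E. 2 * (\<theta> (\<chi> (v e)))\<^sup>2 / of_nat (n e))"
  proof (rule sum.cong[OF HOL.refl])
    fix e assume "e \<in> E"
    then have "(\<Sum>\<alpha>\<in>?R. s e \<alpha> * \<theta> \<alpha>) = 2 * \<theta> (\<chi> (v e))"
      using arg_cong[OF two_v, of e \<theta>] by (simp only: \<theta>_sum \<theta>_scale)
    then show "\<theta> (\<chi> (v e)) / of_nat (n e) * (\<Sum>\<alpha>\<in>?R. s e \<alpha> * \<theta> \<alpha>) = 2 * (\<theta> (\<chi> (v e)))\<^sup>2 / of_nat (n e)"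
      by (simp add: power2_eq_square)
  qed
  finally have "(\<Sum>e\<in>E. 2 * (\<theta> (\<chi> (v e)))\<^sup>2 / of_nat (n e)) = 0" by simp
  then have "\<forall>e\<in>E. 2 * (\<theta> (\<chi> (v e)))\<^sup>2 / of_nat (n e) = 0"
    by (subst (asm) sum_nonneg_eq_0_iff) (use finE in auto)
  then show False using e0(1) \<theta>0 n(2)[OF e0(1)] by auto
qed

text \<open>
  A power \<open>x\<close> of \<open>g\<close> is grouplike, so the right integral property gives \<open>\<mu>(x) x = \<mu>(x) 1\<close> and the left one
  \<open>\<mu>(x) x = \<mu>(x) g\<close>.
\<close>

lemma mu_one_nonzero: "\<mu> 1 \<noteq> 0" and g_eq_one: "g = 1"
proof -
  obtain i where i: "\<mu> (g ^ Suc i) \<noteq> 0" using mu_nonzero_on_grouplike_power by blast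
  let ?x = "g ^ Suc i"
  have "scale (\<mu> ?x) ?x = scale (\<mu> ?x) 1"
    using mu_right_integral[of ?x] sw_grouplike_power[of scale "\<lambda>a b. scale (\<mu> a) b" "Suc i"]
    by (simp add: lin_rules linear_mu del: power_Suc)
  then have 1: "?x = 1" using i by (simp del: power_Suc)
  have "scale (\<mu> ?x) ?x = scale (\<mu> ?x) g"
    using mu_left_quasi_integral[of ?x] sw_grouplike_power[of scale "\<lambda>a b. scale (\<mu> b) a" "Suc i"]
    by (simp add: lin_rules linear_mu del: power_Suc)
  then show "g = 1" using i 1 by (simp del: power_Suc)
  show "\<mu> 1 \<noteq> 0" using i 1 by (simp del: power_Suc)
qed

lemma antipode_order4: "S (S (S (S x))) = x"
  using antipode_power4[of x] by (simp add: g_eq_one)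

end

context semisimple_hopf_algebra
begin

section \<open>The antipode is an involution\<close>

lemma chi_antipode_square: "\<chi> (S (S x)) = \<chi> x"
proof -
  have "\<chi> (S (S x)) = lin_trace scale (\<lambda>h. S (S (x * S (S h))))"
    by (simp add: \<chi>_def antipode_mult antipode_order4)
  also have "\<dots> = lin_trace scale (\<lambda>h. x * S (S (S (S h))))"
    by (rule lin_trace_commute[of "\<lambda>h. S (S h)" "\<lambda>h. x * S (S h)"]) (intro lin_rules)+
  finally show ?thesis by (simp add: \<chi>_def antipode_order4)
qed

text \<open>
  For a right integral \<open>\<mu>\<close>, \<open>\<Sum> \<mu>(y\<^sub>1 k) y\<^sub>2 = \<Sum> \<mu>(y\<^sub>1 k\<^sub>1) y\<^sub>2 k\<^sub>2 S(k\<^sub>3) = \<Sum> \<mu>(y k\<^sub>1) S(k\<^sub>2)\<close>.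
\<close>

lemma mu_slide:
  assumes p: "Vector_Spaces.linear scale (*) p"
  shows "sw y (\<lambda>a b. \<mu> (a * k) * p b) = sw k (\<lambda>c d. \<mu> (y * c) * p (S d))"
proof -
  note lp = linear_comp[OF _ p]
  have "sw k (\<lambda>c d. \<mu> (y * c) * p (S d))
      = sw k (\<lambda>c d. sw y (\<lambda>a b. sw c (\<lambda>r s. \<mu> (a * r) * p (b * (s * S d)))))"
  proof (rule sw_cong)
    fix c d
    have bil: "bilinear_on (*) (\<lambda>u v. \<mu> u * p (v * S d))" by (intro lin_rules linear_mu lp)
    have "\<mu> (y * c) * p (S d) = p (sw (y * c) (\<lambda>u v. scale (\<mu> u) v) * S d)"
      by (simp add: mu_right_integral scale_mult_left[symmetric] linear_scaleD[OF p])
    also have "\<dots> = sw (y * c) (\<lambda>u v. \<mu> u * p (v * S d))"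
      using sw_linear[where f = "\<lambda>x. p (x * S d)" and sX = scale and sY = "(*)" and x = "y * c"
          and \<beta> = "\<lambda>u v. scale (\<mu> u) v"]
      by (simp add: lin_rules lp scale_mult_left[symmetric] linear_scaleD[OF p])
    also have "\<dots> = sw y (\<lambda>a b. sw c (\<lambda>r s. \<mu> (a * r) * p (b * (s * S d))))"
      by (simp add: sw_mult[OF bil] mult.assoc)
    finally show "\<mu> (y * c) * p (S d) = sw y (\<lambda>a b. sw c (\<lambda>r s. \<mu> (a * r) * p (b * (s * S d))))" .
  qed
  also have "\<dots> = sw y (\<lambda>a b. sw k (\<lambda>c d. sw c (\<lambda>r s. \<mu> (a * r) * p (b * (s * S d)))))"
    by (rule sw_swap)
  also have "\<dots> = sw y (\<lambda>a b. sw k (\<lambda>r z. sw z (\<lambda>s d. \<mu> (a * r) * p (b * (s * S d)))))"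
    by (intro sw_cong sw_coassoc[of "(*)"] lin_rules lp)
  also have "\<dots> = sw y (\<lambda>a b. sw k (\<lambda>r z. \<epsilon> z * (\<mu> (a * r) * p (b * 1))))"
    by (intro sw_cong sw_antipode_right lin_rules lp)
  also have "\<dots> = sw y (\<lambda>a b. \<mu> (a * k) * p (b * 1))"
    by (intro sw_cong sw_counit_right lin_rules)
  finally show ?thesis by simp
qed

text \<open>
  The tensor product of the regular representation with itself is a sum of \<open>dim H\<close> copies of it. In the
  proof \<open>\<chi>\<close> is written as \<open>\<mu> (- w)\<close> with \<open>w = \<Sum> S(\<Lambda>\<^sub>2) \<Lambda>\<^sub>1\<close>, and the middle legs of the iterated coproduct of
  \<open>\<Lambda>\<close> cancel under \<open>\<chi>\<close>.
\<close>

lemma chi_convolution: "sw y (\<lambda>a b. \<chi> a * \<chi> b) = \<chi> 1 * \<chi> y"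
proof -
  let ?\<tau> = "\<lambda>r m u. \<mu> (y * (S u * r)) * \<chi> (S m)"
  let ?\<beta> = "\<lambda>c d. \<mu> (y * c) * \<chi> (S d)"
  have bil: "bilinear_on (*) ?\<beta>" by (intro lin_rules linear_chiI)
  have "sw y (\<lambda>a b. \<chi> a * \<chi> b) = sw w ?\<beta>"
    using mu_slide[OF linear_chi, of y w] by (simp add: chi_eq_mu[symmetric])
  also have "\<dots> = sw \<Lambda> (\<lambda>a b. sw (S b * a) ?\<beta>)"
    unfolding w_def by (intro sw_linear[of scale "(*)"] linear_swI bil lin_rules)
  also have "\<dots> = sw \<Lambda> (\<lambda>a b. sw a (\<lambda>r s. sw b (\<lambda>t u. ?\<tau> r (s * S t) u)))"
  proof (rule sw_cong)
    fix a b
    have bil': "bilinear_on (*) (\<lambda>p q. sw a (\<lambda>r s. ?\<beta> (p * r) (q * s)))"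
      by (intro lin_rules linear_chiI)
    have "sw (S b * a) ?\<beta> = sw b (\<lambda>t u. sw a (\<lambda>r s. ?\<beta> (S u * r) (S t * s)))"
      by (simp add: sw_mult[OF bil] sw_antipode[OF bil'])
    also have "\<dots> = sw b (\<lambda>t u. sw a (\<lambda>r s. ?\<tau> r (s * S t) u))"
      by (simp add: antipode_mult chi_commute)
    also have "\<dots> = sw a (\<lambda>r s. sw b (\<lambda>t u. ?\<tau> r (s * S t) u))" by (rule sw_swap)
    finally show "sw (S b * a) ?\<beta> = sw a (\<lambda>r s. sw b (\<lambda>t u. ?\<tau> r (s * S t) u))" .
  qed
  also have "\<dots> = sw \<Lambda> (\<lambda>r u. ?\<tau> r 1 u)"
    by (intro sw_middle_antipode[of "(*)" "?\<tau>"] lin_rules linear_chiI)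
  also have "\<dots> = \<chi> 1 * \<mu> (y * w)"
    unfolding w_def
    using sw_linear[where f = "\<lambda>x. \<chi> 1 * \<mu> (y * x)" and sX = scale and sY = "(*)" and x = \<Lambda>
        and \<beta> = "\<lambda>a b. S b * a"]
    by (simp add: lin_rules antipode_one mult.commute)
  finally show ?thesis by (simp add: chi_eq_mu)
qed

definition convolve_chi :: "'h \<Rightarrow> 'h" where
  "convolve_chi h = sw h (\<lambda>a b. scale (\<chi> a) b)"

lemma linear_convolve_chi: "Vector_Spaces.linear scale scale convolve_chi"
  unfolding convolve_chi_def[abs_def] by (intro lin_rules linear_chi)

lemma linear_convolve_chiI:
  "Vector_Spaces.linear scale scale f \<Longrightarrow> Vector_Spaces.linear scale scale (\<lambda>x. convolve_chi (f x))"
  by (rule linear_comp[OF _ linear_convolve_chi])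

lemma convolve_chi_twice: "convolve_chi (convolve_chi h) = scale (\<chi> 1) (convolve_chi h)"
proof -
  have lin: "Vector_Spaces.linear (*) scale (\<lambda>c. scale c y)" for y
    by (simp add: Vector_Spaces.linear_iff vector_space_axioms vector_space_field scale_left_distrib)
  have bil: "bilinear_on scale (\<lambda>c d. scale (\<chi> c) d)" by (intro lin_rules linear_chi)
  have "convolve_chi (convolve_chi h) = sw h (\<lambda>a b. sw (scale (\<chi> a) b) (\<lambda>c d. scale (\<chi> c) d))"
    unfolding convolve_chi_def by (intro sw_linear[of scale scale] linear_swI bil lin_rules)
  also have "\<dots> = sw h (\<lambda>a b. sw b (\<lambda>c d. scale (\<chi> a * \<chi> c) d))"
    by (simp add: sw_scale[OF bil] sw_linear[OF linear_scaleI[OF linear_identI]])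
  also have "\<dots> = sw h (\<lambda>y d. sw y (\<lambda>a c. scale (\<chi> a * \<chi> c) d))"
    by (intro sw_coassoc[symmetric, of scale] lin_rules linear_chi)
  also have "\<dots> = sw h (\<lambda>y d. scale (\<chi> 1 * \<chi> y) d)"
    by (simp add: sw_linear[OF lin, symmetric] chi_convolution)
  also have "\<dots> = scale (\<chi> 1) (convolve_chi h)"
    by (simp add: convolve_chi_def sw_linear[OF linear_scaleI[OF linear_identI]])
  finally show ?thesis .
qed

lemma convolve_chi_antipode:
  "convolve_chi (S h) = sw h (\<lambda>a b. scale (\<chi> (S b)) (S a))"
  unfolding convolve_chi_def by (intro sw_antipode[of scale] lin_rules linear_chi)

lemma convolve_chi_antipode_square: "convolve_chi (S (S h)) = S (S (convolve_chi h))"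
proof -
  have "convolve_chi (S (S h)) = sw h (\<lambda>a b. scale (\<chi> (S (S a))) (S (S b)))"
    unfolding convolve_chi_antipode
    by (intro sw_antipode[of scale] lin_rules linear_chiI)
  also have "\<dots> = S (S (convolve_chi h))"
    using sw_linear[where f = "\<lambda>x. S (S x)" and sX = scale and sY = scale and x = h
        and \<beta> = "\<lambda>a b. scale (\<chi> a) b"]
    by (simp add: lin_rules chi_antipode_square convolve_chi_def linear_scaleD[OF antipode_linear])
  finally show ?thesis .
qed

text \<open>
  Evaluating the trace by the dual bases of \<open>\<mu>\<close> gives \<open>\<Sum> \<chi>(S(\<Lambda>\<^sub>3)) \<mu>(S\<^sup>3(\<Lambda>\<^sub>2) \<Lambda>\<^sub>1)\<close>. As \<open>S\<^sup>4\<close> is the identity,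
  \<open>S\<^sup>3(\<Lambda>\<^sub>2) \<Lambda>\<^sub>1 = S\<^sup>3(S(\<Lambda>\<^sub>1) \<Lambda>\<^sub>2)\<close> collapses.
\<close>

lemma lin_trace_convolve_chi: "lin_trace scale (\<lambda>h. S (S (convolve_chi h))) = \<mu> 1"
proof -
  let ?S3 = "\<lambda>x. S (S (S x))"
  have "lin_trace scale (\<lambda>h. S (S (convolve_chi h))) = sw \<Lambda> (\<lambda>a b. \<mu> (S (S (convolve_chi (S b))) * a))"
    by (rule lin_trace_via_mu) (intro lin_rules linear_convolve_chiI)
  also have "\<dots> = sw \<Lambda> (\<lambda>a b. sw b (\<lambda>p q. \<chi> (S q) * \<mu> (?S3 p * a)))"
  proof (rule sw_cong)
    fix a b
    show "\<mu> (S (S (convolve_chi (S b))) * a) = sw b (\<lambda>p q. \<chi> (S q) * \<mu> (?S3 p * a))"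
      unfolding convolve_chi_antipode
      using sw_linear[where f = "\<lambda>x. \<mu> (S (S x) * a)" and sX = scale and sY = "(*)" and x = b
          and \<beta> = "\<lambda>p q. scale (\<chi> (S q)) (S p)"]
      by (simp add: lin_rules linear_scaleD[OF antipode_linear] scale_mult_left[symmetric] mu_scale)
  qed
  also have "\<dots> = sw \<Lambda> (\<lambda>z q. sw z (\<lambda>a p. \<chi> (S q) * \<mu> (?S3 p * a)))"
    by (intro sw_coassoc[symmetric, of "(*)"] lin_rules linear_chiI)
  also have "\<dots> = sw \<Lambda> (\<lambda>z q. sw z (\<lambda>a p. \<chi> (S q) * \<mu> (?S3 (S a * p))))"
    by (simp add: antipode_mult antipode_order4)
  also have "\<dots> = sw \<Lambda> (\<lambda>z q. \<epsilon> z * (\<chi> (S q) * \<mu> (?S3 1)))"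
    by (intro sw_cong sw_antipode_left lin_rules)
  also have "\<dots> = \<chi> (S \<Lambda>) * \<mu> (?S3 1)"
    by (rule sw_counit_left) (intro lin_rules linear_chiI)
  finally show ?thesis by (simp add: antipode_integral chi_integral antipode_one)
qed

text \<open>
  Let \<open>A\<close> and \<open>B\<close> be the projections onto the eigenspaces of \<open>S\<^sup>2\<close> for \<open>1\<close> and \<open>- 1\<close>, of ranks \<open>a\<close> and \<open>b\<close>, and let \<open>a'\<close>
  and \<open>b'\<close> be the ranks of their products with the projection \<open>Q\<close>, the convolution by \<open>\<chi>\<close> divided by \<open>n = a + b\<close>. The two
  values of \<open>Tr (S\<^sup>2)\<close> give \<open>a - b = (a + b) (a' - b')\<close>. The left side is nonzero and \<open>a > 0\<close>, hence \<open>b = 0\<close>.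
\<close>

lemma antipode_involutive: "S (S x) = x"
proof -
  let ?\<sigma> = "\<lambda>h. S (S h)"
  define n where "n = \<chi> 1"
  obtain d where d: "n = of_nat d" "d = 0 \<longleftrightarrow> (1::'h) = 0"
    unfolding n_def by (rule chi_idempotent[of 1]) auto
  have n0: "n \<noteq> 0" using d by simp
  define Q where "Q h = scale (1 / n) (convolve_chi h)" for h
  have Ql: "Vector_Spaces.linear scale scale f \<Longrightarrow> Vector_Spaces.linear scale scale (\<lambda>x. Q (f x))" for f
    unfolding Q_def by (intro lin_rules linear_convolve_chiI)
  interpret Q: Vector_Spaces.linear scale scale Q using Ql[OF linear_identI] .
  interpret s: Vector_Spaces.linear scale scale ?\<sigma> by (intro lin_rules)
  have QQ: "Q (Q h) = Q h" for h
    using n0 by (simp add: Q_def linear_scaleD[OF linear_convolve_chi] convolve_chi_twice n_def[symmetric])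
  have Qs: "Q (?\<sigma> h) = ?\<sigma> (Q h)" for h
    by (simp add: Q_def convolve_chi_antipode_square s.scale)
  define A where "A h = scale (1/2) (h + ?\<sigma> h)" for h
  define B where "B h = scale (1/2) (h - ?\<sigma> h)" for h
  have Al: "Vector_Spaces.linear scale scale A"
    by (simp add: Vector_Spaces.linear_iff vector_space_axioms A_def s.add s.scale scale_right_distrib
        scale_left_commute add_ac)
  have Bl: "Vector_Spaces.linear scale scale B"
    by (simp add: Vector_Spaces.linear_iff vector_space_axioms B_def s.add s.scale scale_right_distrib
        scale_right_diff_distrib scale_left_commute)
  interpret A: Vector_Spaces.linear scale scale A by (rule Al)
  interpret B: Vector_Spaces.linear scale scale B by (rule Bl)
  have half: "scale (1/2) y + scale (1/2) y = y" for y
    by (simp add: scale_left_distrib[symmetric])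
  have ss: "?\<sigma> (?\<sigma> h) = h" for h by (rule antipode_order4)
  have sA: "?\<sigma> (A h) = A h" and sB: "?\<sigma> (B h) = - B h" for h
    by (simp_all add: A_def B_def s.scale s.add s.diff ss add.commute scale_right_diff_distrib)
  have AA: "A (A h) = A h" and BB: "B (B h) = B h" for h
    using sA[of h] sB[of h] half by (simp_all add: A_def[of "A h"] B_def[of "B h"] scale_right_distrib)
  have AQ: "A (Q h) = Q (A h)" and BQ: "B (Q h) = Q (B h)" for h
    by (simp_all add: A_def B_def Q.scale Q.add Q.diff Qs)
  obtain a where a: "lin_trace scale A = of_nat a" "a = 0 \<longleftrightarrow> (\<forall>h. A h = 0)"
    by (rule lin_trace_idempotent[OF Al AA])
  obtain b where b: "lin_trace scale B = of_nat b" "b = 0 \<longleftrightarrow> (\<forall>h. B h = 0)"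
    by (rule lin_trace_idempotent[OF Bl BB])
  have lAQ: "Vector_Spaces.linear scale scale (\<lambda>h. A (Q h))" and lBQ: "Vector_Spaces.linear scale scale (\<lambda>h. B (Q h))"
    by (rule linear_comp[OF Ql[OF linear_identI] Al]) (rule linear_comp[OF Ql[OF linear_identI] Bl])
  obtain a' where a': "lin_trace scale (\<lambda>h. A (Q h)) = of_nat a'"
    by (rule lin_trace_idempotent[OF lAQ]) (simp_all add: AQ[symmetric] AA QQ)
  obtain b' where b': "lin_trace scale (\<lambda>h. B (Q h)) = of_nat b'"
    by (rule lin_trace_idempotent[OF lBQ]) (simp_all add: BQ[symmetric] BB QQ)
  have diff_tr: "lin_trace scale (\<lambda>h. f h - f' h) = lin_trace scale f - lin_trace scale f'"
    if "Vector_Spaces.linear scale scale f" "Vector_Spaces.linear scale scale f'" for f f'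
    unfolding lin_trace_eq_sum_coords by (simp add: representation_diff sum_subtractf)
  have AB: "A h - B h = ?\<sigma> h" "A h + B h = h" for h
    using half[of h] half[of "?\<sigma> h"]
    by (simp_all add: A_def B_def scale_right_distrib scale_right_diff_distrib algebra_simps)
  have T: "\<mu> 1 = of_nat a - of_nat b"
    using diff_tr[OF Al Bl] by (simp add: AB a b \<mu>_def)
  have N: "n = of_nat a + of_nat b"
    using lin_trace_add[OF Al Bl] by (simp add: AB a b n_def \<chi>_def)
  have "\<mu> 1 = lin_trace scale (\<lambda>h. scale n (?\<sigma> (Q h)))"
    using n0 by (simp add: lin_trace_convolve_chi[symmetric] Q_def s.scale)
  also have "\<dots> = n * (of_nat a' - of_nat b')"
    using diff_tr[OF lAQ lBQ] by (simp add: lin_trace_scale AB a' b')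
  finally have "(of_nat a - of_nat b :: 'k) = (of_nat a + of_nat b) * (of_nat a' - of_nat b')"
    using T N by simp
  then have "(of_int (int a - int b) :: 'k) = of_int ((int a + int b) * (int a' - int b'))" by simp
  then have eq: "int a - int b = (int a + int b) * (int a' - int b')" by (simp only: of_int_eq_iff)
  have ne: "int a - int b \<noteq> 0" using mu_one_nonzero T by auto
  have "A 1 = 1" unfolding A_def antipode_one scale_right_distrib by (rule half)
  then have a0: "a > 0" using a(2) by (metis neq0_conv zero_neq_one)
  have "int a' - int b' \<ge> 1"
  proof (rule ccontr)
    assume "\<not> ?thesis"
    moreover have "int a' - int b' \<noteq> 0" using eq ne by auto
    ultimately have "int a' - int b' \<le> - 1" by linarith
    then have "(int a + int b) * (int a' - int b') \<le> (int a + int b) * (- 1)"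
      by (intro mult_left_mono) auto
    then show False using eq a0 by simp
  qed
  then have "(int a + int b) * 1 \<le> (int a + int b) * (int a' - int b')"
    by (intro mult_left_mono) auto
  then have "b = 0" using eq by simp
  then have "B x = 0" using b(2) by blast
  then show ?thesis by (simp add: B_def)
qed

lemma chi_eq_integral: "\<chi> = \<mu>"
proof -
  have "S w = sw \<Lambda> (\<lambda>a b. S a * b)"
    unfolding w_def by (simp add: sw_linear[OF antipode_linear] antipode_mult antipode_involutive)
  also have "\<dots> = S 1"
    using sw_antipode_left[OF linear_identI, of \<Lambda>] by (simp add: counit_integral antipode_one)
  finally have "w = 1" by (simp only: antipode_eq_iff)
  then show ?thesis using chi_eq_mu by auto
qed

lemma chi_left_integral: "sw h (\<lambda>a b. scale (\<chi> b) a) = scale (\<chi> h) 1"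
  using mu_left_quasi_integral[of h] by (simp add: chi_eq_integral g_eq_one)

end

section \<open>Left coideal subalgebras\<close>

locale left_coideal_subalgebra_of_semisimple = semisimple_hopf_algebra scale \<Delta> \<epsilon> S
  for scale :: "'k::{alg_closed_field, field_char_0} \<Rightarrow> 'h::ring_1 \<Rightarrow> 'h"
    and \<Delta> :: "'h \<Rightarrow> ('h \<times> 'h) list" and \<epsilon> :: "'h \<Rightarrow> 'k" and S :: "'h \<Rightarrow> 'h" +
  fixes N :: "'h set"
  assumes left_coideal_subalgebra: "left_coideal_subalgebra scale \<Delta> N"
begin

lemma subspace_N: "subspace N" and one_N: "1 \<in> N"
  and mult_N: "x \<in> N \<Longrightarrow> y \<in> N \<Longrightarrow> x * y \<in> N"
  using left_coideal_subalgebra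
  by (auto simp: left_coideal_subalgebra_def unital_subalgebra_def)

lemmas add_N = subspace_add[OF subspace_N] and scale_N = subspace_scale[OF subspace_N]

lemma sw_coideal_cong:
  assumes "n \<in> N" "bilinear_on sX \<beta>" "bilinear_on sX \<gamma>" "\<And>a b. b \<in> N \<Longrightarrow> \<beta> a b = \<gamma> a b"
  shows "sw n \<beta> = sw n \<gamma>"
proof -
  obtain xs where xs: "tensor2_eq scale (\<Delta> n) xs" "\<forall>(a, b)\<in>set xs. b \<in> N"
    using left_coideal_subalgebra assms(1) by (auto simp: left_coideal_subalgebra_def)
  have "(\<Sum>(a, b)\<leftarrow>xs. \<beta> a b) = (\<Sum>(a, b)\<leftarrow>xs. \<gamma> a b)"
    using xs(2) assms(4) by (intro arg_cong[of _ _ sum_list] map_cong) auto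
  then show ?thesis
    using sw_eq_sum_list[OF xs(1) assms(2)] sw_eq_sum_list[OF xs(1) assms(3)] by simp
qed

text \<open>
  The integral property of \<open>\<chi>\<close> in bilinear form: insert \<open>S(n\<^sub>1) n\<^sub>2\<close> in front of \<open>m\<^sub>1\<close> in \<open>\<Sum> m\<^sub>1 \<chi> (n m\<^sub>2)\<close> and
  integrate the product \<open>n m\<close>.
\<close>

lemma chi_transfer: "sw m (\<lambda>a b. scale (\<chi> (n * b)) a) = sw n (\<lambda>a b. scale (\<chi> (b * m)) (S a))"
proof -
  have "sw n (\<lambda>a b. scale (\<chi> (b * m)) (S a))
      = sw n (\<lambda>a b. sw b (\<lambda>p q. sw m (\<lambda>r s. scale (\<chi> (q * s)) (S a * p * r))))"
  proof (rule sw_cong)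
    fix a b
    have bil: "bilinear_on scale (\<lambda>u v. scale (\<chi> v) (S a * u))" by (intro lin_rules linear_chi)
    have "scale (\<chi> (b * m)) (S a) = S a * sw (b * m) (\<lambda>u v. scale (\<chi> v) u)"
      by (simp add: chi_left_integral scale_mult_right[symmetric])
    also have "\<dots> = sw (b * m) (\<lambda>u v. scale (\<chi> v) (S a * u))"
      using sw_linear[OF linear_mult_leftI[OF linear_identI], of "S a" "b * m" "\<lambda>u v. scale (\<chi> v) u"]
      by (simp add: scale_mult_right)
    finally show "scale (\<chi> (b * m)) (S a) = sw b (\<lambda>p q. sw m (\<lambda>r s. scale (\<chi> (q * s)) (S a * p * r)))"
      by (simp add: sw_mult[OF bil] mult.assoc)
  qed
  also have "\<dots> = sw n (\<lambda>z q. sw z (\<lambda>a p. sw m (\<lambda>r s. scale (\<chi> (q * s)) (S a * p * r))))"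
    by (intro sw_coassoc[symmetric, of scale] lin_rules linear_chiI)
  also have "\<dots> = sw n (\<lambda>z q. scale (\<epsilon> z) (sw m (\<lambda>r s. scale (\<chi> (q * s)) (1 * r))))"
    by (intro sw_cong sw_antipode_left lin_rules linear_chiI)
  also have "\<dots> = sw m (\<lambda>r s. scale (\<chi> (n * s)) (1 * r))"
    by (rule sw_counit_left) (intro lin_rules linear_chiI)
  finally show ?thesis by simp
qed

text \<open>
  The elements of the radical are nilpotent, so \<open>\<epsilon>\<close> vanishes on them and is represented on \<open>N\<close> by some \<open>z \<in> N\<close>.
  Transferring to \<open>z\<close> shows \<open>\<Sum> S(x\<^sub>1) \<chi> (x\<^sub>2 z) = 0\<close>, because the second leg of \<open>\<Delta> z\<close> lies in \<open>N\<close>; apply \<open>S\<close> and the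
  counit axiom.
\<close>

lemma chi_nondegenerate_on:
  assumes x: "x \<in> N" and rad: "\<And>y. y \<in> N \<Longrightarrow> \<chi> (x * y) = 0"
  shows "x = 0"
proof -
  have "\<epsilon> y = 0" if y: "y \<in> N" and rad_y: "\<And>z. z \<in> N \<Longrightarrow> \<chi> (y * z) = 0" for y
  proof -
    obtain k where "y ^ k = 0"
      using trace_radical_nilpotent[OF subspace_N one_N mult_N y rad_y] by blast
    then have "\<epsilon> (y ^ k) = 0" by (simp add: linear_zeroD[OF counit_linear])
    moreover have "\<epsilon> (y ^ k) = \<epsilon> y ^ k"
      by (induction k) (simp_all add: counit_one counit_mult)
    ultimately show ?thesis by simp
  qed
  then obtain z where z: "z \<in> N" "\<And>y. y \<in> N \<Longrightarrow> \<epsilon> y = \<chi> (y * z)"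
    using functional_as_chi[OF subspace_N, of \<epsilon>] linear_addD[OF counit_linear] linear_scaleD[OF counit_linear]
    by metis
  have "sw x (\<lambda>a b. scale (\<chi> (b * z)) (S a)) = sw z (\<lambda>a b. scale (\<chi> (x * b)) a)"
    by (rule chi_transfer[symmetric])
  also have "\<dots> = sw z (\<lambda>a b. scale 0 a)"
  proof (rule sw_coideal_cong[OF z(1), where sX = scale])
    show "bilinear_on scale (\<lambda>a b. scale (\<chi> (x * b)) a)" by (intro lin_rules linear_chiI)
    show "bilinear_on scale (\<lambda>a b. scale 0 a)"
      by (simp add: bilinear_on_def Vector_Spaces.linear_iff vector_space_axioms)
  qed (simp add: rad)
  finally have "sw x (\<lambda>a b. scale (\<chi> (b * z)) (S a)) = 0" by (simp add: sw_zero)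
  then have "S (sw x (\<lambda>a b. scale (\<chi> (b * z)) (S a))) = 0" by (simp add: linear_zeroD[OF antipode_linear])
  then have "sw x (\<lambda>a b. scale (\<chi> (b * z)) a) = 0"
    by (simp add: sw_linear[OF antipode_linear] linear_scaleD[OF antipode_linear] antipode_involutive)
  moreover have "sw x (\<lambda>a b. scale (\<epsilon> b) a) = sw x (\<lambda>a b. scale (\<chi> (b * z)) a)"
    by (rule sw_coideal_cong[OF x, where sX = scale]) (intro lin_rules linear_chiI counit_linear | simp add: z)+
  moreover have "sw x (\<lambda>a b. scale (\<epsilon> b) a) = x" by (rule sw_counit_right[OF linear_identI])
  ultimately show ?thesis by simp
qed

lemma chi_cancel_on:
  assumes "x \<in> N" "x' \<in> N" "\<And>y. y \<in> N \<Longrightarrow> \<chi> (y * x) = \<chi> (y * x')"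
  shows "x = x'"
proof -
  interpret l: Vector_Spaces.linear scale "(*)" \<chi> by (rule linear_chi)
  have "x - x' = 0"
  proof (rule chi_nondegenerate_on)
    show "x - x' \<in> N" using assms(1,2) by (rule subspace_diff[OF subspace_N])
    show "\<chi> ((x - x') * y) = 0" if "y \<in> N" for y
      using assms(3)[OF that] by (simp add: left_diff_distrib l.diff chi_commute[of _ y])
  qed
  then show ?thesis by simp
qed

lemma functional_on_as_chi:
  assumes "\<And>x y. x \<in> N \<Longrightarrow> y \<in> N \<Longrightarrow> p (x + y) = p x + p y"
    and "\<And>c x. x \<in> N \<Longrightarrow> p (scale c x) = c * p x"
  obtains z where "z \<in> N" "\<And>x. x \<in> N \<Longrightarrow> p x = \<chi> (x * z)"
proof -
  have "p 0 = 0" using assms(2)[OF one_N, of 0] by simp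
  then have "p x = 0" if "x \<in> N" "\<And>y. y \<in> N \<Longrightarrow> \<chi> (x * y) = 0" for x
    using chi_nondegenerate_on[OF that] by simp
  then show ?thesis using functional_as_chi[OF subspace_N assms] that by metis
qed

text \<open>
  The element \<open>L\<close> that represents \<open>\<epsilon>\<close> is a two-sided integral with \<open>\<chi>(L) = \<epsilon>(1) = 1\<close>. If \<open>\<epsilon>(L)\<close> were zero, then
  \<open>L\<^sup>2 = 0\<close> and the trace of \<open>L\<close> would vanish; so \<open>L\<close> can be normalised.
\<close>

lemma idempotent_integral_exists:
  obtains L where "is_idempotent_integral \<epsilon> scale N L" "\<chi> L \<noteq> 0"
proof -
  obtain L where L: "L \<in> N" and eps: "\<And>x. x \<in> N \<Longrightarrow> \<epsilon> x = \<chi> (x * L)"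
    by (rule functional_on_as_chi[of \<epsilon>])
      (simp_all add: linear_addD[OF counit_linear] linear_scaleD[OF counit_linear])
  have left: "y * L = scale (\<epsilon> y) L" if y: "y \<in> N" for y
  proof (rule chi_cancel_on)
    fix u assume u: "u \<in> N"
    have "\<chi> (u * (y * L)) = \<epsilon> (u * y)" using eps[OF mult_N[OF u y]] by (simp add: mult.assoc)
    then show "\<chi> (u * (y * L)) = \<chi> (u * scale (\<epsilon> y) L)"
      using eps[OF u] by (simp add: counit_mult scale_mult_right[symmetric] linear_scaleD[OF linear_chi])
  qed (use y L mult_N scale_N in auto)
  have right: "L * y = scale (\<epsilon> y) L" if y: "y \<in> N" for y
  proof (rule chi_cancel_on)
    fix u assume u: "u \<in> N"
    have "\<chi> (u * (L * y)) = \<chi> (y * u * L)" using chi_commute[of "u * L" y] by (simp add: mult.assoc)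
    also have "\<dots> = \<epsilon> (y * u)" using eps[OF mult_N[OF y u]] by simp
    finally show "\<chi> (u * (L * y)) = \<chi> (u * scale (\<epsilon> y) L)"
      using eps[OF u] by (simp add: counit_mult scale_mult_right[symmetric] linear_scaleD[OF linear_chi])
  qed (use y L mult_N scale_N in auto)
  have chiL: "\<chi> L = 1" using eps[OF one_N] by (simp add: counit_one)
  have e: "\<epsilon> L \<noteq> 0"
  proof
    assume "\<epsilon> L = 0"
    then have "L * L = 0" using left[OF L] by simp
    then show False using square_zero_trace chiL by simp
  qed
  define L' where "L' = scale (1 / \<epsilon> L) L"
  have eps': "\<epsilon> L' = 1" using e by (simp add: L'_def linear_scaleD[OF counit_linear])
  have L'N: "L' \<in> N" using L by (simp add: L'_def scale_N)
  have int: "y * L' = scale (\<epsilon> y) L'" "L' * y = scale (\<epsilon> y) L'" if "y \<in> N" for y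
    using left[OF that] right[OF that]
    by (simp_all add: L'_def scale_mult_right[symmetric] scale_mult_left[symmetric] mult.commute)
  have "is_idempotent_integral \<epsilon> scale N L'"
    unfolding is_idempotent_integral_def using L'N eps' int[OF L'N] int by simp
  moreover have "\<chi> L' \<noteq> 0" using e chiL by (simp add: L'_def linear_scaleD[OF linear_chi])
  ultimately show ?thesis by (rule that)
qed

lemma regular_character_eq_chi: "regular_character scale = \<chi>"
  by (simp add: regular_character_def rep_character_def restrict_to_def \<chi>_def fun_eq_iff)

definition \<kappa> :: 'k where "\<kappa> = lambda_B scale \<epsilon> N 1"

lemma kappa_nonzero: "\<kappa> \<noteq> 0"
proof -
  obtain L where L: "is_idempotent_integral \<epsilon> scale N L" "\<chi> L \<noteq> 0" by (rule idempotent_integral_exists)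
  have "integral_of scale \<epsilon> N = L"
    unfolding integral_of_def
  proof (rule the_equality)
    show "is_idempotent_integral \<epsilon> scale N L" by (rule L(1))
    fix L' assume L': "is_idempotent_integral \<epsilon> scale N L'"
    have "L' * L = L" "L' * L = L'"
      using L(1) L' unfolding is_idempotent_integral_def by auto
    then show "L' = L" by simp
  qed
  then show ?thesis
    using L(2) by (simp add: \<kappa>_def lambda_B_def hit_def restrict_to_def regular_character_eq_chi)
qed

abbreviation F where "F \<equiv> F_map scale \<epsilon> N"

lemma F_map_on: "n \<in> N \<Longrightarrow> x \<in> N \<Longrightarrow> F n x = \<chi> (x * n) / \<kappa>"
  using mult_N by (simp add: F_map_def hit_def restrict_to_def regular_character_eq_chi \<kappa>_def)

lemma F_map_outside: "x \<notin> N \<Longrightarrow> F n x = 0"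
  by (simp add: F_map_def hit_def restrict_to_def)

lemma F_map_bij: "bij_betw F N (dual_space scale N)"
  unfolding bij_betw_def
proof (intro conjI subset_antisym subsetI)
  show "inj_on F N"
  proof (rule inj_onI)
    fix n n' assume n: "n \<in> N" "n' \<in> N" "F n = F n'"
    show "n = n'"
    proof (rule chi_cancel_on[OF n(1,2)])
      fix y assume "y \<in> N"
      then show "\<chi> (y * n) = \<chi> (y * n')"
        using fun_cong[OF n(3), of y] n(1,2) kappa_nonzero by (simp add: F_map_on)
    qed
  qed
next
  fix p assume "p \<in> F ` N"
  then obtain n where n: "n \<in> N" "p = F n" by blast
  then show "p \<in> dual_space scale N"
    by (simp add: dual_space_def F_map_on add_N scale_N distrib_right scale_mult_left[symmetric]
        linear_addD[OF linear_chi] linear_scaleD[OF linear_chi] add_divide_distrib F_map_outside)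
next
  fix p assume p: "p \<in> dual_space scale N"
  obtain z where z: "z \<in> N" "\<And>x. x \<in> N \<Longrightarrow> p x = \<chi> (x * z)"
    by (rule functional_on_as_chi[of p]) (use p in \<open>auto simp: dual_space_def\<close>)
  have "p = F (scale \<kappa> z)"
  proof
    fix x
    show "p x = F (scale \<kappa> z) x"
    proof (cases "x \<in> N")
      case True
      then show ?thesis using z kappa_nonzero
        by (simp add: F_map_on scale_N scale_mult_right[symmetric] linear_scaleD[OF linear_chi])
    next
      case False
      then show ?thesis using p by (simp add: dual_space_def F_map_outside)
    qed
  qed
  then show "p \<in> F ` N" using scale_N[OF z(1)] by blast
qed

definition F_inv :: "('h \<Rightarrow> 'k) \<Rightarrow> 'h" where "F_inv = the_inv_into N F"

lemma F_inv_in: "p \<in> dual_space scale N \<Longrightarrow> F_inv p \<in> N"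
  unfolding F_inv_def using bij_betw_the_inv_into[OF F_map_bij] by (auto simp: bij_betw_def)

lemma F_inv_apply: "p \<in> dual_space scale N \<Longrightarrow> x \<in> N \<Longrightarrow> p x = \<chi> (x * F_inv p) / \<kappa>"
  using f_the_inv_into_f_bij_betw[OF F_map_bij, of p] F_map_on[OF F_inv_in[of p], of x]
  by (simp add: F_inv_def)

lemma F_inv_F: "n \<in> N \<Longrightarrow> F_inv (F n) = n"
  unfolding F_inv_def using F_map_bij by (intro the_inv_into_f_f) (auto simp: bij_betw_def)

lemma form_N_eq: "form_N scale \<epsilon> N p q = q (F_inv p)"
  by (simp add: form_N_def F_inv_def)

lemma form_N_commute:
  assumes "p \<in> dual_space scale N" "q \<in> dual_space scale N"
  shows "form_N scale \<epsilon> N p q = form_N scale \<epsilon> N q p"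
  using F_inv_apply[OF assms(1) F_inv_in[OF assms(2)]] F_inv_apply[OF assms(2) F_inv_in[OF assms(1)]]
  by (simp add: form_N_eq chi_commute[of "F_inv p"])

lemma form_N_symmetric: "symmetric_form_on (dual_space scale N) (form_N scale \<epsilon> N)"
  unfolding symmetric_form_on_def using form_N_commute by blast

lemma dual_space_add: "p \<in> dual_space scale N \<Longrightarrow> q \<in> dual_space scale N \<Longrightarrow> (\<lambda>x. p x + q x) \<in> dual_space scale N"
  and dual_space_scale: "p \<in> dual_space scale N \<Longrightarrow> (\<lambda>x. a * p x) \<in> dual_space scale N"
  by (auto simp: dual_space_def algebra_simps)

lemma form_N_bilinear: "bilinear_form_on (dual_space scale N) (form_N scale \<epsilon> N)"
  unfolding bilinear_form_on_def
proof (intro conjI ballI allI)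
  fix p q r a assume p: "p \<in> dual_space scale N" and q: "q \<in> dual_space scale N"
  show "form_N scale \<epsilon> N p (\<lambda>x. a * q x) = a * form_N scale \<epsilon> N p q" by (simp add: form_N_eq)
  show "form_N scale \<epsilon> N (\<lambda>x. a * p x) q = a * form_N scale \<epsilon> N p q"
    by (simp only: form_N_commute[OF dual_space_scale[OF p] q] form_N_commute[OF p q]) (simp add: form_N_eq)
  assume r: "r \<in> dual_space scale N"
  show "form_N scale \<epsilon> N p (\<lambda>x. q x + r x) = form_N scale \<epsilon> N p q + form_N scale \<epsilon> N p r"
    by (simp add: form_N_eq)
  show "form_N scale \<epsilon> N (\<lambda>x. p x + q x) r = form_N scale \<epsilon> N p r + form_N scale \<epsilon> N q r"
    by (simp only: form_N_commute[OF dual_space_add[OF p q] r] form_N_commute[OF p r] form_N_commute[OF q r])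
      (simp add: form_N_eq)
qed

lemma form_N_nondegenerate: "nondegenerate_form_on (dual_space scale N) (form_N scale \<epsilon> N)"
proof -
  have "p = (\<lambda>_. 0)" if p: "p \<in> dual_space scale N" and 0: "\<forall>q\<in>dual_space scale N. form_N scale \<epsilon> N q p = 0" for p
  proof
    fix x
    show "p x = 0"
    proof (cases "x \<in> N")
      case True
      then have "F x \<in> dual_space scale N" using F_map_bij by (auto simp: bij_betw_def)
      then have "form_N scale \<epsilon> N (F x) p = 0" using 0 by blast
      then show ?thesis by (simp add: form_N_eq F_inv_F[OF True])
    qed (use p in \<open>simp add: dual_space_def\<close>)
  qed
  then show ?thesis
    unfolding nondegenerate_form_on_def using form_N_commute by metis
qed

section \<open>Irreducible characters\<close>

lemma representationD:
  assumes "is_representation scale N sV \<rho>"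
  shows "vector_space sV" "\<And>n. n \<in> N \<Longrightarrow> Vector_Spaces.linear sV sV (\<rho> n)"
    "\<And>m n v. m \<in> N \<Longrightarrow> n \<in> N \<Longrightarrow> \<rho> (m + n) v = \<rho> m v + \<rho> n v"
    "\<And>a n v. n \<in> N \<Longrightarrow> \<rho> (scale a n) v = sV a (\<rho> n v)"
    "\<And>v. \<rho> 1 v = v" "\<And>m n v. m \<in> N \<Longrightarrow> n \<in> N \<Longrightarrow> \<rho> (m * n) v = \<rho> m (\<rho> n v)"
  using assms by (auto simp: is_representation_def)

lemma irreducible_orbit:
  assumes irr: "irreducible_representation scale N sV \<rho>"
    and J: "subspace J" "J \<subseteq> N" "\<And>n a. n \<in> N \<Longrightarrow> a \<in> J \<Longrightarrow> n * a \<in> J"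
    and a: "a \<in> J" "\<rho> a v \<noteq> 0"
  shows "\<exists>a\<in>J. \<rho> a v = u"
proof -
  have rep: "is_representation scale N sV \<rho>" using irr by (simp add: irreducible_representation_def)
  note R = representationD[OF rep]
  interpret V: vector_space sV by (rule R(1))
  let ?W = "(\<lambda>a. \<rho> a v) ` J"
  have "V.subspace ?W"
  proof (rule V.subspaceI)
    have "\<rho> (scale 0 a) v = 0" using R(4)[of a 0 v] a(1) J(2) by auto
    then show "0 \<in> ?W" using subspace_scale[OF J(1) a(1), of 0] by (metis imageI)
  next
    fix x y assume "x \<in> ?W" "y \<in> ?W"
    then obtain a b where ab: "a \<in> J" "b \<in> J" "x = \<rho> a v" "y = \<rho> b v" by blast
    then have "x + y = \<rho> (a + b) v" using R(3) J(2) by (metis subsetD)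
    then show "x + y \<in> ?W" using subspace_add[OF J(1) ab(1,2)] by blast
  next
    fix t x assume "x \<in> ?W"
    then obtain a where ab: "a \<in> J" "x = \<rho> a v" by blast
    then have "sV t x = \<rho> (scale t a) v" using R(4) J(2) by (metis subsetD)
    then show "sV t x \<in> ?W" using subspace_scale[OF J(1) ab(1)] by blast
  qed
  moreover have "\<forall>n\<in>N. \<forall>x\<in>?W. \<rho> n x \<in> ?W"
  proof (intro ballI)
    fix n x assume n: "n \<in> N" and "x \<in> ?W"
    then obtain a where ab: "a \<in> J" "x = \<rho> a v" by blast
    then have "\<rho> n x = \<rho> (n * a) v" using R(6)[OF n] J(2) by (metis subsetD)
    then show "\<rho> n x \<in> ?W" using J(3)[OF n ab(1)] by blast
  qed
  moreover have "?W \<noteq> {0}" using a by blast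
  ultimately have "?W = UNIV"
    using irr unfolding irreducible_representation_def by blast
  then show ?thesis by (metis (mono_tags, lifting) UNIV_I imageE)
qed

lemma irreducible_finite_dimensional:
  fixes sV :: "'k \<Rightarrow> 'v::ab_group_add \<Rightarrow> 'v"
  assumes irr: "irreducible_representation scale N sV \<rho>"
  obtains B where "finite_dimensional_vector_space sV B"
proof -
  have rep: "is_representation scale N sV \<rho>" using irr by (simp add: irreducible_representation_def)
  note R = representationD[OF rep]
  interpret V: vector_space sV by (rule R(1))
  obtain v :: 'v where v: "v \<noteq> 0" using irr by (auto simp: irreducible_representation_def)
  obtain C where C: "C \<subseteq> N" "independent C" "N \<subseteq> span C" using basis_exists[of N] by metis
  have finC: "finite C" by (rule finiteI_independent[OF C(2)])
  have span: "a \<in> N \<and> \<rho> a v \<in> V.span ((\<lambda>a. \<rho> a v) ` C)" if "a \<in> span C" for a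
    using that
  proof (induction rule: span_induct_alt)
    case base
    have "\<rho> (scale 0 1) v = 0" using R(4)[OF one_N, of 0 v] by simp
    then show ?case using subspace_0[OF subspace_N] by (simp add: V.span_zero)
  next
    case (step t x y)
    then have "x \<in> N" using C by blast
    then show ?case
      using step by (simp add: R(3,4) scale_N add_N V.span_add V.span_scale V.span_base)
  qed
  have spanV: "u \<in> V.span ((\<lambda>a. \<rho> a v) ` C)" for u
  proof -
    have "\<rho> 1 v \<noteq> 0" using v by (simp add: R(5))
    then obtain a where "a \<in> N" "\<rho> a v = u"
      using irreducible_orbit[OF irr subspace_N order_refl mult_N one_N, of v u] by blast
    then show ?thesis using span C(3) by blast
  qed
  let ?B = "V.extend_basis {}"
  have B: "V.independent ?B" "V.span ?B = UNIV"
    by (rule V.independent_extend_basis[OF V.independent_empty], rule V.span_extend_basis[OF V.independent_empty])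
  have "finite ?B"
    using V.independent_span_bound[OF finite_imageI[OF finC, of "\<lambda>a. \<rho> a v"] B(1)] spanV by blast
  then have "finite_dimensional_vector_space sV ?B"
    using B by unfold_locales auto
  then show ?thesis by (rule that)
qed

lemma rep_character_on: "n \<in> N \<Longrightarrow> rep_character N sV \<rho> n = lin_trace sV (\<rho> n)"
  by (simp add: rep_character_def restrict_to_def)

lemma rep_character_in_dual:
  assumes irr: "irreducible_representation scale N sV \<rho>"
  shows "rep_character N sV \<rho> \<in> dual_space scale N"
proof -
  have rep: "is_representation scale N sV \<rho>" using irr by (simp add: irreducible_representation_def)
  note R = representationD[OF rep]
  obtain B where "finite_dimensional_vector_space sV B" by (rule irreducible_finite_dimensional[OF irr])
  then interpret V: finite_dimensional_vector_space sV B .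
  have "lin_trace sV (\<rho> (x + y)) = lin_trace sV (\<rho> x) + lin_trace sV (\<rho> y)" if "x \<in> N" "y \<in> N" for x y
  proof -
    have "\<rho> (x + y) = (\<lambda>v. \<rho> x v + \<rho> y v)" using R(3)[OF that] by auto
    then show ?thesis using V.lin_trace_add[OF R(2)[OF that(1)] R(2)[OF that(2)]] by simp
  qed
  moreover have "lin_trace sV (\<rho> (scale a x)) = a * lin_trace sV (\<rho> x)" if "x \<in> N" for a x
  proof -
    have "\<rho> (scale a x) = (\<lambda>v. sV a (\<rho> x v))" using R(4)[OF that] by auto
    then show ?thesis using V.lin_trace_scale by simp
  qed
  ultimately show ?thesis
    by (simp add: dual_space_def rep_character_on add_N scale_N) (simp add: rep_character_def restrict_to_def)
qed

lemma rep_character_commute: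
  assumes irr: "irreducible_representation scale N sV \<rho>" and "m \<in> N" "n \<in> N"
  shows "rep_character N sV \<rho> (m * n) = rep_character N sV \<rho> (n * m)"
proof -
  have rep: "is_representation scale N sV \<rho>" using irr by (simp add: irreducible_representation_def)
  note R = representationD[OF rep]
  obtain B where "finite_dimensional_vector_space sV B" by (rule irreducible_finite_dimensional[OF irr])
  then interpret V: finite_dimensional_vector_space sV B .
  have "\<rho> (m * n) = (\<lambda>v. \<rho> m (\<rho> n v))" "\<rho> (n * m) = (\<lambda>v. \<rho> n (\<rho> m v))"
    using R(6) assms(2,3) by auto
  then show ?thesis
    using V.lin_trace_commute[OF R(2)[OF assms(2)] R(2)[OF assms(3)]]
    by (simp add: rep_character_on mult_N assms(2,3))
qed

lemma F_inv_character_central: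
  assumes irr: "irreducible_representation scale N sV \<rho>" and y: "y \<in> N"
  shows "y * F_inv (rep_character N sV \<rho>) = F_inv (rep_character N sV \<rho>) * y"
proof -
  let ?p = "rep_character N sV \<rho>"
  note p = rep_character_in_dual[OF irr]
  show ?thesis
  proof (rule chi_cancel_on)
    fix x assume x: "x \<in> N"
    have "\<chi> (x * (y * F_inv ?p)) = \<kappa> * ?p (x * y)"
      using F_inv_apply[OF p mult_N[OF x y]] kappa_nonzero by (simp add: mult.assoc)
    also have "\<dots> = \<kappa> * ?p (y * x)" by (simp add: rep_character_commute[OF irr x y])
    also have "\<dots> = \<chi> (y * x * F_inv ?p)"
      using F_inv_apply[OF p mult_N[OF y x]] kappa_nonzero by simp
    also have "\<dots> = \<chi> (x * (F_inv ?p * y))"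
      using chi_commute[of y "x * F_inv ?p"] by (simp add: mult.assoc)
    finally show "\<chi> (x * (y * F_inv ?p)) = \<chi> (x * (F_inv ?p * y))" .
  qed (use y F_inv_in[OF p] mult_N in auto)
qed

lemma F_inv_character_annihilated:
  assumes irr: "irreducible_representation scale N sV \<rho>" and x: "x \<in> N" "\<And>v. \<rho> x v = 0"
  shows "x * F_inv (rep_character N sV \<rho>) = 0"
proof -
  let ?p = "rep_character N sV \<rho>"
  note p = rep_character_in_dual[OF irr]
  have rep: "is_representation scale N sV \<rho>" using irr by (simp add: irreducible_representation_def)
  note R = representationD[OF rep]
  obtain B where "finite_dimensional_vector_space sV B" by (rule irreducible_finite_dimensional[OF irr])
  then interpret V: finite_dimensional_vector_space sV B .
  show ?thesis
  proof (rule chi_cancel_on)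
    fix y assume y: "y \<in> N"
    interpret l: Vector_Spaces.linear sV sV "\<rho> y" by (rule R(2)[OF y])
    have "\<rho> (y * x) = (\<lambda>v. 0)" using R(6)[OF y x(1)] x(2) by (auto simp: l.zero)
    then have "?p (y * x) = 0"
      by (simp add: rep_character_on mult_N x(1) y V.lin_trace_zero)
    then show "\<chi> (y * (x * F_inv ?p)) = \<chi> (y * 0)"
      using F_inv_apply[OF p mult_N[OF y x(1)]] kappa_nonzero by (simp add: mult.assoc linear_zeroD[OF linear_chi])
  qed (use x F_inv_in[OF p] mult_N subspace_0[OF subspace_N] in auto)
qed

text \<open>
  Fix \<open>w \<noteq> 0\<close> in \<open>W\<close> and a finite basis of \<open>V\<close>. Among the sets \<open>T\<close> of basis vectors whose common annihilator \<open>J T\<close> in \<open>N\<close>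
  does not kill \<open>w\<close>, choose a largest one. It is not the whole basis, and for a further basis vector \<open>b\<close> every
  \<open>a \<in> J T\<close> with \<open>a b = 0\<close> kills \<open>w\<close>. So \<open>a b \<mapsto> a w\<close> is a well-defined isomorphism from \<open>V = (J T) b\<close> to
  \<open>W = (J T) w\<close>.
\<close>

lemma rep_character_eq_if_annihilator_subset:
  fixes sV :: "'k \<Rightarrow> 'v::ab_group_add \<Rightarrow> 'v" and sW :: "'k \<Rightarrow> 'w::ab_group_add \<Rightarrow> 'w"
  assumes V: "irreducible_representation scale N sV \<rho>" and W: "irreducible_representation scale N sW \<sigma>"
    and ann: "\<And>x. x \<in> N \<Longrightarrow> (\<And>v. \<rho> x v = 0) \<Longrightarrow> (\<And>w. \<sigma> x w = 0)"
  shows "rep_character N sV \<rho> = rep_character N sW \<sigma>"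
proof -
  have repV: "is_representation scale N sV \<rho>" and repW: "is_representation scale N sW \<sigma>"
    using V W by (simp_all add: irreducible_representation_def)
  note R = representationD[OF repV] and Q = representationD[OF repW]
  obtain B where fdV: "finite_dimensional_vector_space sV B" by (rule irreducible_finite_dimensional[OF V])
  obtain B' where fdW: "finite_dimensional_vector_space sW B'" by (rule irreducible_finite_dimensional[OF W])
  interpret V: finite_dimensional_vector_space sV B by (rule fdV)
  interpret W: finite_dimensional_vector_space sW B' by (rule fdW)
  have zV: "\<rho> n 0 = 0" if "n \<in> N" for n
  proof -
    interpret l: Vector_Spaces.linear sV sV "\<rho> n" by (rule R(2)[OF that])
    show ?thesis by (rule l.zero)
  qed
  have zW: "\<sigma> n 0 = 0" if "n \<in> N" for n
  proof -
    interpret l: Vector_Spaces.linear sW sW "\<sigma> n" by (rule Q(2)[OF that])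
    show ?thesis by (rule l.zero)
  qed
  obtain w :: 'w where w: "w \<noteq> 0" using W by (auto simp: irreducible_representation_def)
  define J where "J T = {a \<in> N. \<forall>b\<in>T. \<rho> a b = 0}" for T
  have subJ: "subspace (J T)" for T
  proof (rule subspaceI)
    have "\<rho> 0 v = 0" for v using R(4)[OF one_N, of 0 v] by simp
    then show "0 \<in> J T" using subspace_0[OF subspace_N] by (simp add: J_def)
  qed (auto simp: J_def add_N scale_N R(3,4))
  have JN: "J T \<subseteq> N" for T by (auto simp: J_def)
  have JI: "n * a \<in> J T" if "n \<in> N" "a \<in> J T" for n a T
    using that by (auto simp: J_def mult_N R(6) zV)
  define P where "P T \<longleftrightarrow> T \<subseteq> B \<and> (\<exists>a\<in>J T. \<sigma> a w \<noteq> 0)" for T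
  have "\<sigma> 1 w \<noteq> 0" using w by (simp add: Q(5))
  then have "P {}" unfolding P_def J_def using one_N by blast
  moreover have "\<forall>T. P T \<longrightarrow> card T < Suc (card B)"
    using V.finite_Basis by (auto simp: P_def less_Suc_eq_le intro: card_mono)
  ultimately have "\<exists>T. P T \<and> (\<forall>T'. P T' \<longrightarrow> card T' \<le> card T)"
    by (rule ex_has_greatest_nat)
  then obtain T where T: "P T" and max: "\<And>T'. P T' \<Longrightarrow> card T' \<le> card T" by blast
  obtain a0 where a0: "a0 \<in> J T" "\<sigma> a0 w \<noteq> 0" using T by (auto simp: P_def)
  have "T \<noteq> B"
  proof
    assume "T = B"
    then have "a0 \<in> N" and 0: "\<forall>b\<in>B. \<rho> a0 b = 0" using a0(1) by (auto simp: J_def)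
    interpret l: Vector_Spaces.linear sV sV "\<rho> a0" by (rule R(2)[OF \<open>a0 \<in> N\<close>])
    have "\<rho> a0 v = 0" for v
      using l.eq_0_on_span[of B v] 0 V.span_Basis by simp
    then show False using ann[OF \<open>a0 \<in> N\<close>] a0(2) by blast
  qed
  then obtain b where b: "b \<in> B" "b \<notin> T" using T by (auto simp: P_def)
  have kill: "\<sigma> a w = 0" if a: "a \<in> J T" "\<rho> a b = 0" for a
  proof (rule ccontr)
    assume "\<sigma> a w \<noteq> 0"
    then have "P (insert b T)" using T a b by (auto simp: P_def J_def)
    moreover have "finite T" using T V.finite_Basis by (auto simp: P_def intro: finite_subset)
    ultimately show False using max[of "insert b T"] b(2) by simp
  qed
  have "\<rho> a0 b \<noteq> 0" using kill a0 by blast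
  note orbV = irreducible_orbit[OF V subJ JN JI a0(1) this]
  note orbW = irreducible_orbit[OF W subJ JN JI a0]
  define A where "A v = (SOME a. a \<in> J T \<and> \<rho> a b = v)" for v
  have A: "A v \<in> J T" "\<rho> (A v) b = v" for v
    using someI_ex[of "\<lambda>a. a \<in> J T \<and> \<rho> a b = v"] orbV[of v] unfolding A_def by blast+
  define \<phi> where "\<phi> v = \<sigma> (A v) w" for v
  have diffV: "\<rho> (a - a') v = \<rho> a v - \<rho> a' v" and diffW: "\<sigma> (a - a') u = \<sigma> a u - \<sigma> a' u"
    if "a \<in> N" "a' \<in> N" for a a' v u
    using R(3)[OF subspace_diff[OF subspace_N that] that(2), of v]
      Q(3)[OF subspace_diff[OF subspace_N that] that(2), of u] by simp_all
  have phi: "\<phi> (\<rho> a b) = \<sigma> a w" if a: "a \<in> J T" for a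
  proof -
    have AN: "A (\<rho> a b) \<in> N" "a \<in> N" using A(1) a JN by blast+
    have "\<rho> (A (\<rho> a b) - a) b = 0" using diffV[OF AN] A(2) by simp
    then have "\<sigma> (A (\<rho> a b) - a) w = 0"
      by (intro kill subspace_diff[OF subJ A(1) a])
    then show ?thesis using diffW[OF AN] by (simp add: \<phi>_def)
  qed
  have phi_add: "\<phi> (v + v') = \<phi> v + \<phi> v'" for v v'
  proof -
    have N: "A v \<in> N" "A v' \<in> N" using A(1) JN by blast+
    have "\<phi> (\<rho> (A v + A v') b) = \<sigma> (A v + A v') w" by (rule phi[OF subspace_add[OF subJ A(1) A(1)]])
    then show ?thesis by (simp add: R(3)[OF N] Q(3)[OF N] A(2)) (simp add: \<phi>_def)
  qed
  have phi_scale: "\<phi> (sV t v) = sW t (\<phi> v)" for t v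
  proof -
    have N: "A v \<in> N" using A(1) JN by blast
    have "\<phi> (\<rho> (scale t (A v)) b) = \<sigma> (scale t (A v)) w" by (rule phi[OF subspace_scale[OF subJ A(1)]])
    then show ?thesis by (simp add: R(4)[OF N] Q(4)[OF N] A(2)) (simp add: \<phi>_def)
  qed
  have phi_rep: "\<phi> (\<rho> n v) = \<sigma> n (\<phi> v)" if n: "n \<in> N" for n v
  proof -
    have N: "A v \<in> N" using A(1) JN by blast
    have "\<phi> (\<rho> (n * A v) b) = \<sigma> (n * A v) w" by (rule phi[OF JI[OF n A(1)]])
    then show ?thesis by (simp add: R(6)[OF n N] Q(6)[OF n N] A(2)) (simp add: \<phi>_def)
  qed
  have phi_lin: "Vector_Spaces.linear sV sW \<phi>"
    by (simp add: Vector_Spaces.linear_iff V.vector_space_axioms W.vector_space_axioms phi_add phi_scale)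
  interpret phi: Vector_Spaces.linear sV sW \<phi> by (rule phi_lin)
  have surj: "\<exists>v. \<phi> v = u" for u
    using orbW[of u] phi by metis
  let ?K = "{v. \<phi> v = 0}"
  have "V.subspace ?K \<and> (\<forall>n\<in>N. \<forall>v\<in>?K. \<rho> n v \<in> ?K)"
    using phi.subspace_kernel by (auto simp: phi_rep zW)
  then have "?K = {0} \<or> ?K = UNIV"
    using V unfolding irreducible_representation_def by blast
  moreover have "\<rho> a0 b \<notin> ?K" using phi[OF a0(1)] a0(2) by simp
  then have "?K \<noteq> UNIV" by blast
  ultimately have ker: "?K = {0}" by blast
  have inj: "v = v'" if "\<phi> v = \<phi> v'" for v v'
  proof -
    have "v - v' \<in> ?K" using that by (simp add: phi.diff)
    then show ?thesis using ker by simp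
  qed
  define \<psi> where "\<psi> u = (SOME v. \<phi> v = u)" for u
  have phi_psi: "\<phi> (\<psi> u) = u" for u unfolding \<psi>_def using someI_ex[OF surj[of u]] .
  have psi_phi: "\<psi> (\<phi> v) = v" for v by (rule inj) (rule phi_psi)
  have psi_lin: "Vector_Spaces.linear sW sV \<psi>"
    unfolding Vector_Spaces.linear_iff
  proof (intro conjI allI)
    show "\<psi> (x + y) = \<psi> x + \<psi> y" for x y by (rule inj) (simp add: phi_psi phi_add)
    show "\<psi> (sW t x) = sV t (\<psi> x)" for t x by (rule inj) (simp add: phi_psi phi_scale)
  qed (rule W.vector_space_axioms V.vector_space_axioms)+
  show ?thesis
  proof
    fix n
    show "rep_character N sV \<rho> n = rep_character N sW \<sigma> n"
    proof (cases "n \<in> N")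
      case True
      have "lin_trace sW (\<sigma> n) = lin_trace sV (\<rho> n)"
        by (rule lin_trace_conjugate[OF fdV fdW phi_lin psi_lin psi_phi phi_psi R(2)[OF True]])
          (simp add: phi_rep[OF True])
      then show ?thesis by (simp add: rep_character_on True)
    qed (simp add: rep_character_def restrict_to_def)
  qed
qed

text \<open>
  The central element \<open>F\<^sub>N\<inverse> (\<chi>\<^sub>V)\<close> maps \<open>W\<close> onto a submodule. If this is all of \<open>W\<close>, the annihilator of \<open>V\<close> kills
  \<open>W\<close> and the characters coincide; otherwise the element acts as zero and its trace on \<open>W\<close> vanishes.
\<close>

lemma characters_orthogonal:
  fixes sV :: "'k \<Rightarrow> 'v::ab_group_add \<Rightarrow> 'v" and sW :: "'k \<Rightarrow> 'w::ab_group_add \<Rightarrow> 'w"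
  assumes V: "irreducible_representation scale N sV \<rho>" and W: "irreducible_representation scale N sW \<sigma>"
    and ne: "rep_character N sV \<rho> \<noteq> rep_character N sW \<sigma>"
  shows "form_N scale \<epsilon> N (rep_character N sV \<rho>) (rep_character N sW \<sigma>) = 0"
proof -
  let ?u = "F_inv (rep_character N sV \<rho>)"
  have u: "?u \<in> N" by (rule F_inv_in[OF rep_character_in_dual[OF V]])
  have repW: "is_representation scale N sW \<sigma>"
    using W by (simp add: irreducible_representation_def)
  note Q = representationD[OF repW]
  obtain B' where "finite_dimensional_vector_space sW B'" by (rule irreducible_finite_dimensional[OF W])
  then interpret W: finite_dimensional_vector_space sW B' .
  interpret l: Vector_Spaces.linear sW sW "\<sigma> ?u" by (rule Q(2)[OF u])
  have "\<sigma> ?u y = 0" for y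
  proof (rule ccontr)
    assume y: "\<sigma> ?u y \<noteq> 0"
    let ?U = "range (\<sigma> ?u)"
    have "\<sigma> n x \<in> ?U" if n: "n \<in> N" and x: "x \<in> ?U" for n x
    proof -
      obtain x' where "x = \<sigma> ?u x'" using x by blast
      then have "\<sigma> n x = \<sigma> ?u (\<sigma> n x')"
        using Q(6)[OF n u, of x'] Q(6)[OF u n, of x'] F_inv_character_central[OF V n] by simp
      then show ?thesis by blast
    qed
    moreover have "W.subspace ?U" using l.subspace_image[of UNIV] by simp
    ultimately have "?U = {0} \<or> ?U = UNIV"
      using W unfolding irreducible_representation_def by blast
    then have UNIV: "?U = UNIV" using y by blast
    have "\<sigma> x w = 0" if x: "x \<in> N" "\<And>v. \<rho> x v = 0" for x w
    proof -
      obtain w' where w': "w = \<sigma> ?u w'" using UNIV by (metis UNIV_I imageE)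
      have "\<sigma> x w = \<sigma> (x * ?u) w'" by (simp add: w' Q(6)[OF x(1) u])
      also have "x * ?u = scale 0 1" using F_inv_character_annihilated[OF V x] by simp
      also have "\<sigma> (scale 0 1) w' = 0" using Q(4)[OF one_N, of 0 w'] by simp
      finally show ?thesis .
    qed
    then have "rep_character N sV \<rho> = rep_character N sW \<sigma>"
      by (rule rep_character_eq_if_annihilator_subset[OF V W])
    then show False using ne by contradiction
  qed
  then have "\<sigma> ?u = (\<lambda>v. 0)" by auto
  then show ?thesis by (simp add: form_N_eq rep_character_on u W.lin_trace_zero)
qed

end

theorem theorem2p10:
  fixes scale :: "'k::{alg_closed_field, field_char_0} \<Rightarrow> 'h::ring_1 \<Rightarrow> 'h"
    and \<Delta> :: "'h \<Rightarrow> ('h \<times> 'h) list"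
    and \<epsilon> :: "'h \<Rightarrow> 'k"
    and S :: "'h \<Rightarrow> 'h"
    and N :: "'h set"
  assumes "hopf_algebra scale \<Delta> \<epsilon> S"
    and "semisimple_algebra scale"
    and "left_coideal_subalgebra scale \<Delta> N"
  shows "bilinear_form_on (dual_space scale N) (form_N scale \<epsilon> N) \<and>
         symmetric_form_on (dual_space scale N) (form_N scale \<epsilon> N) \<and>
         nondegenerate_form_on (dual_space scale N) (form_N scale \<epsilon> N) \<and>
         (\<forall>(scaleV :: 'k \<Rightarrow> 'v::ab_group_add \<Rightarrow> 'v) \<rho> (scaleW :: 'k \<Rightarrow> 'w::ab_group_add \<Rightarrow> 'w) \<sigma>.
            irreducible_representation scale N scaleV \<rho> \<longrightarrow>
            irreducible_representation scale N scaleW \<sigma> \<longrightarrow>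
            rep_character N scaleV \<rho> \<noteq> rep_character N scaleW \<sigma> \<longrightarrow>
            form_N scale \<epsilon> N (rep_character N scaleV \<rho>) (rep_character N scaleW \<sigma>) = 0)"
proof -
  interpret hopf_algebra scale \<Delta> \<epsilon> S by (rule assms(1))
  interpret left_coideal_subalgebra_of_semisimple scale \<Delta> \<epsilon> S N
    by unfold_locales (rule assms(2), rule assms(3))
  show ?thesis
    using form_N_bilinear form_N_symmetric form_N_nondegenerate characters_orthogonal by blast
qed

end
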